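(* Let $T$ be a locally finite, infinite tree with root $o$ in which every vertex has forward degree at least $2$, and consider a transient nearest neighbour random walk on $T$ such that $F(x,x^-)<1$ for every $x\in T\setminus\{o\}$ and $\lim_{x\to\infty} G(x,o) = 0$ (i.e. for every $\varepsilon>0$ there is a finite set outside of which $G(\cdot,o)<\varepsilon$). Then $\phi = G(\cdot,o)$ is an ultrametric element on $T$, and the K-process on $\partial T$ induced by the Dirichlet form $\mathcal{E}_{HD}$ coincides with the standard process associated with the ultrametric element $\phi = G(\cdot,o)$ and the limit distribution $\nu_o$ of the random walk; that is, for all $\varphi,\psi\in\mathcal{D}(\partial T,P)$, $$\mathcal{E}_{HD}(\varphi,\psi) = \frac12\int_{\partial T}\int_{\partial T}(\varphi(\xi)-\varphi(\eta))(\psi(\xi)-\psi(\eta))\,J_{\phi,\nu_o}(\xi,\eta)\,d\nu_o(\xi)\,d\nu_o(\eta).$$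
   Context: Tree notation: for $x\neq o$, $x^-$ is the neighbour of $x$ on the geodesic from $o$ to $x$; forward degree of $x$ is $|\{y:y^-=x\}|$; $E(T)=\{[x^-,x]:x\neq o\}$. $\partial T$ is the space of ends (classes of geodesic rays modulo finite symmetric difference); $\pi(o,\xi)$ is the ray from $o$ to $\xi$; $T_x = \{y : x\in\text{geodesic from } o \text{ to } y\}$, $\partial T_x$ the ends represented by rays in $T_x$; for $\xi\neq\eta$, $\xi\wedge\eta$ is the last common vertex of $\pi(o,\xi),\pi(o,\eta)$. An ultrametric element is $\phi:T\to(0,\infty)$ with $\phi(x^-)>\phi(x)$ ($x\ne o$) and $\phi\to0$ along every geodesic ray; it gives the ultrametric $d_\phi(\xi,\eta)=\phi(\xi\wedge\eta)$ ($\xi\ne\eta$) with closed balls $B_\phi(\xi,r)$. Random walk: stochastic matrix $p(x,y)>0$ iff $x\sim y$; $G(x,y)=\sum_n p^{(n)}(x,y)<\infty$ (transience); $F(x,y)$ the probability of ever reaching $y$ from $x$; $\nu_x$ the distribution of the almost sure limit end $Z_\infty$ of the walk started at $x$; Poisson transform $h_\varphi(x)=\int\varphi\,d\nu_x$. Let $\mathsf{m}(o)=1$, $\mathsf{m}(x)=\prod_{i=1}^k p(x_{i-1},x_i)/p(x_i,x_{i-1})$ for $\pi(o,x)=[x_0=o,\dots,x_k=x]$, $a(x^-,x)=\mathsf{m}(x)p(x,x^-)$, $\mathcal{E}_T(f,g)=\sum_{[x^-,x]\in E(T)}(f(x)-f(x^-))(g(x)-g(x^-))a(x^-,x)$, $\mathcal{D}(\partial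 T,P)=\{\varphi\in L^1(\partial T,\nu_o):\mathcal{E}_T(h_\varphi,h_\varphi)<\infty\}$, $\mathcal{E}_{HD}(\varphi,\psi)=\mathcal{E}_T(h_\varphi,h_\psi)$. The K-process is the Markov process on $\partial T$ associated with the Dirichlet form $\mathcal{E}_{HD}$ (reference measure $\nu_o$). For an ultrametric element $\phi$ and a fully supported Borel probability measure $\mu$ on $\partial T$, the standard $(\phi,\mu)$-process is the Hunt process with Markov semigroup $P^tf(\xi)=\int P_rf(\xi)\,d\sigma_*^t(r)$, where $P_rf(\xi)=\mu(B_\phi(\xi,r))^{-1}\int_{B_\phi(\xi,r)}f\,d\mu$ and $\sigma_*^t([0,r))=e^{-t/r}$; its Dirichlet form is $\frac12\iint(u(\xi)-u(\eta))(v(\xi)-v(\eta))J_{\phi,\mu}(\xi,\eta)\,d\mu\,d\mu$ with $J_{\phi,\mu}(\xi,\eta)=\frac1{\phi(o)}+\int_{1/\phi(o)}^{1/\phi(\xi\wedge\eta)}\frac{dt}{\mu(B_\phi(\xi,1/t))}$ for $\xi\neq\eta$. Processes are identified via their Dirichlet forms. *)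

theory Defs
  imports "HOL-Analysis.Analysis" "HOL-Probability.Probability"
begin

text \<open>A rooted tree on the vertex type 'v is given by a rt and a parent map
  par (par x is the vertex x^- for x different from the rt; par rt is irrelevant).
  Every vertex reaches the rt by iterating par.\<close>

definition rooted_tree :: "('v \<Rightarrow> 'v) \<Rightarrow> 'v \<Rightarrow> bool" where
  "rooted_tree par rt \<longleftrightarrow> (\<forall>x. \<exists>n. (par ^^ n) x = rt)"

definition adj :: "('v \<Rightarrow> 'v) \<Rightarrow> 'v \<Rightarrow> 'v \<Rightarrow> 'v \<Rightarrow> bool" where
  "adj par rt x y \<longleftrightarrow> (x \<noteq> rt \<and> y = par x) \<or> (y \<noteq> rt \<and> x = par y)"

definition nbrs :: "('v \<Rightarrow> 'v) \<Rightarrow> 'v \<Rightarrow> 'v \<Rightarrow> 'v set" where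
  "nbrs par rt x = {y. adj par rt x y}"

definition children :: "('v \<Rightarrow> 'v) \<Rightarrow> 'v \<Rightarrow> 'v \<Rightarrow> 'v set" where
  "children par rt x = {y. y \<noteq> rt \<and> par y = x}"

definition anc :: "('v \<Rightarrow> 'v) \<Rightarrow> 'v \<Rightarrow> 'v \<Rightarrow> 'v set" where
  "anc par rt x = {(par ^^ k) x | k. k \<le> (LEAST n. (par ^^ n) x = rt)}"

definition nn_random_walk :: "('v \<Rightarrow> 'v) \<Rightarrow> 'v \<Rightarrow> ('v \<Rightarrow> 'v \<Rightarrow> real) \<Rightarrow> bool" where
  "nn_random_walk par rt p \<longleftrightarrow>
     (\<forall>x y. (p x y > 0 \<longleftrightarrow> adj par rt x y) \<and> p x y \<ge> 0) \<and>
     (\<forall>x. (\<Sum>y\<in>nbrs par rt x. p x y) = 1)"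

fun pstep :: "('v \<Rightarrow> 'v) \<Rightarrow> 'v \<Rightarrow> ('v \<Rightarrow> 'v \<Rightarrow> real) \<Rightarrow> nat \<Rightarrow> 'v \<Rightarrow> 'v \<Rightarrow> real" where
  "pstep par rt p 0 x y = (if x = y then 1 else 0)"
| "pstep par rt p (Suc n) x y = (\<Sum>z\<in>nbrs par rt x. p x z * pstep par rt p n z y)"

definition transient :: "('v \<Rightarrow> 'v) \<Rightarrow> 'v \<Rightarrow> ('v \<Rightarrow> 'v \<Rightarrow> real) \<Rightarrow> bool" where
  "transient par rt p \<longleftrightarrow> (\<forall>x y. summable (\<lambda>n. pstep par rt p n x y))"

definition Green :: "('v \<Rightarrow> 'v) \<Rightarrow> 'v \<Rightarrow> ('v \<Rightarrow> 'v \<Rightarrow> real) \<Rightarrow> 'v \<Rightarrow> 'v \<Rightarrow> real" where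
  "Green par rt p x y = (\<Sum>n. pstep par rt p n x y)"

fun fpass :: "('v \<Rightarrow> 'v) \<Rightarrow> 'v \<Rightarrow> ('v \<Rightarrow> 'v \<Rightarrow> real) \<Rightarrow> nat \<Rightarrow> 'v \<Rightarrow> 'v \<Rightarrow> real" where
  "fpass par rt p 0 x y = (if x = y then 1 else 0)"
| "fpass par rt p (Suc n) x y =
     (if x = y then 0 else (\<Sum>z\<in>nbrs par rt x. p x z * fpass par rt p n z y))"

definition Fhit :: "('v \<Rightarrow> 'v) \<Rightarrow> 'v \<Rightarrow> ('v \<Rightarrow> 'v \<Rightarrow> real) \<Rightarrow> 'v \<Rightarrow> 'v \<Rightarrow> real" where
  "Fhit par rt p x y = (\<Sum>n. fpass par rt p n x y)"

definition path_space :: "(nat \<Rightarrow> 'v) measure" where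
  "path_space = (\<Pi>\<^sub>M i\<in>(UNIV::nat set). count_space (UNIV::'v set))"

text \<open>Law of the random walk started at x (determined by its finite dimensional distributions).\<close>
definition walk_law :: "('v \<Rightarrow> 'v \<Rightarrow> real) \<Rightarrow> 'v \<Rightarrow> (nat \<Rightarrow> 'v) measure" where
  "walk_law p x = (THE M. sets M = sets path_space \<and> prob_space M \<and>
     (\<forall>n (f::nat \<Rightarrow> 'v). emeasure M {\<omega> \<in> space M. \<forall>i\<le>n. \<omega> i = f i} =
        ennreal (if f 0 = x then (\<Prod>i<n. p (f i) (f (Suc i))) else 0)))"

text \<open>Each end is represented by the unique geodesic ray from the rt pi(rt,xi).\<close>
definition rays :: "('v \<Rightarrow> 'v) \<Rightarrow> 'v \<Rightarrow> (nat \<Rightarrow> 'v) set" where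
  "rays par rt = {\<xi>. \<xi> 0 = rt \<and> (\<forall>n. \<xi> (Suc n) \<noteq> rt \<and> par (\<xi> (Suc n)) = \<xi> n)}"

definition bdry_cyl :: "('v \<Rightarrow> 'v) \<Rightarrow> 'v \<Rightarrow> 'v \<Rightarrow> (nat \<Rightarrow> 'v) set" where
  "bdry_cyl par rt x = {\<xi> \<in> rays par rt. x \<in> range \<xi>}"

text \<open>The boundary with its Borel sigma algebra (generated by the basic open sets \<partial>T_x).\<close>
definition bdry :: "('v \<Rightarrow> 'v) \<Rightarrow> 'v \<Rightarrow> (nat \<Rightarrow> 'v) measure" where
  "bdry par rt = sigma (rays par rt) (range (bdry_cyl par rt))"

definition geodesic_ray :: "('v \<Rightarrow> 'v) \<Rightarrow> 'v \<Rightarrow> (nat \<Rightarrow> 'v) \<Rightarrow> bool" where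
  "geodesic_ray par rt \<xi> \<longleftrightarrow>
     (\<forall>n. adj par rt (\<xi> n) (\<xi> (Suc n)) \<and> \<xi> (Suc (Suc n)) \<noteq> \<xi> n)"

definition converges_to_end :: "('v \<Rightarrow> 'v) \<Rightarrow> 'v \<Rightarrow> (nat \<Rightarrow> 'v) \<Rightarrow> (nat \<Rightarrow> 'v) \<Rightarrow> bool" where
  "converges_to_end par rt \<omega> \<xi> \<longleftrightarrow>
     (\<forall>k. \<exists>N. \<forall>m\<ge>N. \<xi> k \<in> anc par rt (\<omega> m))"

definition limit_end :: "('v \<Rightarrow> 'v) \<Rightarrow> 'v \<Rightarrow> (nat \<Rightarrow> 'v) \<Rightarrow> (nat \<Rightarrow> 'v)" where
  "limit_end par rt \<omega> = (THE \<xi>. \<xi> \<in> rays par rt \<and> converges_to_end par rt \<omega> \<xi>)"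

definition hit_distr :: "('v \<Rightarrow> 'v) \<Rightarrow> 'v \<Rightarrow> ('v \<Rightarrow> 'v \<Rightarrow> real) \<Rightarrow> 'v \<Rightarrow> (nat \<Rightarrow> 'v) measure" where
  "hit_distr par rt p x = distr (walk_law p x) (bdry par rt) (limit_end par rt)"

definition poisson :: "('v \<Rightarrow> 'v) \<Rightarrow> 'v \<Rightarrow> ('v \<Rightarrow> 'v \<Rightarrow> real) \<Rightarrow> ((nat \<Rightarrow> 'v) \<Rightarrow> real) \<Rightarrow> 'v \<Rightarrow> real" where
  "poisson par rt p \<phi> x = integral\<^sup>L (hit_distr par rt p x) \<phi>"

definition mweight :: "('v \<Rightarrow> 'v) \<Rightarrow> 'v \<Rightarrow> ('v \<Rightarrow> 'v \<Rightarrow> real) \<Rightarrow> 'v \<Rightarrow> real" where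
  "mweight par rt p x = (\<Prod>y\<in>anc par rt x - {rt}. p (par y) y / p y (par y))"

definition cond :: "('v \<Rightarrow> 'v) \<Rightarrow> 'v \<Rightarrow> ('v \<Rightarrow> 'v \<Rightarrow> real) \<Rightarrow> 'v \<Rightarrow> real" where
  "cond par rt p x = mweight par rt p x * p x (par x)"

definition energy_T :: "('v \<Rightarrow> 'v) \<Rightarrow> 'v \<Rightarrow> ('v \<Rightarrow> 'v \<Rightarrow> real) \<Rightarrow> ('v \<Rightarrow> real) \<Rightarrow> ('v \<Rightarrow> real) \<Rightarrow> real" where
  "energy_T par rt p f g =
     (\<Sum>\<^sub>\<infinity>x\<in>UNIV - {rt}. (f x - f (par x)) * (g x - g (par x)) * cond par rt p x)"

definition HD_domain :: "('v \<Rightarrow> 'v) \<Rightarrow> 'v \<Rightarrow> ('v \<Rightarrow> 'v \<Rightarrow> real) \<Rightarrow> ((nat \<Rightarrow> 'v) \<Rightarrow> real) set" where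
  "HD_domain par rt p = {\<phi>. integrable (hit_distr par rt p rt) \<phi> \<and>
     (\<lambda>x. (poisson par rt p \<phi> x - poisson par rt p \<phi> (par x))\<^sup>2 * cond par rt p x)
        summable_on (UNIV - {rt})}"

definition energy_HD :: "('v \<Rightarrow> 'v) \<Rightarrow> 'v \<Rightarrow> ('v \<Rightarrow> 'v \<Rightarrow> real) \<Rightarrow> ((nat \<Rightarrow> 'v) \<Rightarrow> real) \<Rightarrow> ((nat \<Rightarrow> 'v) \<Rightarrow> real) \<Rightarrow> real" where
  "energy_HD par rt p \<phi> \<psi> = energy_T par rt p (poisson par rt p \<phi>) (poisson par rt p \<psi>)"

definition ultrametric_element :: "('v \<Rightarrow> 'v) \<Rightarrow> 'v \<Rightarrow> ('v \<Rightarrow> real) \<Rightarrow> bool" where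
  "ultrametric_element par rt \<phi> \<longleftrightarrow>
     (\<forall>x. \<phi> x > 0) \<and> (\<forall>x. x \<noteq> rt \<longrightarrow> \<phi> (par x) > \<phi> x) \<and>
     (\<forall>\<xi>. geodesic_ray par rt \<xi> \<longrightarrow> (\<lambda>n. \<phi> (\<xi> n)) \<longlonglongrightarrow> 0)"

text \<open>Confluent xi \<and> eta: last common vertex of the rays (for xi different from eta).\<close>
definition meet :: "(nat \<Rightarrow> 'v) \<Rightarrow> (nat \<Rightarrow> 'v) \<Rightarrow> 'v" where
  "meet \<xi> \<eta> = \<xi> (GREATEST k. \<forall>i\<le>k. \<xi> i = \<eta> i)"

definition uball :: "('v \<Rightarrow> 'v) \<Rightarrow> 'v \<Rightarrow> ('v \<Rightarrow> real) \<Rightarrow> (nat \<Rightarrow> 'v) \<Rightarrow> real \<Rightarrow> (nat \<Rightarrow> 'v) set" where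
  "uball par rt \<phi> \<xi> r = {\<eta> \<in> rays par rt. \<eta> = \<xi> \<or> \<phi> (meet \<xi> \<eta>) \<le> r}"

text \<open>Jump kernel J_{phi,mu}(xi,eta) for xi different from eta (value on the diagonal irrelevant).\<close>
definition jump_kernel :: "('v \<Rightarrow> 'v) \<Rightarrow> 'v \<Rightarrow> ('v \<Rightarrow> real) \<Rightarrow> (nat \<Rightarrow> 'v) measure \<Rightarrow> (nat \<Rightarrow> 'v) \<Rightarrow> (nat \<Rightarrow> 'v) \<Rightarrow> real" where
  "jump_kernel par rt \<phi> \<mu> \<xi> \<eta> =
     (if \<xi> = \<eta> then 0 else
       1 / \<phi> rt + integral {1 / \<phi> rt .. 1 / \<phi> (meet \<xi> \<eta>)}
                        (\<lambda>t. 1 / measure \<mu> (uball par rt \<phi> \<xi> (1 / t))))"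

definition standard_form :: "('v \<Rightarrow> 'v) \<Rightarrow> 'v \<Rightarrow> ('v \<Rightarrow> real) \<Rightarrow> (nat \<Rightarrow> 'v) measure \<Rightarrow> ((nat \<Rightarrow> 'v) \<Rightarrow> real) \<Rightarrow> ((nat \<Rightarrow> 'v) \<Rightarrow> real) \<Rightarrow> real" where
  "standard_form par rt \<phi> \<mu> u v =
     1/2 * (\<integral>\<xi>. (\<integral>\<eta>. (u \<xi> - u \<eta>) * (v \<xi> - v \<eta>) * jump_kernel par rt \<phi> \<mu> \<xi> \<eta> \<partial>\<mu>) \<partial>\<mu>)"

end

theory Submission
  imports Defs
begin

text \<open>Write \<open>g = G(\<cdot>,o)\<close>, let \<open>a\<close> be the conductances and \<open>\<nu>(x) = \<nu>\<^sub>o(\<partial>T\<^sub>x)\<close>. Counting crossings of an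
  edge gives \<open>\<nu>(x) = a(x) (g(x\<^sup>-) - g(x))\<close>, and first passage decompositions give that \<open>\<nu>\<^sub>x\<close> is
  \<open>F(x,x\<^sup>-) \<nu>\<^bsub>x\<^sup>-\<^esub>\<close> plus a multiple of \<open>\<nu>\<^sub>o\<close> restricted to \<open>\<partial>T\<^sub>x\<close>. With \<open>I(x)\<close> the integral of \<open>u\<close>
  over \<open>\<partial>T\<^sub>x\<close> and \<open>h\<close> the Poisson transform of \<open>u\<close>, the flow \<open>\<theta>(x) = (h(x) - h(x\<^sup>-)) a(x)\<close> then satisfies
  \<open>I = \<nu> h + g \<theta>\<close>. On the other side \<open>J(\<xi>,\<eta>)\<close> is the sum of \<open>c(x) = (1/g(x) - 1/g(x\<^sup>-)) / \<nu>(x)\<close> over the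
  common vertices of the two rays. Summation by parts shows that the jump energy of the level-\<open>n\<close>
  conditional expectation of \<open>u\<close> is the tree energy up to level \<open>n\<close> plus an error which, since
  \<open>g\<close> vanishes at infinity, is the least energy of a flow continuing \<open>\<theta>\<close> below level \<open>n\<close>, hence at most
  the remaining tree energy. Fatou's lemma and the Cauchy--Schwarz inequality let \<open>n \<rightarrow> \<infinity>\<close>, and
  polarization gives the bilinear identity.\<close>

section \<open>Rooted trees and their ends\<close>

text \<open>An element of \<open>HD\<close> is only known to be integrable, so the double integral
  cannot be expanded directly: \<open>u\<^sup>2\<close> might have no finite integral. Conditional
  expectations on a level take finitely many values, so for them every manipulation is a finite sum.
  Bounding the error \<open>B\<close> by the remaining tree energy gives
  \<open>S u n + B u n \<le> E\<close> for all \<open>n\<close>; this uniform bound produces square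
  integrability and the upper estimate of the jump energy at once. The lower estimate comes from
  \<open>0 \<le> B u n\<close>, because averaging lowers the energy. The relation
  \<open>I = \<nu> h + g \<theta>\<close> has a twin with the values of \<open>h\<close> and
  \<open>g\<close> at the parent. The two are compatible because
  \<open>\<nu> = a (g (par x) - g x)\<close>, and dividing their squares by \<open>g x\<close> and
  \<open>g (par x)\<close> is what makes the sum with weights \<open>c\<close> telescope. On the
  probabilistic side, \<open>walk_law\<close> and \<open>limit_end\<close> are definite
  descriptions, so existence, uniqueness and measurability come before any statement about limit
  distributions. \<open>F\<close> and \<open>G\<close> are series of recursively defined terms, so
  first passage identities become Cauchy products.\<close>

locale branching_tree =
  fixes par :: "'v \<Rightarrow> 'v" and rt :: 'v
  assumes tree: "rooted_tree par rt"
    and locally_finite: "\<forall>x. finite (nbrs par rt x)"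
    and fdeg: "\<forall>x. card (children par rt x) \<ge> 2"
begin

definition depth :: "'v \<Rightarrow> nat" where
  "depth x = (LEAST n. (par ^^ n) x = rt)"

definition level :: "nat \<Rightarrow> 'v set" where
  "level n = {x. depth x = n}"

definition subtree :: "'v \<Rightarrow> 'v set" where
  "subtree x = {y. x \<in> anc par rt y}"

abbreviation "chl \<equiv> children par rt"
abbreviation "cyl \<equiv> bdry_cyl par rt"
abbreviation "ends \<equiv> rays par rt"
abbreviation "bd \<equiv> bdry par rt"

lemma depth_rt [simp]: "depth rt = 0"
  unfolding depth_def by (rule Least_eq_0) simp

lemma depth_par: "x \<noteq> rt \<Longrightarrow> depth x = Suc (depth (par x))"
proof -
  assume x: "x \<noteq> rt"
  obtain n where n: "(par ^^ n) x = rt" using tree unfolding rooted_tree_def by blast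
  have "(LEAST n. (par ^^ n) x = rt) = Suc (LEAST m. (par ^^ Suc m) x = rt)"
    by (rule Least_Suc[where P="\<lambda>n. (par ^^ n) x = rt", OF n]) (use x in simp)
  then show ?thesis unfolding depth_def by (simp add: funpow_swap1)
qed

lemma depth_0_iff [simp]: "depth x = 0 \<longleftrightarrow> x = rt"
  using depth_par by fastforce

lemma tree_induct [case_names root child]:
  assumes "P rt" "\<And>x. x \<noteq> rt \<Longrightarrow> P (par x) \<Longrightarrow> P x"
  shows "P x"
proof (induction "depth x" arbitrary: x)
  case 0 then show ?case using assms by simp
next
  case (Suc n)
  then have "x \<noteq> rt" by auto
  then show ?case using Suc depth_par[of x] assms(2)[of x] by simp
qed

lemma anc_altdef: "anc par rt x = {(par ^^ k) x | k. k \<le> depth x}"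
  unfolding anc_def depth_def ..

lemma anc_rt: "anc par rt rt = {rt}"
  by (auto simp: anc_altdef)

lemma anc_step: "x \<noteq> rt \<Longrightarrow> anc par rt x = insert x (anc par rt (par x))"
proof (rule set_eqI)
  fix y assume x: "x \<noteq> rt"
  have "y \<in> anc par rt x \<longleftrightarrow> (\<exists>k\<le>Suc (depth (par x)). y = (par ^^ k) x)"
    using depth_par[OF x] by (auto simp: anc_altdef)
  also have "\<dots> \<longleftrightarrow> y = x \<or> (\<exists>k\<le>depth (par x). y = (par ^^ Suc k) x)"
  proof
    assume "\<exists>k\<le>Suc (depth (par x)). y = (par ^^ k) x"
    then obtain k where k: "k \<le> Suc (depth (par x))" "y = (par ^^ k) x" by blast
    then show "y = x \<or> (\<exists>k\<le>depth (par x). y = (par ^^ Suc k) x)"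
      by (cases k) auto
  next
    assume "y = x \<or> (\<exists>k\<le>depth (par x). y = (par ^^ Suc k) x)"
    then show "\<exists>k\<le>Suc (depth (par x)). y = (par ^^ k) x"
    proof
      assume "y = x" then show ?thesis by (intro exI[of _ 0]) simp
    next
      assume "\<exists>k\<le>depth (par x). y = (par ^^ Suc k) x"
      then obtain k where "k \<le> depth (par x)" "y = (par ^^ Suc k) x" by blast
      then show ?thesis by (intro exI[of _ "Suc k"]) (simp del: funpow.simps)
    qed
  qed
  also have "\<dots> \<longleftrightarrow> y \<in> insert x (anc par rt (par x))"
    by (auto simp: anc_altdef funpow_swap1)
  finally show "y \<in> anc par rt x \<longleftrightarrow> y \<in> insert x (anc par rt (par x))" .
qed

lemma anc_self [simp]: "x \<in> anc par rt x"
  by (cases "x = rt") (auto simp: anc_rt anc_step)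

lemma finite_anc [simp]: "finite (anc par rt x)"
  by (induction x rule: tree_induct) (auto simp: anc_rt anc_step)

lemma anc_depth_le: "y \<in> anc par rt x \<Longrightarrow> depth y \<le> depth x"
  by (induction x rule: tree_induct) (auto simp: anc_rt anc_step depth_par)

lemma anc_trans: "x \<in> anc par rt y \<Longrightarrow> y \<in> anc par rt z \<Longrightarrow> x \<in> anc par rt z"
proof (induction z rule: tree_induct)
  case root then show ?case by (simp add: anc_rt)
next
  case (child z)
  then show ?case by (auto simp: anc_step[of z])
qed

lemma anc_depth_unique: "y \<in> anc par rt x \<Longrightarrow> z \<in> anc par rt x \<Longrightarrow> depth y = depth z \<Longrightarrow> y = z"
proof (induction x rule: tree_induct)
  case root then show ?case by (simp add: anc_rt)
next
  case (child x)
  have "w \<in> anc par rt (par x) \<Longrightarrow> depth w \<noteq> depth x" for w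
    using anc_depth_le[of w "par x"] depth_par[OF child.hyps] by linarith
  then show ?case using child by (metis anc_step insertE)
qed

lemma par_in_anc: "y \<noteq> rt \<Longrightarrow> y \<in> anc par rt x \<Longrightarrow> par y \<in> anc par rt x"
  by (rule anc_trans[of _ y]) (auto simp: anc_step)

lemma anc_antisym: "x \<in> anc par rt y \<Longrightarrow> y \<in> anc par rt x \<Longrightarrow> x = y"
  using anc_depth_le anc_depth_unique anc_self by (metis le_antisym)

lemma ex_anc_depth: "n \<le> depth x \<Longrightarrow> \<exists>y\<in>anc par rt x. depth y = n"
proof (induction x rule: tree_induct)
  case root then show ?case by (auto simp: anc_rt)
next
  case (child x)
  then show ?case using depth_par[of x] by (cases "n = depth x") (auto simp: anc_step[of x])
qed

text \<open>Meaningful only for \<open>n \<le> depth x\<close>. It records the branch at level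
  \<open>n\<close> that contains \<open>x\<close>, which is what must stabilize along a path
  converging to an end.\<close>

definition anc_at :: "nat \<Rightarrow> 'v \<Rightarrow> 'v" where
  "anc_at n x = (THE y. y \<in> anc par rt x \<and> depth y = n)"

lemma anc_at_eqI: "y \<in> anc par rt x \<Longrightarrow> depth y = n \<Longrightarrow> anc_at n x = y"
  unfolding anc_at_def using anc_depth_unique by blast

lemma anc_at: "n \<le> depth x \<Longrightarrow> anc_at n x \<in> anc par rt x \<and> depth (anc_at n x) = n"
  using ex_anc_depth[of n x] anc_at_eqI[of _ x n] by auto

lemma anc_at_self [simp]: "anc_at (depth x) x = x"
  by (rule anc_at_eqI) auto

lemma anc_at_par: "n < depth x \<Longrightarrow> anc_at n x = anc_at n (par x)"
proof -
  assume n: "n < depth x"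
  then have x: "x \<noteq> rt" by auto
  then have "n \<le> depth (par x)" using n depth_par[OF x] by simp
  from anc_at[OF this] show ?thesis using x by (intro anc_at_eqI) (auto simp: anc_step)
qed

lemma in_subtree_iff: "y \<in> subtree x \<longleftrightarrow> x \<in> anc par rt y"
  by (simp add: subtree_def)

lemma children_iff: "y \<in> chl x \<longleftrightarrow> y \<noteq> rt \<and> par y = x"
  by (simp add: children_def)

lemma par_children: "y \<in> chl x \<Longrightarrow> par y = x"
  by (simp add: children_iff)

lemma depth_children: "y \<in> chl x \<Longrightarrow> depth y = Suc (depth x)"
  using depth_par by (auto simp: children_iff)

lemma nbrs_eq: "nbrs par rt x = chl x \<union> (if x = rt then {} else {par x})"
  by (auto simp: nbrs_def adj_def children_def)

lemma par_neq: "x \<noteq> rt \<Longrightarrow> par x \<noteq> x"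
  using depth_par by (metis n_not_Suc_n)

lemma adj_sym: "adj par rt x y \<longleftrightarrow> adj par rt y x"
  by (auto simp: adj_def)

lemma finite_nbrs [simp]: "finite (nbrs par rt x)"
  using locally_finite by blast

lemma finite_children [simp]: "finite (chl x)"
  by (rule finite_subset[OF _ finite_nbrs[of x]]) (auto simp: nbrs_eq)

lemma children_nonempty: "chl x \<noteq> {}"
  using fdeg[rule_format, of x] by force

lemma level_0 [simp]: "level 0 = {rt}"
  by (auto simp: level_def)

lemma level_Suc: "level (Suc n) = (\<Union>x\<in>level n. chl x)"
proof -
  have "x \<in> (\<Union>x\<in>level n. chl x)" if "x \<in> level (Suc n)" for x
  proof -
    have "x \<noteq> rt" using that by (auto simp: level_def)
    then show ?thesis using that depth_par[of x] by (auto simp: level_def children_iff)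
  qed
  then show ?thesis by (auto simp: level_def depth_children)
qed

lemma finite_level [simp]: "finite (level n)"
  by (induction n) (auto simp: level_Suc)

text \<open>Local finiteness makes each level finite. Countability lets random vertices serve as
  measurable indices and lets almost sure statements be collected over all vertices.\<close>

lemma countable_verts: "countable (A :: 'v set)"
proof -
  have "UNIV = (\<Union>n. level n)" by (auto simp: level_def)
  then have "countable (UNIV :: 'v set)"
    by (metis countable_UN countable_finite countableI_type finite_level)
  then show ?thesis by (rule countable_subset[rotated]) simp
qed

lemma sum_level_Suc:
  fixes f :: "'v \<Rightarrow> 'a::comm_monoid_add"
  shows "(\<Sum>y\<in>level (Suc n). f y) = (\<Sum>x\<in>level n. \<Sum>y\<in>chl x. f y)"
  unfolding level_Suc by (rule sum.UNION_disjoint) (auto simp: children_iff)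

lemma finite_depth_le: "finite {x. depth x \<le> n}"
proof -
  have "{x. depth x \<le> n} = (\<Union>k\<le>n. level k)" by (auto simp: level_def)
  then show ?thesis by simp
qed

section \<open>Ends as rays from the root, and the cylinders of ends below a vertex\<close>

lemma ray_depth: "\<xi> \<in> ends \<Longrightarrow> depth (\<xi> n) = n"
proof (induction n)
  case 0 then show ?case by (simp add: rays_def)
next
  case (Suc n)
  then show ?case using depth_par[of "\<xi> (Suc n)"] by (simp add: rays_def)
qed

lemma ray_par: "\<xi> \<in> ends \<Longrightarrow> par (\<xi> (Suc n)) = \<xi> n"
  by (auto simp: rays_def)

lemma ray_ne_rt: "\<xi> \<in> ends \<Longrightarrow> \<xi> (Suc n) \<noteq> rt"
  by (auto simp: rays_def)

lemma ray_0 [simp]: "\<xi> \<in> ends \<Longrightarrow> \<xi> 0 = rt"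
  by (auto simp: rays_def)

lemma ray_anc: "\<xi> \<in> ends \<Longrightarrow> anc par rt (\<xi> n) = \<xi> ` {..n}"
proof (induction n)
  case 0 then show ?case by (simp add: anc_rt)
next
  case (Suc n)
  then show ?case
    using anc_step[OF ray_ne_rt[OF Suc.prems, of n]] ray_par[OF Suc.prems, of n]
    by (auto simp: atMost_Suc)
qed

lemma in_cyl_iff: "\<xi> \<in> cyl x \<longleftrightarrow> \<xi> \<in> ends \<and> \<xi> (depth x) = x"
proof -
  have "x \<in> range \<xi> \<longleftrightarrow> \<xi> (depth x) = x" if "\<xi> \<in> ends"
    using ray_depth[OF that] by (metis rangeE rangeI)
  then show ?thesis by (auto simp: bdry_cyl_def)
qed

lemma cyl_subset_ends: "cyl x \<subseteq> ends"
  by (auto simp: in_cyl_iff)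

lemma cyl_rt [simp]: "cyl rt = ends"
  by (auto simp: in_cyl_iff)

lemma cyl_mono: "x \<in> anc par rt y \<Longrightarrow> cyl y \<subseteq> cyl x"
proof
  fix \<xi> assume x: "x \<in> anc par rt y" and "\<xi> \<in> cyl y"
  then have \<xi>: "\<xi> \<in> ends" "\<xi> (depth y) = y" by (auto simp: in_cyl_iff)
  have "x \<in> \<xi> ` {..depth y}" using ray_anc[OF \<xi>(1), of "depth y"] x \<xi> by simp
  then show "\<xi> \<in> cyl x" using \<xi>(1) by (auto simp: bdry_cyl_def)
qed

lemma cyl_anc: "\<xi> \<in> cyl x \<Longrightarrow> \<xi> \<in> cyl y \<Longrightarrow> depth x \<le> depth y \<Longrightarrow> x \<in> anc par rt y"
  unfolding in_cyl_iff by (metis atMost_iff imageI ray_anc)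

lemma cyl_disjoint: "x \<notin> anc par rt y \<Longrightarrow> y \<notin> anc par rt x \<Longrightarrow> cyl x \<inter> cyl y = {}"
  using cyl_anc[of _ x y] cyl_anc[of _ y x] by (meson disjoint_iff nle_le)

lemma cyl_level_disjoint: "x \<in> level n \<Longrightarrow> y \<in> level n \<Longrightarrow> x \<noteq> y \<Longrightarrow> cyl x \<inter> cyl y = {}"
  by (auto simp: in_cyl_iff level_def)

lemma cyl_children: "cyl x = (\<Union>y\<in>chl x. cyl y)"
proof
  show "cyl x \<subseteq> (\<Union>y\<in>chl x. cyl y)"
  proof
    fix \<xi> assume "\<xi> \<in> cyl x"
    then have \<xi>: "\<xi> \<in> ends" "\<xi> (depth x) = x" by (auto simp: in_cyl_iff)
    have "\<xi> (Suc (depth x)) \<in> chl x"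
      using \<xi> ray_par[OF \<xi>(1)] ray_ne_rt[OF \<xi>(1)] by (auto simp: children_iff)
    moreover have "\<xi> \<in> cyl (\<xi> (Suc (depth x)))"
      using \<xi> ray_depth[OF \<xi>(1)] by (auto simp: in_cyl_iff)
    ultimately show "\<xi> \<in> (\<Union>y\<in>chl x. cyl y)" by blast
  qed
  have "y \<in> chl x \<Longrightarrow> cyl y \<subseteq> cyl x" for y
    by (rule cyl_mono) (auto simp: children_iff anc_step)
  then show "(\<Union>y\<in>chl x. cyl y) \<subseteq> cyl x" by blast
qed

lemma cyl_children_disjoint: "disjoint_family_on cyl (chl x)"
  unfolding disjoint_family_on_def
  using cyl_level_disjoint[of _ "Suc (depth x)"] by (auto simp: level_def depth_children)

lemma space_bdry [simp]: "space bd = ends"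
  unfolding bdry_def by (rule space_measure_of) (auto simp: in_cyl_iff)

lemma sets_bdry: "sets bd = sigma_sets ends (range cyl)"
  unfolding bdry_def by (rule sets_measure_of) (auto simp: in_cyl_iff)

lemma cyl_sets [measurable, simp]: "cyl x \<in> sets bd"
  by (auto simp: sets_bdry)

text \<open>Two cylinders are nested or disjoint according to the ancestor relation; the empty set
  joins the generator to account for the disjoint case.\<close>

lemma Int_stable_cyl: "Int_stable (insert {} (range cyl))"
proof (rule Int_stableI)
  fix A B assume AB: "A \<in> insert {} (range cyl)" "B \<in> insert {} (range cyl)"
  show "A \<inter> B \<in> insert {} (range cyl)"
  proof (cases "A = {} \<or> B = {}")
    case True then show ?thesis by auto
  next
    case False
    then obtain x y where xy: "A = cyl x" "B = cyl y" using AB by auto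
    consider "x \<in> anc par rt y" | "y \<in> anc par rt x" | "cyl x \<inter> cyl y = {}"
      using cyl_disjoint by blast
    then show ?thesis
    proof cases
      case 1 then have "A \<inter> B = cyl y" using cyl_mono xy by blast then show ?thesis by simp
    next
      case 2 then have "A \<inter> B = cyl x" using cyl_mono xy by blast then show ?thesis by simp
    next
      case 3 then show ?thesis using xy by simp
    qed
  qed
qed

lemma sets_bdry': "sets bd = sigma_sets ends (insert {} (range cyl))"
  unfolding sets_bdry
  by (rule sigma_sets_eqI) (auto intro: sigma_sets.Empty sigma_sets.Basic)

lemma measure_eqI_cyl:
  assumes "sets M = sets bd" "sets N = sets bd" "emeasure M ends \<noteq> \<infinity>"
    and eq: "\<And>x. emeasure M (cyl x) = emeasure N (cyl x)"
  shows "M = N"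
proof (rule measure_eqI_generator_eq[where E="insert {} (range cyl)" and \<Omega>=ends and A="\<lambda>_. ends"])
  show "range (\<lambda>_::nat. ends) \<subseteq> insert {} (range cyl)"
    using cyl_rt by (metis (mono_tags) image_subset_iff insertCI rangeI)
qed (use assms Int_stable_cyl sets_bdry' in_cyl_iff in auto)

text \<open>Since every vertex has a child, a ray can be grown step by step. It provides a default
  end for paths that do not converge.\<close>

lemma ex_ray: "\<exists>\<xi>. \<xi> \<in> ends"
proof -
  define \<xi> where "\<xi> = rec_nat rt (\<lambda>_ x. SOME y. y \<in> chl x)"
  have "\<xi> (Suc n) \<in> chl (\<xi> n)" for n
    unfolding \<xi>_def using children_nonempty by (simp add: some_in_eq)
  moreover have "\<xi> 0 = rt" by (simp add: \<xi>_def)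
  ultimately have "\<xi> \<in> ends" unfolding rays_def children_iff by blast
  then show ?thesis by blast
qed

end

section \<open>The law of the random walk\<close>

locale tree_walk = branching_tree par rt for par :: "'v \<Rightarrow> 'v" and rt :: 'v +
  fixes p :: "'v \<Rightarrow> 'v \<Rightarrow> real"
  assumes walk: "nn_random_walk par rt p"
begin

lemma p_nonneg [simp]: "0 \<le> p x y"
  using walk by (simp add: nn_random_walk_def)

lemma p_pos_iff: "0 < p x y \<longleftrightarrow> y \<in> nbrs par rt x"
  using walk by (simp add: nn_random_walk_def nbrs_def)

lemma p_eq_0: "y \<notin> nbrs par rt x \<Longrightarrow> p x y = 0"
  using p_pos_iff[of x y] p_nonneg[of x y] by linarith

lemma sum_p: "(\<Sum>y\<in>nbrs par rt x. p x y) = 1"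
  using walk by (simp add: nn_random_walk_def)

section \<open>Existence and uniqueness of the path law\<close>

definition step_pmf :: "'v \<Rightarrow> 'v pmf" where
  "step_pmf x = embed_pmf (p x)"

lemma pmf_step_pmf: "pmf (step_pmf x) y = p x y"
  unfolding step_pmf_def
proof (rule pmf_embed_pmf)
  have "(\<integral>\<^sup>+ y. ennreal (p x y) \<partial>count_space UNIV)
      = (\<integral>\<^sup>+ y. ennreal (p x y) \<partial>count_space (nbrs par rt x))"
    by (intro nn_integral_count_space_eq) (auto simp: p_eq_0)
  also have "\<dots> = ennreal (\<Sum>y\<in>nbrs par rt x. p x y)"
    by (simp add: nn_integral_count_space_finite)
  finally show "(\<integral>\<^sup>+ y. ennreal (p x y) \<partial>count_space UNIV) = 1"
    by (simp add: sum_p)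
qed simp

text \<open>One independent draw for every pair of a time and a vertex: the draw at
  \<open>(n, x)\<close> is the move made if the walk sits at \<open>x\<close> at time
  \<open>n\<close>. A single product measure then carries the walks from all starting
  points.\<close>

definition coin_space :: "(nat \<times> 'v \<Rightarrow> 'v) measure" where
  "coin_space = (\<Pi>\<^sub>M i\<in>UNIV. measure_pmf (step_pmf (snd i)))"

primrec traj :: "'v \<Rightarrow> (nat \<times> 'v \<Rightarrow> 'v) \<Rightarrow> nat \<Rightarrow> 'v" where
  "traj s u 0 = s"
| "traj s u (Suc n) = u (n, traj s u n)"

sublocale coin: product_prob_space "\<lambda>i. measure_pmf (step_pmf (snd i))" "UNIV :: (nat \<times> 'v) set"
  by unfold_locales

lemma coin_component [measurable]: "(\<lambda>u. u i) \<in> measurable coin_space (count_space UNIV)"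
proof -
  have "(\<lambda>u. u i) \<in> measurable coin_space (measure_pmf (step_pmf (snd i)))"
    unfolding coin_space_def by measurable
  then show ?thesis by simp
qed

lemma traj_measurable [measurable]: "(\<lambda>u. traj s u n) \<in> measurable coin_space (count_space UNIV)"
proof (induction n)
  case (Suc n)
  \<comment> \<open>The coordinate that is read depends on the random position. This is still
    measurable because the position ranges over a countable set.\<close>
  have "(\<lambda>u. (\<lambda>x u. u (n, x)) (traj s u n) u) \<in> measurable coin_space (count_space UNIV)"
    by (rule measurable_compose_countable'[OF _ Suc countable_verts]) measurable
  then show ?case by simp
qed simp

lemma space_path_space: "space path_space = (UNIV :: (nat \<Rightarrow> 'v) set)"
  by (auto simp: path_space_def space_PiM)

lemma path_component [measurable]: "(\<lambda>\<omega>. \<omega> n) \<in> measurable path_space (count_space (UNIV :: 'v set))"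
  unfolding path_space_def by measurable

lemma path_pred: "Measurable.pred path_space (\<lambda>\<omega> :: nat \<Rightarrow> 'v. Q (\<omega> n))"
  using measurable_compose[OF path_component, of Q "count_space UNIV"] by simp

lemma path_set [measurable]: "Measurable.pred path_space (\<lambda>\<omega> :: nat \<Rightarrow> 'v. \<omega> n \<in> A)"
  by (rule path_pred)

lemma path_cylinder_sets [simp]: "{\<omega> :: nat \<Rightarrow> 'v. \<forall>i\<le>n. \<omega> i = f i} \<in> sets path_space"
proof -
  have "{\<omega> \<in> space path_space. \<forall>i\<le>n. (\<omega> :: nat \<Rightarrow> 'v) i = f i} \<in> sets path_space" by measurable
  then show ?thesis by (simp add: space_path_space)
qed

lemma traj_path_measurable [measurable]: "traj s \<in> measurable coin_space path_space"
  unfolding path_space_def by (rule measurable_PiM_single') (auto simp: space_PiM)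

text \<open>This is the predicate under \<open>THE\<close> in \<open>walk_law\<close>, named so that
  existence and uniqueness can be proved separately.\<close>

definition is_law :: "'v \<Rightarrow> (nat \<Rightarrow> 'v) measure \<Rightarrow> bool" where
  "is_law s M \<longleftrightarrow> sets M = sets path_space \<and> prob_space M \<and>
     (\<forall>n (f::nat \<Rightarrow> 'v). emeasure M {\<omega> \<in> space M. \<forall>i\<le>n. \<omega> i = f i} =
        ennreal (if f 0 = s then (\<Prod>i<n. p (f i) (f (Suc i))) else 0))"

lemma traj_eq_iff:
  "(\<forall>i\<le>n. traj s u i = f i) \<longleftrightarrow> f 0 = s \<and> (\<forall>i<n. u (i, f i) = f (Suc i))"
proof (induction n)
  case (Suc n)
  then show ?case by (auto simp: le_Suc_eq less_Suc_eq)
qed auto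

lemma is_law_distr: "is_law s (distr coin_space path_space (traj s))"
proof -
  interpret P: prob_space coin_space
    unfolding coin_space_def by (rule coin.P.prob_space_axioms)
  have "emeasure (distr coin_space path_space (traj s)) {\<omega> \<in> space path_space. \<forall>i\<le>n. \<omega> i = f i} =
        ennreal (if f 0 = s then (\<Prod>i<n. p (f i) (f (Suc i))) else 0)" for n f
  proof -
    have "emeasure (distr coin_space path_space (traj s)) {\<omega> \<in> space path_space. \<forall>i\<le>n. \<omega> i = f i}
      = emeasure coin_space {u \<in> space coin_space. \<forall>i\<le>n. traj s u i = f i}"
      by (subst emeasure_distr) (auto intro!: arg_cong[where f="emeasure _"] simp: space_path_space)
    also have "\<dots> = ennreal (if f 0 = s then (\<Prod>i<n. p (f i) (f (Suc i))) else 0)"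
    proof (cases "f 0 = s")
      case True
      \<comment> \<open>The time component keeps these indices distinct even when \<open>f\<close>
        revisits a vertex, so the probability is a product over independent draws.\<close>
      let ?J = "(\<lambda>i. (i, f i)) ` {..<n}"
      have "{u \<in> space coin_space. \<forall>i\<le>n. traj s u i = f i}
          = {u \<in> space coin_space. \<forall>j\<in>?J. u j \<in> {f (Suc (fst j))}}"
        using True by (auto simp: traj_eq_iff)
      also have "emeasure coin_space \<dots> = (\<Prod>j\<in>?J. emeasure (step_pmf (snd j)) {f (Suc (fst j))})"
        unfolding coin_space_def by (rule coin.emeasure_PiM_Collect) auto
      also have "\<dots> = (\<Prod>i<n. ennreal (p (f i) (f (Suc i))))"
        by (subst prod.reindex) (auto simp: inj_on_def emeasure_pmf_single pmf_step_pmf)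
      finally show ?thesis using True by (simp add: prod_ennreal)
    qed (simp add: traj_eq_iff)
    finally show ?thesis .
  qed
  then show ?thesis
    unfolding is_law_def by (auto intro!: P.prob_space_distr)
qed

text \<open>A finite-dimensional event with coordinates up to time \<open>n\<close> is a countable
  disjoint union of sets fixing the whole initial path up to \<open>n\<close>, and
  \<open>is_law\<close> prescribes the measure of those.\<close>

lemma is_law_unique:
  assumes "is_law s M" "is_law s N"
  shows "M = N"
  unfolding path_space_def
proof (rule measure_eqI_PiM_infinite)
  show sM: "sets M = sets (\<Pi>\<^sub>M i\<in>(UNIV::nat set). count_space (UNIV::'v set))"
    and sN: "sets N = sets (\<Pi>\<^sub>M i\<in>(UNIV::nat set). count_space (UNIV::'v set))"
    using assms by (auto simp: is_law_def path_space_def)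
  interpret M: prob_space M using assms by (simp add: is_law_def)
  show "finite_measure M" by unfold_locales
  fix A :: "nat \<Rightarrow> 'v set" and J :: "nat set"
  assume J: "finite J"
  obtain n where n: "J \<subseteq> {..n}" using J by (meson finite_nat_set_iff_bounded_le atMost_iff subsetI)
  let ?I = "{f \<in> {..n} \<rightarrow>\<^sub>E UNIV. \<forall>j\<in>J. f j \<in> A j}"
  have I: "countable ?I"
    by (rule countable_subset[of _ "{..n} \<rightarrow>\<^sub>E UNIV"]) (auto intro!: countable_PiE countable_verts)
  define Z where "Z f = {\<omega> :: nat \<Rightarrow> 'v. \<forall>i\<le>n. \<omega> i = f i}" for f :: "nat \<Rightarrow> 'v"
  have eq: "prod_emb UNIV (\<lambda>_. count_space UNIV) J (Pi\<^sub>E J A) = (\<Union>f\<in>?I. Z f)"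
  proof -
    have a: "\<omega> \<in> (\<Union>f\<in>?I. Z f)" if "\<forall>j\<in>J. \<omega> j \<in> A j" for \<omega>
      by (rule UN_I[of "restrict \<omega> {..n}"]) (use n that in \<open>auto simp: Z_def\<close>)
    have b: "\<forall>j\<in>J. \<omega> j \<in> A j" if "\<omega> \<in> (\<Union>f\<in>?I. Z f)" for \<omega>
      using that n by (force simp: Z_def)
    have "prod_emb UNIV (\<lambda>_. count_space UNIV) J (Pi\<^sub>E J A) = {\<omega>. \<forall>j\<in>J. \<omega> j \<in> A j}"
      by (auto simp: prod_emb_def PiE_iff)
    also have "\<dots> = (\<Union>f\<in>?I. Z f)"
      by (intro equalityI subsetI CollectI, erule CollectE, erule a, erule b)
    finally show ?thesis .
  qed
  have disj: "disjoint_family_on Z ?I"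
    unfolding disjoint_family_on_def
  proof (intro ballI impI)
    fix f g assume fg: "f \<in> ?I" "g \<in> ?I" "f \<noteq> g"
    then obtain i where i: "f i \<noteq> g i" by (meson ext)
    then have "i \<le> n" using fg by (auto simp: PiE_iff extensional_def)
    then show "Z f \<inter> Z g = {}" using i by (auto simp: Z_def)
  qed
  have Zs: "Z f \<in> sets path_space" for f
    by (simp add: Z_def)
  have *: "emeasure K (prod_emb UNIV (\<lambda>_. count_space UNIV) J (Pi\<^sub>E J A))
      = (\<integral>\<^sup>+f. ennreal (if f 0 = s then (\<Prod>i<n. p (f i) (f (Suc i))) else 0) \<partial>count_space ?I)"
    if K: "is_law s K" for K
  proof -
    have sp: "space K = UNIV"
      using K sets_eq_imp_space_eq[of K path_space] by (auto simp: is_law_def space_path_space)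
    have "emeasure K (\<Union>f\<in>?I. Z f) = (\<integral>\<^sup>+f. emeasure K (Z f) \<partial>count_space ?I)"
      by (rule emeasure_UN_countable[OF _ I disj]) (use K Zs in \<open>auto simp: is_law_def\<close>)
    also have "\<dots> = (\<integral>\<^sup>+f. ennreal (if f 0 = s then (\<Prod>i<n. p (f i) (f (Suc i))) else 0) \<partial>count_space ?I)"
      using K sp by (intro nn_integral_cong) (simp add: is_law_def Z_def)
    finally show ?thesis unfolding eq .
  qed
  show "emeasure M (prod_emb UNIV (\<lambda>_. count_space UNIV) J (Pi\<^sub>E J A))
      = emeasure N (prod_emb UNIV (\<lambda>_. count_space UNIV) J (Pi\<^sub>E J A))"
    using *[OF assms(1)] *[OF assms(2)] by simp
qed

abbreviation "law \<equiv> walk_law p"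

lemma is_law_walk_law: "is_law s (law s)"
proof -
  have "walk_law p s = (THE M. is_law s M)"
    unfolding walk_law_def is_law_def ..
  also have "is_law s \<dots>"
    by (rule theI'[of "is_law s"]) (use is_law_distr is_law_unique in blast)
  finally show ?thesis .
qed

lemma sets_law [simp, measurable_cong]: "sets (law s) = sets path_space"
  using is_law_walk_law by (simp add: is_law_def)

lemma space_law [simp]: "space (law s) = UNIV"
  using sets_eq_imp_space_eq[OF sets_law] by (simp add: space_path_space)

lemma prob_space_law: "prob_space (law s)"
  using is_law_walk_law by (simp add: is_law_def)

sublocale law: prob_space "law s" for s
  by (rule prob_space_law)

lemma prob_path:
  "measure (law s) {\<omega>. \<forall>i\<le>n. \<omega> i = f i} = (if f 0 = s then (\<Prod>i<n. p (f i) (f (Suc i))) else 0)"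
proof -
  have "emeasure (law s) {\<omega>. \<forall>i\<le>n. \<omega> i = f i} = ennreal (if f 0 = s then (\<Prod>i<n. p (f i) (f (Suc i))) else 0)"
    using is_law_walk_law[of s] by (simp add: is_law_def)
  then show ?thesis by (simp add: measure_def prod_nonneg split: if_splits)
qed

text \<open>Conditioning on the first \<open>k\<close> steps: it suffices to let the next step run through the
  neighbours, since these already carry the whole mass of the conditioning event.\<close>

lemma prob_path_step:
  assumes Q: "Measurable.pred path_space Q"
  shows "measure (law s) {\<omega>. (\<forall>i\<le>k. \<omega> i = f i) \<and> Q \<omega>} =
    (\<Sum>z\<in>nbrs par rt (f k). measure (law s) {\<omega>. (\<forall>i\<le>Suc k. \<omega> i = (f(Suc k := z)) i) \<and> Q \<omega>})"
proof -
  note [measurable] = Q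
  let ?N = "nbrs par rt (f k)"
  let ?E = "\<lambda>Q. {\<omega> \<in> space path_space. (\<forall>i\<le>k. \<omega> i = f i) \<and> Q \<omega>}"
  have E [measurable]: "Measurable.pred path_space Q \<Longrightarrow> ?E Q \<in> sets path_space" for Q
    by measurable
  have eq: "{\<omega>. (\<forall>i\<le>Suc k. \<omega> i = (f(Suc k := z)) i) \<and> Q \<omega>} = ?E (\<lambda>\<omega>. \<omega> (Suc k) = z \<and> Q \<omega>)" for z Q
    by (auto simp: le_Suc_eq space_path_space)
  have part: "(\<Sum>z\<in>?N. measure (law s) (?E (\<lambda>\<omega>. \<omega> (Suc k) = z \<and> Q \<omega>)))
     = measure (law s) (?E (\<lambda>\<omega>. \<omega> (Suc k) \<in> ?N \<and> Q \<omega>))" if [measurable]: "Measurable.pred path_space Q" for Q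
  proof -
    have "?E (\<lambda>\<omega>. \<omega> (Suc k) \<in> ?N \<and> Q \<omega>) = (\<Union>z\<in>?N. ?E (\<lambda>\<omega>. \<omega> (Suc k) = z \<and> Q \<omega>))" by auto
    then show ?thesis
      by (simp only:, intro law.finite_measure_finite_Union[symmetric])
         (auto simp: disjoint_family_on_def)
  qed
  have *: "measure (law s) (?E (\<lambda>\<omega>. \<omega> (Suc k) \<in> ?N \<and> True)) = measure (law s) (?E (\<lambda>_. True))"
  proof -
    have "measure (law s) (?E (\<lambda>\<omega>. \<omega> (Suc k) \<in> ?N \<and> True))
        = (\<Sum>z\<in>?N. measure (law s) {\<omega>. \<forall>i\<le>Suc k. \<omega> i = (f(Suc k := z)) i})"
      using eq[of _ "\<lambda>_. True"] by (subst part[symmetric]) auto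
    also have "\<dots> = (\<Sum>z\<in>?N. (if f 0 = s then (\<Prod>i<k. p (f i) (f (Suc i))) else 0) * p (f k) z)"
      unfolding prob_path by (intro sum.cong) (auto intro!: prod.cong)
    also have "\<dots> = measure (law s) {\<omega>. \<forall>i\<le>k. \<omega> i = f i}"
      unfolding prob_path by (simp add: sum_distrib_left[symmetric] sum_p)
    finally show ?thesis by (simp add: space_path_space)
  qed
  have "measure (law s) (?E (\<lambda>\<omega>. \<not> \<omega> (Suc k) \<in> ?N)) = 0"
  proof -
    have "?E (\<lambda>_. True) = ?E (\<lambda>\<omega>. \<omega> (Suc k) \<in> ?N \<and> True) \<union> ?E (\<lambda>\<omega>. \<not> \<omega> (Suc k) \<in> ?N)" by auto
    moreover have "measure (law s) (?E (\<lambda>\<omega>. \<omega> (Suc k) \<in> ?N \<and> True) \<union> ?E (\<lambda>\<omega>. \<not> \<omega> (Suc k) \<in> ?N))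
      = measure (law s) (?E (\<lambda>\<omega>. \<omega> (Suc k) \<in> ?N \<and> True)) + measure (law s) (?E (\<lambda>\<omega>. \<not> \<omega> (Suc k) \<in> ?N))"
      by (rule law.finite_measure_Union) auto
    ultimately show ?thesis using * by simp
  qed
  then have "?E (\<lambda>\<omega>. \<not> \<omega> (Suc k) \<in> ?N) \<in> null_sets (law s)"
    by (intro null_setsI) (auto simp: law.emeasure_eq_measure)
  then have "AE \<omega> in law s. \<omega> \<notin> ?E (\<lambda>\<omega>. \<not> \<omega> (Suc k) \<in> ?N)"
    by (rule AE_not_in)
  then have "measure (law s) (?E Q) = measure (law s) (?E (\<lambda>\<omega>. \<omega> (Suc k) \<in> ?N \<and> Q \<omega>))"
    by (intro law.finite_measure_eq_AE) auto
  then show ?thesis unfolding eq part[OF Q] by (simp add: space_path_space)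
qed

text \<open>This is the Markov property in the form used below. The induction varies the prefix: one
  of the remaining \<open>n\<close> steps is appended to it, so the recursion of
  \<open>pstep\<close> appears from its first step.\<close>

lemma prob_path_pstep:
  "measure (law s) {\<omega>. (\<forall>i\<le>k. \<omega> i = f i) \<and> \<omega> (k + n) = y}
     = measure (law s) {\<omega>. \<forall>i\<le>k. \<omega> i = f i} * pstep par rt p n (f k) y"
proof (induction n arbitrary: k f)
  case 0
  have "{\<omega>. (\<forall>i\<le>k. \<omega> i = f i) \<and> \<omega> (k + 0) = y} = (if f k = y then {\<omega>. \<forall>i\<le>k. \<omega> i = f i} else {})"
    by auto
  then show ?case by (simp only: ) simp
next
  case (Suc n)
  have "measure (law s) {\<omega>. (\<forall>i\<le>k. \<omega> i = f i) \<and> \<omega> (k + Suc n) = y} =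
    (\<Sum>z\<in>nbrs par rt (f k). measure (law s) {\<omega>. (\<forall>i\<le>Suc k. \<omega> i = (f(Suc k := z)) i) \<and> \<omega> (k + Suc n) = y})"
    by (rule prob_path_step) measurable
  also have "\<dots> = (\<Sum>z\<in>nbrs par rt (f k). measure (law s) {\<omega>. \<forall>i\<le>Suc k. \<omega> i = (f(Suc k := z)) i} * pstep par rt p n z y)"
    using Suc.IH[of "Suc k" "f(Suc k := _)"] by (intro sum.cong) auto
  also have "\<dots> = (\<Sum>z\<in>nbrs par rt (f k). measure (law s) {\<omega>. \<forall>i\<le>k. \<omega> i = f i} * p (f k) z * pstep par rt p n z y)"
    unfolding prob_path by (intro sum.cong) (auto intro!: prod.cong)
  also have "\<dots> = measure (law s) {\<omega>. \<forall>i\<le>k. \<omega> i = f i} * pstep par rt p (Suc n) (f k) y"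
    by (simp add: sum_distrib_left mult.assoc)
  finally show ?case .
qed

text \<open>The same induction, also recording the edge taken at time \<open>k + n\<close>; it
  supplies the probabilities of edge crossings.\<close>

lemma prob_path_pstep2:
  "measure (law s) {\<omega>. (\<forall>i\<le>k. \<omega> i = f i) \<and> \<omega> (k + n) = y \<and> \<omega> (Suc (k + n)) = z}
     = measure (law s) {\<omega>. \<forall>i\<le>k. \<omega> i = f i} * (pstep par rt p n (f k) y * p y z)"
proof (induction n arbitrary: k f)
  case 0
  have "{\<omega>. (\<forall>i\<le>k. \<omega> i = f i) \<and> \<omega> (k + 0) = y \<and> \<omega> (Suc (k + 0)) = z} 
    = (if f k = y then {\<omega>. \<forall>i\<le>Suc k. \<omega> i = (f(Suc k := z)) i} else {})"
    by (auto simp: le_Suc_eq)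
  then have "measure (law s) {\<omega>. (\<forall>i\<le>k. \<omega> i = f i) \<and> \<omega> (k + 0) = y \<and> \<omega> (Suc (k + 0)) = z}
    = (if f k = y then measure (law s) {\<omega>. \<forall>i\<le>Suc k. \<omega> i = (f(Suc k := z)) i} else 0)"
    by (simp only: ) simp
  also have "\<dots> = measure (law s) {\<omega>. \<forall>i\<le>k. \<omega> i = f i} * (pstep par rt p 0 (f k) y * p y z)"
    unfolding prob_path by (auto intro!: prod.cong)
  finally show ?case .
next
  case (Suc n)
  have "measure (law s) {\<omega>. (\<forall>i\<le>k. \<omega> i = f i) \<and> \<omega> (k + Suc n) = y \<and> \<omega> (Suc (k + Suc n)) = z} =
    (\<Sum>w\<in>nbrs par rt (f k). measure (law s) {\<omega>. (\<forall>i\<le>Suc k. \<omega> i = (f(Suc k := w)) i) \<and> \<omega> (k + Suc n) = y \<and> \<omega> (Suc (k + Suc n)) = z})"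
    by (rule prob_path_step) measurable
  also have "\<dots> = (\<Sum>w\<in>nbrs par rt (f k). measure (law s) {\<omega>. \<forall>i\<le>Suc k. \<omega> i = (f(Suc k := w)) i} * (pstep par rt p n w y * p y z))"
    using Suc.IH[of "Suc k" "f(Suc k := _)"] by (intro sum.cong) auto
  also have "\<dots> = (\<Sum>w\<in>nbrs par rt (f k). measure (law s) {\<omega>. \<forall>i\<le>k. \<omega> i = f i} * p (f k) w * (pstep par rt p n w y * p y z))"
    unfolding prob_path by (intro sum.cong) (auto intro!: prod.cong)
  also have "\<dots> = measure (law s) {\<omega>. \<forall>i\<le>k. \<omega> i = f i} * (pstep par rt p (Suc n) (f k) y * p y z)"
    by (simp add: sum_distrib_left sum_distrib_right mult.assoc)
  finally show ?case .
qed

lemma AE_law_0: "AE \<omega> in law s. \<omega> 0 = s"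
proof -
  have "measure (law s) {\<omega>. \<forall>i\<le>0. \<omega> i = (\<lambda>_. s) i} = 1" unfolding prob_path by simp
  from law.AE_prob_1[OF this] show ?thesis by simp
qed

lemma prob_pstep: "measure (law s) {\<omega>. \<omega> n = y} = pstep par rt p n s y"
proof -
  have "measure (law s) {\<omega>. \<omega> n = y} = measure (law s) {\<omega>. (\<forall>i\<le>0. \<omega> i = (\<lambda>_. s) i) \<and> \<omega> (0 + n) = y}"
  proof (rule law.finite_measure_eq_AE)
    have "{\<omega> \<in> space path_space. \<omega> n = y} \<in> sets path_space" 
      "{\<omega> \<in> space path_space. (\<forall>i\<le>0. \<omega> i = (\<lambda>_. s) i) \<and> \<omega> (0 + n) = y} \<in> sets path_space" by measurable
    then show "{\<omega>. \<omega> n = y} \<in> sets (law s)" 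
      "{\<omega>. (\<forall>i\<le>0. \<omega> i = (\<lambda>_. s) i) \<and> \<omega> (0 + n) = y} \<in> sets (law s)"
      by (simp_all add: space_path_space)
  qed (use AE_law_0[of s] in \<open>auto elim!: eventually_mono\<close>)
  also have "\<dots> = pstep par rt p n s y"
    unfolding prob_path_pstep prob_path by simp
  finally show ?thesis .
qed

lemma prob_pstep2: "measure (law s) {\<omega>. \<omega> n = y \<and> \<omega> (Suc n) = z} = pstep par rt p n s y * p y z"
proof -
  have "measure (law s) {\<omega>. \<omega> n = y \<and> \<omega> (Suc n) = z} 
    = measure (law s) {\<omega>. (\<forall>i\<le>0. \<omega> i = (\<lambda>_. s) i) \<and> \<omega> (0 + n) = y \<and> \<omega> (Suc (0 + n)) = z}"
  proof (rule law.finite_measure_eq_AE)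
    have "{\<omega> \<in> space path_space. \<omega> n = y \<and> \<omega> (Suc n) = z} \<in> sets path_space" 
      "{\<omega> \<in> space path_space. (\<forall>i\<le>0. \<omega> i = (\<lambda>_. s) i) \<and> \<omega> (0 + n) = y \<and> \<omega> (Suc (0 + n)) = z} \<in> sets path_space" by measurable
    then show "{\<omega>. \<omega> n = y \<and> \<omega> (Suc n) = z} \<in> sets (law s)" 
      "{\<omega>. (\<forall>i\<le>0. \<omega> i = (\<lambda>_. s) i) \<and> \<omega> (0 + n) = y \<and> \<omega> (Suc (0 + n)) = z} \<in> sets (law s)"
      by (simp_all add: space_path_space)
  qed (use AE_law_0[of s] in \<open>auto elim!: eventually_mono\<close>)
  also have "\<dots> = pstep par rt p n s y * p y z"
    unfolding prob_path_pstep2 prob_path by simp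
  finally show ?thesis .
qed

lemma AE_law_adj: "AE \<omega> in law s. \<forall>n. \<omega> (Suc n) \<in> nbrs par rt (\<omega> n)"
proof -
  have "AE \<omega> in law s. \<not> (\<omega> n = y \<and> \<omega> (Suc n) = z)" if "z \<notin> nbrs par rt y" for n y z
  proof -
    have "{\<omega> \<in> space path_space. \<omega> n = y \<and> \<omega> (Suc n) = z} \<in> sets path_space" by measurable
    then have "{\<omega>. \<omega> n = y \<and> \<omega> (Suc n) = z} \<in> null_sets (law s)"
      using prob_pstep2[of s n y z] that
      by (intro null_setsI) (auto simp: law.emeasure_eq_measure p_eq_0 space_path_space)
    from AE_not_in[OF this] show ?thesis by simp
  qed
  then have "AE \<omega> in law s. \<forall>n. \<forall>y\<in>UNIV. \<forall>z\<in>UNIV. z \<notin> nbrs par rt y \<longrightarrow> \<not> (\<omega> n = y \<and> \<omega> (Suc n) = z)"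
    unfolding AE_all_countable AE_ball_countable[OF countable_verts]
    by (auto intro!: AE_impI)
  then show ?thesis by eventually_elim blast
qed

end

section \<open>Convergence to the boundary\<close>

text \<open>A tree has no cycles, so the edge above \<open>x\<close> is the only connection between
  \<open>subtree x\<close> and the rest. Applied to both directions of a step, it identifies
  entering and leaving the subtree with crossings of that edge.\<close>

lemma (in branching_tree) subtree_step:
  assumes "x \<noteq> rt" "z \<in> nbrs par rt y"
  shows "y \<notin> subtree x \<and> z \<in> subtree x \<longleftrightarrow> y = par x \<and> z = x"
proof
  assume *: "y \<notin> subtree x \<and> z \<in> subtree x"
  consider "z \<noteq> rt" "par z = y" | "y \<noteq> rt" "z = par y"
    using assms(2) by (auto simp: nbrs_def adj_def)
  then show "y = par x \<and> z = x"
    using * by cases (auto simp: in_subtree_iff anc_step)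
next
  assume "y = par x \<and> z = x"
  moreover have "x \<notin> anc par rt (par x)"
    using anc_depth_le[of x "par x"] depth_par[OF assms(1)] by auto
  ultimately show "y \<notin> subtree x \<and> z \<in> subtree x" by (simp add: in_subtree_iff)
qed

locale transient_tree_walk = tree_walk +
  assumes trans: "transient par rt p"
begin

abbreviation "G \<equiv> Green par rt p"
abbreviation "ps \<equiv> pstep par rt p"
abbreviation "hit \<equiv> hit_distr par rt p"

lemma ps_summable [simp]: "summable (\<lambda>n. ps n x y)"
  using trans by (simp add: transient_def)

lemma ps_sums: "(\<lambda>n. ps n x y) sums G x y"
  unfolding Green_def by (rule summable_sums) simp

lemma ps_nonneg [simp]: "0 \<le> ps n x y"
  by (induction n arbitrary: x) (auto intro!: sum_nonneg)

lemma path_pred_sets: "{\<omega> :: nat \<Rightarrow> 'a. Q (\<omega> n)} \<in> sets path_space"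
proof -
  have "{\<omega> \<in> space path_space. Q ((\<omega> :: nat \<Rightarrow> 'a) n)} \<in> sets path_space" 
    using path_pred[of Q n] by measurable
  then show ?thesis by (simp add: space_path_space)
qed

lemma path_sets [simp]:
  "{\<omega> :: nat \<Rightarrow> 'a. \<omega> n = y} \<in> sets path_space"
  "{\<omega> :: nat \<Rightarrow> 'a. \<omega> n \<in> A} \<in> sets path_space"
  by (rule path_pred_sets)+

text \<open>Borel-Cantelli: the probabilities of being at \<open>y\<close> at time \<open>n\<close>
  sum to \<open>G s y\<close>, which is finite by transience.\<close>

lemma AE_finitely_many_visits: "AE \<omega> in law s. \<forall>y. eventually (\<lambda>n. \<omega> n \<noteq> y) sequentially"
proof -
  have "AE \<omega> in law s. eventually (\<lambda>n. \<omega> n \<noteq> y) sequentially" for y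
    using borel_cantelli_AE1[of "\<lambda>n. {\<omega>. \<omega> n = y}" "law s"]
    by (simp add: prob_pstep law.emeasure_eq_measure)
  then have "AE \<omega> in law s. \<forall>y\<in>UNIV. eventually (\<lambda>n. \<omega> n \<noteq> y) sequentially"
    unfolding AE_ball_countable[OF countable_verts] by simp
  then show ?thesis by simp
qed

text \<open>Convergence is phrased through vertices and times alone, without quantifying over ends,
  so that it is visibly measurable; \<open>conv_iff\<close> gives the intended meaning.\<close>

definition conv :: "(nat \<Rightarrow> 'a) \<Rightarrow> bool" where
  "conv \<omega> \<longleftrightarrow> (\<forall>k. \<exists>x\<in>level k. \<exists>N. \<forall>m\<ge>N. x \<in> anc par rt (\<omega> m))"

lemma converges_unique:
  assumes "converges_to_end par rt \<omega> \<xi>" "converges_to_end par rt \<omega> \<eta>" "\<xi> \<in> ends" "\<eta> \<in> ends"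
  shows "\<xi> = \<eta>"
proof
  fix k
  obtain N M where "\<forall>m\<ge>N. \<xi> k \<in> anc par rt (\<omega> m)" "\<forall>m\<ge>M. \<eta> k \<in> anc par rt (\<omega> m)"
    using assms unfolding converges_to_end_def by blast
  then have "\<xi> k \<in> anc par rt (\<omega> (max N M))" "\<eta> k \<in> anc par rt (\<omega> (max N M))" by auto
  then show "\<xi> k = \<eta> k"
    by (rule anc_depth_unique) (simp add: ray_depth assms)
qed

lemma conv_iff: "conv \<omega> \<longleftrightarrow> (\<exists>\<xi>\<in>ends. converges_to_end par rt \<omega> \<xi>)"
proof
  assume "conv \<omega>"
  then have "\<forall>k. \<exists>x. x \<in> level k \<and> (\<exists>N. \<forall>m\<ge>N. x \<in> anc par rt (\<omega> m))"
    unfolding conv_def by blast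
  then obtain \<xi> where \<xi>: "\<And>k. \<xi> k \<in> level k" "\<And>k. \<exists>N. \<forall>m\<ge>N. \<xi> k \<in> anc par rt (\<omega> m)"
    by metis
  have d: "depth (\<xi> k) = k" for k using \<xi>(1)[of k] by (simp add: level_def)
  have "\<xi> 0 = rt" using d[of 0] by simp
  moreover have "\<xi> (Suc k) \<noteq> rt \<and> par (\<xi> (Suc k)) = \<xi> k" for k
  proof -
    have ne: "\<xi> (Suc k) \<noteq> rt" using d[of "Suc k"] by (metis depth_rt nat.distinct(1))
    obtain N M where "\<forall>m\<ge>N. \<xi> k \<in> anc par rt (\<omega> m)" "\<forall>m\<ge>M. \<xi> (Suc k) \<in> anc par rt (\<omega> m)"
      using \<xi>(2) by metis
    then have "\<xi> k \<in> anc par rt (\<omega> (max N M))" "\<xi> (Suc k) \<in> anc par rt (\<omega> (max N M))" by auto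
    then have "par (\<xi> (Suc k)) = \<xi> k"
      using anc_depth_unique[OF par_in_anc[OF ne], of "\<omega> (max N M)" "\<xi> k"] d[of k] d[of "Suc k"] depth_par[OF ne] by simp
    then show ?thesis using ne by simp
  qed
  ultimately have "\<xi> \<in> ends" unfolding rays_def by blast
  then show "\<exists>\<xi>\<in>ends. converges_to_end par rt \<omega> \<xi>"
    using \<xi>(2) by (auto simp: converges_to_end_def)
next
  assume "\<exists>\<xi>\<in>ends. converges_to_end par rt \<omega> \<xi>"
  then obtain \<xi> where \<xi>: "\<xi> \<in> ends" "converges_to_end par rt \<omega> \<xi>" by blast
  show "conv \<omega>" unfolding conv_def
  proof
    fix k
    show "\<exists>x\<in>level k. \<exists>N. \<forall>m\<ge>N. x \<in> anc par rt (\<omega> m)"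
      using \<xi> ray_depth[OF \<xi>(1), of k] 
      by (intro bexI[of _ "\<xi> k"]) (auto simp: level_def converges_to_end_def)
  qed
qed

lemma limit_end: "conv \<omega> \<Longrightarrow> limit_end par rt \<omega> \<in> ends \<and> converges_to_end par rt \<omega> (limit_end par rt \<omega>)"
  unfolding limit_end_def conv_iff
  by (rule theI'[of "\<lambda>\<xi>. \<xi> \<in> ends \<and> converges_to_end par rt \<omega> \<xi>"]) (use converges_unique in blast)

lemma limit_end_cyl:
  assumes "conv \<omega>"
  shows "eventually (\<lambda>m. \<omega> m \<in> subtree x \<longleftrightarrow> limit_end par rt \<omega> \<in> cyl x) sequentially"
proof -
  let ?\<xi> = "limit_end par rt \<omega>"
  have \<xi>: "?\<xi> \<in> ends" "converges_to_end par rt \<omega> ?\<xi>" using limit_end[OF assms] by auto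
  then obtain N where N: "\<And>m. m \<ge> N \<Longrightarrow> ?\<xi> (depth x) \<in> anc par rt (\<omega> m)"
    unfolding converges_to_end_def by blast
  have "\<omega> m \<in> subtree x \<longleftrightarrow> ?\<xi> \<in> cyl x" if "m \<ge> N" for m
    using N[OF that] anc_depth_unique[of x "\<omega> m" "?\<xi> (depth x)"] ray_depth[OF \<xi>(1)] \<xi>(1)
    by (auto simp: in_subtree_iff in_cyl_iff)
  then show ?thesis by (auto simp: eventually_sequentially)
qed

text \<open>After the last visit to depth at most \<open>k\<close>, a step to a parent or child
  cannot change the ancestor at level \<open>k\<close>. The strict bound on the depth matters: it
  keeps that ancestor in place even when the step goes upwards.\<close>

lemma conv_if_transient_path:
  assumes adj: "\<And>n. \<omega> (Suc n) \<in> nbrs par rt (\<omega> n)"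
    and fin: "\<And>y. eventually (\<lambda>n. \<omega> n \<noteq> y) sequentially"
  shows "conv \<omega>"
  unfolding conv_def
proof
  fix k
  have "eventually (\<lambda>n. \<forall>y\<in>{x. depth x \<le> k}. \<omega> n \<noteq> y) sequentially"
    by (rule eventually_ball_finite[OF finite_depth_le]) (use fin in blast)
  then obtain N where "\<forall>m\<ge>N. \<forall>y\<in>{x. depth x \<le> k}. \<omega> m \<noteq> y"
    by (auto simp: eventually_sequentially)
  then have N: "k < depth (\<omega> m)" if "m \<ge> N" for m
    using that by (metis mem_Collect_eq not_le)
  have step: "anc_at k (\<omega> (Suc m)) = anc_at k (\<omega> m)" if "m \<ge> N" for m
  proof -
    consider "par (\<omega> (Suc m)) = \<omega> m" | "\<omega> (Suc m) = par (\<omega> m)"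
      using adj[of m] by (auto simp: nbrs_def adj_def)
    then show ?thesis
      using anc_at_par[OF N[OF that]] anc_at_par[OF N[of "Suc m"]] that by cases auto
  qed
  have const: "anc_at k (\<omega> m) = anc_at k (\<omega> N)" if "m \<ge> N" for m
    using that by (induction m rule: dec_induct) (auto simp: step)
  have "anc_at k (\<omega> N) \<in> level k" using anc_at[of k "\<omega> N"] N[of N] by (simp add: level_def)
  moreover have "\<forall>m\<ge>N. anc_at k (\<omega> N) \<in> anc par rt (\<omega> m)"
    using anc_at const N by (metis less_imp_le)
  ultimately show "\<exists>x\<in>level k. \<exists>N. \<forall>m\<ge>N. x \<in> anc par rt (\<omega> m)" by blast
qed

lemma AE_conv: "AE \<omega> in law s. conv \<omega>"
  using AE_finitely_many_visits[of s] AE_law_adj[of s]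
  by eventually_elim (auto intro: conv_if_transient_path)

lemma conv_measurable [measurable]: "Measurable.pred path_space conv"
proof -
  have [measurable]: "Measurable.pred path_space (\<lambda>\<omega>. x \<in> anc par rt (\<omega> m))" for x m
    by (rule path_pred)
  show ?thesis unfolding conv_def by measurable
qed

text \<open>\<^const>\<open>limit_end\<close> takes an unspecified value on the null set of non-convergent paths;
  \<open>lim_end\<close> is a measurable modification.\<close>

definition lim_end :: "(nat \<Rightarrow> 'a) \<Rightarrow> nat \<Rightarrow> 'a" where
  "lim_end \<omega> = (if conv \<omega> then limit_end par rt \<omega> else (SOME \<xi>. \<xi> \<in> ends))"

lemma lim_end_ends: "lim_end \<omega> \<in> ends"
  using limit_end ex_ray someI_ex[of "\<lambda>\<xi>. \<xi> \<in> ends"] by (auto simp: lim_end_def)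

lemma lim_end_measurable [measurable]: "lim_end \<in> measurable path_space bd"
  unfolding bdry_def
proof (rule measurable_measure_of)
  fix A assume "A \<in> range cyl"
  then obtain x where A: "A = cyl x" by blast
  have [measurable]: "Measurable.pred path_space (\<lambda>\<omega>. \<omega> m \<in> subtree x)" for m
    by (rule path_pred)
  have *: "lim_end \<omega> \<in> cyl x \<longleftrightarrow> conv \<omega> \<and> (\<exists>N. \<forall>m\<ge>N. \<omega> m \<in> subtree x) \<or> \<not> conv \<omega> \<and> (SOME \<xi>. \<xi> \<in> ends) \<in> cyl x" for \<omega>
  proof (cases "conv \<omega>")
    case True
    from limit_end_cyl[OF this, of x] obtain N 
      where N: "\<forall>m\<ge>N. \<omega> m \<in> subtree x \<longleftrightarrow> limit_end par rt \<omega> \<in> cyl x" 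
      by (auto simp: eventually_sequentially)
    have "(\<exists>N. \<forall>m\<ge>N. \<omega> m \<in> subtree x) \<longleftrightarrow> limit_end par rt \<omega> \<in> cyl x"
      using N by (meson nle_le order_trans)
    then show ?thesis using True by (simp add: lim_end_def)
  qed (simp add: lim_end_def)
  have "{\<omega> \<in> space path_space. conv \<omega> \<and> (\<exists>N. \<forall>m\<ge>N. \<omega> m \<in> subtree x) \<or> \<not> conv \<omega> \<and> (SOME \<xi>. \<xi> \<in> ends) \<in> cyl x} \<in> sets path_space"
    by measurable
  then show "lim_end -` A \<inter> space path_space \<in> sets path_space"
    unfolding A vimage_def Int_def mem_Collect_eq * by (simp add: space_path_space)
qed (use lim_end_ends cyl_subset_ends in auto)

text \<open>\<open>distr\<close> only looks at measures of preimages. Those under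
  \<open>limit_end\<close> and \<open>lim_end\<close> differ within the null set of non-convergent
  paths, so it remains to see that the former are measurable.\<close>

lemma hit_eq_distr: "hit s = distr (law s) bd lim_end"
  unfolding hit_distr_def distr_def
proof (rule measure_of_eq)
  show "sets bd \<subseteq> Pow (space bd)" by (rule sets.space_closed)
  fix A assume "A \<in> sigma_sets (space bd) (sets bd)"
  then have A: "A \<in> sets bd" using sets.sigma_sets_eq[of bd] by simp
  \<comment> \<open>On a non-convergent path no end satisfies the description, so \<open>THE\<close>
    is applied to the constantly false predicate and gives one common value. This makes the
    preimages under \<open>limit_end\<close> measurable.\<close>
  define junk where "junk = (THE \<xi> :: nat \<Rightarrow> 'a. False)"
  have "\<not> conv \<omega> \<Longrightarrow> limit_end par rt \<omega> = junk" for \<omega>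
    unfolding limit_end_def junk_def conv_iff by (rule arg_cong[where f=The]) auto
  then have eq: "limit_end par rt -` A = {\<omega>. conv \<omega> \<and> lim_end \<omega> \<in> A \<or> \<not> conv \<omega> \<and> junk \<in> A}"
    by (auto simp: lim_end_def)
  have m1: "lim_end -` A \<inter> space path_space \<in> sets path_space"
    by (rule measurable_sets[OF lim_end_measurable A])
  have "{\<omega> \<in> space path_space. conv \<omega> \<and> lim_end \<omega> \<in> A \<or> \<not> conv \<omega> \<and> junk \<in> A} \<in> sets path_space"
    using A by measurable
  then have "limit_end par rt -` A \<in> sets path_space"
    unfolding eq by (simp add: space_path_space)
  then show "emeasure (law s) (limit_end par rt -` A \<inter> space (law s))
      = emeasure (law s) (lim_end -` A \<inter> space (law s))"
    using m1 AE_conv[of s]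
    by (intro emeasure_eq_AE) (auto simp: space_path_space eq elim!: eventually_mono)
qed

lemma sets_hit [simp, measurable_cong]: "sets (hit s) = sets bd"
  by (simp add: hit_eq_distr)

lemma space_hit [simp]: "space (hit s) = ends"
  by (simp add: hit_eq_distr)

sublocale hit: prob_space "hit s" for s
  unfolding hit_eq_distr by (rule law.prob_space_distr) simp

text \<open>Along a convergent path, membership in \<open>subtree x\<close> is eventually constant
  and tells whether the limit lies in \<open>cyl x\<close>; dominated convergence carries this to
  probabilities.\<close>

lemma prob_subtree_limit:
  "(\<lambda>n. measure (law s) {\<omega>. \<omega> n \<in> subtree x}) \<longlonglongrightarrow> measure (hit s) (cyl x)"
proof -
  have "(\<lambda>n. \<integral>\<omega>. indicator {\<omega>. \<omega> n \<in> subtree x} \<omega> \<partial>law s)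
      \<longlonglongrightarrow> (\<integral>\<omega>. (indicator {\<omega>. lim_end \<omega> \<in> cyl x} \<omega> :: real) \<partial>law s)"
  proof (rule integral_dominated_convergence[where w="\<lambda>_. 1"])
    show "AE \<omega> in law s. (\<lambda>n. indicator {\<omega>. \<omega> n \<in> subtree x} \<omega>) \<longlonglongrightarrow> (indicator {\<omega>. lim_end \<omega> \<in> cyl x} \<omega> :: real)"
      using AE_conv
    proof eventually_elim
      case (elim \<omega>)
      have "eventually (\<lambda>n. indicator {\<omega>. \<omega> n \<in> subtree x} \<omega> = (indicator {\<omega>. lim_end \<omega> \<in> cyl x} \<omega> :: real)) sequentially"
        using limit_end_cyl[OF elim, of x] by eventually_elim (simp add: lim_end_def elim indicator_def)
      then show ?case by (rule tendsto_eventually)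
    qed
    have "{\<omega> \<in> space path_space. lim_end \<omega> \<in> cyl x} \<in> sets path_space" by measurable
    then show "(indicator {\<omega>. lim_end \<omega> \<in> cyl x} :: _ \<Rightarrow> real) \<in> borel_measurable (law s)"
      by (simp add: space_path_space)
    show "(indicator {\<omega>. \<omega> n \<in> subtree x} :: _ \<Rightarrow> real) \<in> borel_measurable (law s)" for n
      by simp
  qed (auto simp: indicator_def)
  moreover have "measure (hit s) (cyl x) = measure (law s) {\<omega>. lim_end \<omega> \<in> cyl x}"
    unfolding hit_eq_distr by (subst measure_distr) (auto simp: vimage_def)
  ultimately show ?thesis by (simp add: vimage_def)
qed

text \<open>In one step the probability of being in \<open>subtree x\<close> changes by the downward
  minus the upward crossing probability of the edge above \<open>x\<close>. Summing over time turns
  the visits into Green functions, and the indicator of the starting point is the term at time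
  0.\<close>

lemma measure_hit_cyl:
  assumes "x \<noteq> rt"
  shows "measure (hit s) (cyl x) =
    (if s \<in> subtree x then 1 else 0) + G s (par x) * p (par x) x - G s x * p x (par x)"
proof -
  let ?T = "subtree x"
  let ?a = "\<lambda>n. measure (law s) {\<omega>. \<omega> n \<in> ?T}"
  have [simp]: "{\<omega> :: nat \<Rightarrow> 'a. \<omega> n = y \<and> \<omega> (Suc n) = z} \<in> sets path_space" for n y z
  proof -
    have "{\<omega> \<in> space path_space. \<omega> n = y \<and> \<omega> (Suc n) = z} \<in> sets path_space" by measurable
    then show ?thesis by (simp add: space_path_space)
  qed
  have step: "?a (Suc n) - ?a n = ps n s (par x) * p (par x) x - ps n s x * p x (par x)" for n
  proof -
    let ?I = "\<lambda>A \<omega>. indicator A \<omega> :: real"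
    have "AE \<omega> in law s. ?I {\<omega>. \<omega> (Suc n) \<in> ?T} \<omega> - ?I {\<omega>. \<omega> n \<in> ?T} \<omega>
       = ?I {\<omega>. \<omega> n = par x \<and> \<omega> (Suc n) = x} \<omega> - ?I {\<omega>. \<omega> n = x \<and> \<omega> (Suc n) = par x} \<omega>"
      using AE_law_adj
    proof eventually_elim
      case (elim \<omega>)
      then have *: "\<omega> (Suc n) \<in> nbrs par rt (\<omega> n)" "\<omega> n \<in> nbrs par rt (\<omega> (Suc n))"
        using adj_sym by (auto simp: nbrs_def)
      show ?case
        using subtree_step[OF assms *(1)] subtree_step[OF assms *(2)] par_neq[OF assms]
        by (auto simp: indicator_def)
    qed
    then have "(\<integral>\<omega>. ?I {\<omega>. \<omega> (Suc n) \<in> ?T} \<omega> - ?I {\<omega>. \<omega> n \<in> ?T} \<omega> \<partial>law s)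
       = (\<integral>\<omega>. ?I {\<omega>. \<omega> n = par x \<and> \<omega> (Suc n) = x} \<omega> - ?I {\<omega>. \<omega> n = x \<and> \<omega> (Suc n) = par x} \<omega> \<partial>law s)"
      by (intro integral_cong_AE) auto
    then show ?thesis
      by (subst (asm) (1 2) Bochner_Integration.integral_diff)
         (auto simp: prob_pstep2 less_top[symmetric] intro!: integrable_real_indicator)
  qed
  have "?a n - ?a 0 = (\<Sum>k<n. ps k s (par x) * p (par x) x - ps k s x * p x (par x))" for n
    by (induction n) (auto simp: step[symmetric])
  moreover have "(\<lambda>n. \<Sum>k<n. ps k s (par x) * p (par x) x - ps k s x * p x (par x))
      \<longlonglongrightarrow> G s (par x) * p (par x) x - G s x * p x (par x)"
    using sums_diff[OF sums_mult2[OF ps_sums] sums_mult2[OF ps_sums]] unfolding sums_def by blast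
  ultimately have "(\<lambda>n. ?a n - ?a 0) \<longlonglongrightarrow> G s (par x) * p (par x) x - G s x * p x (par x)"
    by simp
  moreover have "(\<lambda>n. ?a n - ?a 0) \<longlonglongrightarrow> measure (hit s) (cyl x) - ?a 0"
    by (intro tendsto_diff prob_subtree_limit tendsto_const)
  ultimately have "measure (hit s) (cyl x) - ?a 0 = G s (par x) * p (par x) x - G s x * p x (par x)"
    by (rule LIMSEQ_unique[rotated])
  moreover have "?a 0 = (if s \<in> ?T then 1 else 0)"
  proof -
    have "?a 0 = measure (law s) (if s \<in> ?T then UNIV else {})"
        using AE_law_0[of s] sets.top[of "path_space :: (nat \<Rightarrow> 'a) measure"]
      by (intro law.finite_measure_eq_AE) (auto simp: space_path_space elim!: eventually_mono)
    then show ?thesis using law.prob_space[of s] by (auto split: if_splits)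
  qed
  ultimately show ?thesis by simp
qed

end

section \<open>Green function and limit distributions\<close>

context branching_tree
begin

lemma not_in_subtree_par: "x \<noteq> rt \<Longrightarrow> par x \<notin> subtree x"
  using anc_depth_le[of x "par x"] depth_par[of x] by (auto simp: in_subtree_iff)

lemma subtree_self [simp]: "x \<in> subtree x"
  by (simp add: in_subtree_iff)

lemma rt_in_subtree: "rt \<in> subtree x \<longleftrightarrow> x = rt"
  by (auto simp: in_subtree_iff anc_rt)

text \<open>Together with \<open>subtree_entry\<close> this provides the separation hypothesis of
  the first passage identities: \<open>par x\<close> separates the subtree from outside, and
  \<open>x\<close> separates the complement from inside.\<close>

lemma subtree_exit:
  assumes "x \<noteq> rt" "w \<in> subtree x"
  shows "nbrs par rt w \<subseteq> subtree x \<union> {par x}"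
proof
  fix v assume "v \<in> nbrs par rt w"
  then have "w \<in> nbrs par rt v" by (simp add: nbrs_def adj_sym)
  then show "v \<in> subtree x \<union> {par x}" using subtree_step[OF assms(1), of w v] assms(2) by blast
qed

lemma subtree_entry:
  assumes "x \<noteq> rt" "w \<notin> subtree x"
  shows "nbrs par rt w \<subseteq> - subtree x \<union> {x}"
  using subtree_step[OF assms(1), of _ w] assms(2) by blast

end

context tree_walk
begin

section \<open>Conductances and reversibility\<close>

abbreviation "m \<equiv> mweight par rt p"
abbreviation "a \<equiv> cond par rt p"

lemma p_par_pos: "x \<noteq> rt \<Longrightarrow> 0 < p x (par x)" "x \<noteq> rt \<Longrightarrow> 0 < p (par x) x"
  by (auto simp: p_pos_iff nbrs_def adj_def)

lemma m_rt [simp]: "m rt = 1"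
  by (simp add: mweight_def anc_rt)

lemma m_step: "x \<noteq> rt \<Longrightarrow> m x = m (par x) * (p (par x) x / p x (par x))"
proof -
  assume x: "x \<noteq> rt"
  have "anc par rt x - {rt} = insert x (anc par rt (par x) - {rt})"
    using x by (auto simp: anc_step[OF x])
  moreover have "x \<notin> anc par rt (par x) - {rt}"
    using not_in_subtree_par[OF x] by (simp add: in_subtree_iff)
  ultimately show ?thesis
    unfolding mweight_def by (simp add: mult.commute)
qed

lemma m_pos: "0 < m x"
  by (induction x rule: tree_induct) (simp_all add: m_step p_par_pos)

lemma a_eq: "x \<noteq> rt \<Longrightarrow> a x = m (par x) * p (par x) x"
  using p_par_pos[of x] by (simp add: cond_def m_step)

lemma a_pos: "x \<noteq> rt \<Longrightarrow> 0 < a x"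
  by (simp add: a_eq m_pos p_par_pos)

text \<open>Every nearest neighbour walk on a tree is reversible: \<open>m\<close> is defined so
  that detailed balance holds on each edge to a parent, and there are no other edges.\<close>

lemma m_reversible: "m x * p x y = m y * p y x"
proof -
  consider "x \<noteq> rt" "y = par x" | "y \<noteq> rt" "x = par y" | "\<not> adj par rt x y" by (auto simp: adj_def)
  then show ?thesis
  proof cases
    case 1 then show ?thesis using a_eq[of x] by (simp add: cond_def)
  next
    case 2 then show ?thesis using a_eq[of y] by (simp add: cond_def)
  next
    case 3
    then have "p x y = 0" "p y x = 0" using adj_sym by (auto intro!: p_eq_0 simp: nbrs_def)
    then show ?thesis by simp
  qed
qed

text \<open>\<open>pstep\<close> recurses on the first step; reversing paths requires the
  decomposition at the last step.\<close>

lemma pstep_last: "pstep par rt p (Suc n) x z = (\<Sum>w\<in>nbrs par rt z. pstep par rt p n x w * p w z)"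
proof (induction n arbitrary: x)
  case 0
  have "pstep par rt p (Suc 0) x z = (if z \<in> nbrs par rt x then p x z else 0)"
    by (simp add: sum.delta if_distrib[of "\<lambda>t. _ * t"] cong: if_cong)
  also have "\<dots> = (if x \<in> nbrs par rt z then p x z else 0)"
    using adj_sym by (auto simp: nbrs_def)
  also have "\<dots> = (\<Sum>w\<in>nbrs par rt z. pstep par rt p 0 x w * p w z)"
    by (simp add: sum.delta' if_distrib[of "\<lambda>t. t * _"] cong: if_cong)
  finally show ?case .
next
  case (Suc n)
  have "pstep par rt p (Suc (Suc n)) x z
      = (\<Sum>v\<in>nbrs par rt x. p x v * (\<Sum>w\<in>nbrs par rt z. pstep par rt p n v w * p w z))"
    by (subst pstep.simps(2)) (simp only: Suc)
  also have "\<dots> = (\<Sum>w\<in>nbrs par rt z. \<Sum>v\<in>nbrs par rt x. p x v * (pstep par rt p n v w * p w z))"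
    unfolding sum_distrib_left by (rule sum.swap)
  also have "\<dots> = (\<Sum>w\<in>nbrs par rt z. pstep par rt p (Suc n) x w * p w z)"
    by (simp add: sum_distrib_right mult.assoc)
  finally show ?case .
qed

lemma pstep_reversible: "m x * pstep par rt p n x y = m y * pstep par rt p n y x"
proof (induction n arbitrary: x)
  case (Suc n)
  have "m x * pstep par rt p (Suc n) x y = (\<Sum>v\<in>nbrs par rt x. (m x * p x v) * pstep par rt p n v y)"
    by (simp add: sum_distrib_left mult.assoc)
  also have "\<dots> = (\<Sum>v\<in>nbrs par rt x. p v x * (m v * pstep par rt p n v y))"
    by (intro sum.cong) (simp_all add: m_reversible[of x])
  also have "\<dots> = (\<Sum>v\<in>nbrs par rt x. m y * (pstep par rt p n y v * p v x))"
    unfolding Suc by (simp add: mult_ac)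
  also have "\<dots> = m y * pstep par rt p (Suc n) y x"
    unfolding pstep_last sum_distrib_left ..
  finally show ?case .
qed simp

end

context transient_tree_walk
begin

section \<open>First passage and Green function identities\<close>

abbreviation "fp \<equiv> fpass par rt p"
abbreviation "F \<equiv> Fhit par rt p"

lemma fp_nonneg [simp]: "0 \<le> fp n x y"
  by (induction n arbitrary: x) (auto intro!: sum_nonneg)

lemma fp_le_ps: "fp n x y \<le> ps n x y"
proof (induction n arbitrary: x)
  case (Suc n)
  then show ?case
    by (auto intro!: sum_mono mult_left_mono sum_nonneg)
qed simp

lemma fp_summable: "summable (\<lambda>n. fp n x y)"
  by (rule summable_comparison_test'[of "\<lambda>n. ps n x y" 0]) (auto simp: fp_le_ps)

text \<open>From \<open>W\<close> the target \<open>z\<close> can only be reached through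
  \<open>b\<close>, so \<open>k\<close> is the time of the first visit to \<open>b\<close>. The
  recursion of \<open>fpass\<close> matches that of \<open>pstep\<close> on
  \<open>W\<close>.\<close>

lemma ps_first_passage:
  assumes exit: "\<And>w. w \<in> W \<Longrightarrow> nbrs par rt w \<subseteq> W \<union> {b}" and b: "b \<notin> W" and z: "z \<notin> W"
    and w: "w \<in> W \<union> {b}"
  shows "ps n w z = (\<Sum>k\<le>n. fp k w b * ps (n - k) b z)"
  using w
proof (induction n arbitrary: w)
  case 0
  then show ?case using z by auto
next
  case (Suc n)
  show ?case
  proof (cases "w = b")
    case True
    \<comment> \<open>A neighbour of a vertex of \<open>W\<close> may be \<open>b\<close> itself, so
      the induction must include \<open>w = b\<close>; the convolution then collapses to its term at
      \<open>k = 0\<close>.\<close>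
    have "fp k b b = (if k = 0 then 1 else 0)" for k by (cases k) auto
    then show ?thesis
      using True by (simp add: sum.delta if_distrib[of "\<lambda>t. t * _"] cong: if_cong del: pstep.simps sum.atMost_Suc)
  next
    case False
    then have wW: "w \<in> W" using Suc.prems by auto
    have "ps (Suc n) w z = (\<Sum>v\<in>nbrs par rt w. p w v * (\<Sum>k\<le>n. fp k v b * ps (n - k) b z))"
      unfolding pstep.simps using exit[OF wW] by (intro sum.cong refl) (auto simp: Suc.IH)
    also have "\<dots> = (\<Sum>k\<le>n. \<Sum>v\<in>nbrs par rt w. p w v * (fp k v b * ps (n - k) b z))"
      unfolding sum_distrib_left by (rule sum.swap)
    also have "\<dots> = (\<Sum>k\<le>n. fp (Suc k) w b * ps (Suc n - Suc k) b z)"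
      using False by (simp add: sum_distrib_right mult.assoc)
    also have "\<dots> = (\<Sum>k\<le>Suc n. fp k w b * ps (Suc n - k) b z)"
      using False unfolding sum.atMost_Suc_shift by simp
    finally show ?thesis .
  qed
qed

text \<open>The convolution over the passage time is the Cauchy product of the series for
  \<open>F w b\<close> and \<open>G b z\<close>.\<close>

lemma G_first_passage:
  assumes "\<And>w. w \<in> W \<Longrightarrow> nbrs par rt w \<subseteq> W \<union> {b}" "b \<notin> W" "z \<notin> W" "w \<in> W"
  shows "G w z = F w b * G b z"
proof -
  have "(\<lambda>n. \<Sum>k\<le>n. fp k w b * ps (n - k) b z) sums (F w b * G b z)"
    unfolding Fhit_def Green_def
    by (rule Cauchy_product_sums) (use fp_summable in \<open>auto\<close>)
  then have "(\<lambda>n. ps n w z) sums (F w b * G b z)"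
    using ps_first_passage[OF assms(1-3), of w] assms(4) by simp
  then show ?thesis using ps_sums sums_unique2 by blast
qed

lemma G_first_step: "G x z = (if x = z then 1 else 0) + (\<Sum>v\<in>nbrs par rt x. p x v * G v z)"
proof -
  have "(\<lambda>n. ps (Suc n) x z) sums (\<Sum>v\<in>nbrs par rt x. p x v * G v z)"
    unfolding pstep.simps by (intro sums_sum sums_mult ps_sums)
  from sums_Suc[OF this] have "(\<lambda>n. ps n x z) sums ((\<Sum>v\<in>nbrs par rt x. p x v * G v z) + ps 0 x z)" .
  from sums_unique2[OF ps_sums this] show ?thesis by simp
qed

lemma G_last_step: "G x z = (if x = z then 1 else 0) + (\<Sum>w\<in>nbrs par rt z. G x w * p w z)"
proof -
  have "(\<lambda>n. ps (Suc n) x z) sums (\<Sum>w\<in>nbrs par rt z. G x w * p w z)"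
    unfolding pstep_last by (intro sums_sum sums_mult2 ps_sums)
  from sums_Suc[OF this] have "(\<lambda>n. ps n x z) sums ((\<Sum>w\<in>nbrs par rt z. G x w * p w z) + ps 0 x z)" .
  from sums_unique2[OF ps_sums this] show ?thesis by simp
qed

lemma G_nonneg [simp]: "0 \<le> G x y"
  unfolding Green_def by (rule suminf_nonneg) auto

lemma G_reversible: "m x * G x y = m y * G y x"
  using sums_mult[OF ps_sums[of x y], of "m x"] sums_mult[OF ps_sums[of y x], of "m y"]
  unfolding pstep_reversible[of x] by (rule sums_unique2)

abbreviation g :: "'a \<Rightarrow> real" where "g x \<equiv> G x rt"

lemma g_pos: "0 < g x"
proof (induction x rule: tree_induct)
  case root
  have "0 \<le> (\<Sum>v\<in>nbrs par rt rt. p rt v * G v rt)" by (intro sum_nonneg) simp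
  then show ?case by (subst G_first_step) simp
next
  case (child x)
  have "0 < p x (par x) * g (par x)" using child p_par_pos by simp
  also have "\<dots> \<le> (\<Sum>v\<in>nbrs par rt x. p x v * G v rt)"
    using child.hyps by (intro member_le_sum) (auto simp: nbrs_eq)
  finally show ?case using child.hyps by (subst G_first_step) simp
qed

lemma G_rt_pos: "0 < G rt x"
  using G_reversible[of rt x] m_pos[of x] g_pos[of x] by simp

lemma g_step: "x \<noteq> rt \<Longrightarrow> g x = F x (par x) * g (par x)"
  by (rule G_first_passage[OF subtree_exit]) (simp_all add: not_in_subtree_par rt_in_subtree)

abbreviation \<nu> :: "'a \<Rightarrow> real" where "\<nu> x \<equiv> measure (hit rt) (cyl x)"

lemma hit_ends [simp]: "measure (hit s) ends = 1"
  using hit.prob_space[of s] by simp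

text \<open>The net number of crossings of the edge above \<open>x\<close> is the indicator of ending below \<open>x\<close>.\<close>

lemma \<nu>_eq: "x \<noteq> rt \<Longrightarrow> \<nu> x = a x * (g (par x) - g x)"
proof -
  assume x: "x \<noteq> rt"
  have "G rt (par x) * p (par x) x = a x * g (par x)"
    using G_reversible[of rt "par x"] by (simp add: a_eq[OF x])
  moreover have "G rt x * p x (par x) = a x * g x"
    using G_reversible[of rt x] by (simp add: cond_def)
  ultimately show ?thesis
    using measure_hit_cyl[OF x, of rt] x by (simp add: rt_in_subtree algebra_simps)
qed

lemma hit_cyl_children: "measure (hit s) (cyl x) = (\<Sum>y\<in>chl x. measure (hit s) (cyl y))"
  by (subst cyl_children)
     (rule hit.finite_measure_finite_Union, auto simp: cyl_children_disjoint)

end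

locale descending_green_walk = transient_tree_walk +
  assumes F_lt1: "\<forall>x. x \<noteq> rt \<longrightarrow> Fhit par rt p x (par x) < 1"
begin

lemma g_decreasing: "x \<noteq> rt \<Longrightarrow> g x < g (par x)"
  using F_lt1 g_step[of x] g_pos[of "par x"] by simp

text \<open>Strict decrease of \<open>g\<close>, which expresses \<open>F < 1\<close>, means that
  the limit distribution charges every cylinder; it justifies all later divisions by
  \<open>\<nu>\<close>.\<close>

lemma \<nu>_pos: "0 < \<nu> x"
  by (cases "x = rt") (simp_all add: \<nu>_eq a_pos g_decreasing)

text \<open>The measure \<open>hit x\<close> minus \<open>F x (par x)\<close> times
  \<open>hit (par x)\<close> has total mass \<open>1 - F x (par x)\<close> and turns out to be a
  multiple of \<open>hit rt\<close> on \<open>cyl x\<close>; this forces the factor.\<close>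

definition C :: "'a \<Rightarrow> real" where
  "C x = (1 - F x (par x)) / \<nu> x"

text \<open>Before leaving \<open>T\<^sub>x\<close> through \<open>x\<^sup>-\<close> the walk from \<open>x\<close> sees the ends below \<open>x\<close> in the same
  proportions as the walk from the root; afterwards it is a walk from \<open>x\<^sup>-\<close>.\<close>

lemma hit_cyl_relation:
  assumes x: "x \<noteq> rt"
  shows "measure (hit x) (cyl y) =
    F x (par x) * measure (hit (par x)) (cyl y) + C x * measure (hit rt) (cyl x \<inter> cyl y)"
proof -
  let ?b = "par x" and ?T = "subtree x"
  define f where "f = F x ?b"
  \<comment> \<open>This counts the expected visits to \<open>z\<close>, starting at
    \<open>x\<close>, before \<open>par x\<close> is reached. It vanishes outside the subtree and is
    proportional to \<open>G rt z\<close> inside, because walks from outside must enter at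
    \<open>x\<close>.\<close>
  define gh where "gh z = G x z - f * G ?b z" for z
  define C' where "C' = (1 - f * F ?b x) / F rt x"
  have up: "G x z = f * G ?b z" if "z \<notin> ?T" for z
    unfolding f_def
    by (rule G_first_passage[OF subtree_exit[OF x]]) (use that x in \<open>simp_all add: not_in_subtree_par\<close>)
  have down: "G w z = F w x * G x z" if "z \<in> ?T" "w \<notin> ?T" for w z
    by (rule G_first_passage[where W="- ?T"]) (use that subtree_entry[OF x] in simp_all)
  have rtT: "rt \<notin> ?T" using x by (simp add: rt_in_subtree)
  have bT: "?b \<notin> ?T" by (rule not_in_subtree_par[OF x])
  have gh0: "gh z = 0" if "z \<notin> ?T" for z using up[OF that] by (simp add: gh_def)
  have Fpos: "F rt x \<noteq> 0" using down[of x rt] rtT G_rt_pos[of x] by auto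
  have ghT: "gh z = C' * G rt z" if "z \<in> ?T" for z
    using down[OF that rtT] down[OF that bT] Fpos by (simp add: gh_def C'_def field_simps)
  \<comment> \<open>The killed walk reaches \<open>par x\<close> only by the edge from
    \<open>x\<close>. Formally this is the last-step equation at \<open>par x\<close>, where
    \<open>gh\<close> is zero and \<open>x\<close> is the only neighbour contributing.\<close>
  have ghx: "gh x * p x ?b = f"
  proof -
    have "gh ?b = - f + (\<Sum>w\<in>nbrs par rt ?b. gh w * p w ?b)"
      unfolding gh_def using G_last_step[of x ?b] G_last_step[of ?b ?b] par_neq[OF x]
      by (simp add: sum_subtractf sum_distrib_left algebra_simps)
    also have "(\<Sum>w\<in>nbrs par rt ?b. gh w * p w ?b) = (\<Sum>w\<in>{x}. gh w * p w ?b)"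
    proof (rule sum.mono_neutral_right)
      show "{x} \<subseteq> nbrs par rt ?b" using x by (auto simp: nbrs_def adj_def)
      show "\<forall>w\<in>nbrs par rt ?b - {x}. gh w * p w ?b = 0"
        using subtree_entry[OF x bT] gh0 by auto
    qed simp
    finally show ?thesis using gh0[OF bT] by simp
  qed
  have xb: "x \<in> subtree y \<longleftrightarrow> y = x \<or> ?b \<in> subtree y" for y
    by (auto simp: in_subtree_iff anc_step[OF x])
  have diff: "measure (hit x) (cyl y) - f * measure (hit ?b) (cyl y)
     = (if x \<in> subtree y then 1 else 0) - f * (if ?b \<in> subtree y then 1 else 0)
       + gh (par y) * p (par y) y - gh y * p y (par y)" if "y \<noteq> rt" for y
    unfolding measure_hit_cyl[OF that] gh_def by (simp add: algebra_simps)
  have diff_x: "measure (hit x) (cyl x) - f * measure (hit ?b) (cyl x) = 1 - f"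
    using diff[OF x] gh0[OF bT] ghx bT by simp
  have diff_below: "measure (hit x) (cyl y) - f * measure (hit ?b) (cyl y) = C' * \<nu> y"
    if y: "y \<in> ?T" "y \<noteq> x" for y
  proof -
    have ry: "y \<noteq> rt" using y rtT by auto
    have py: "par y \<in> ?T" using y by (auto simp: in_subtree_iff anc_step[OF ry])
    have "x \<notin> subtree y" using y anc_antisym by (auto simp: in_subtree_iff)
    moreover have "?b \<notin> subtree y" using calculation xb by blast
    ultimately show ?thesis
      unfolding diff[OF ry] ghT[OF y(1)] ghT[OF py] measure_hit_cyl[OF ry, of rt] using ry
      by (simp add: rt_in_subtree algebra_simps)
  qed
  \<comment> \<open>Proportionality is known only for vertices strictly below \<open>x\<close>.
    Adding over the children of \<open>x\<close> extends it to \<open>x\<close> itself, where the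
    total mass \<open>1 - f\<close> identifies \<open>C'\<close>.\<close>
  have "C' * \<nu> x = (\<Sum>y\<in>chl x. C' * \<nu> y)"
    unfolding hit_cyl_children[of rt x] sum_distrib_left ..
  also have "\<dots> = (\<Sum>y\<in>chl x. measure (hit x) (cyl y) - f * measure (hit ?b) (cyl y))"
  proof (rule sum.cong)
    fix y assume "y \<in> chl x"
    then have "y \<in> ?T" "y \<noteq> x"
      using par_neq[of y] by (auto simp: children_iff in_subtree_iff anc_step)
    then show "C' * \<nu> y = measure (hit x) (cyl y) - f * measure (hit ?b) (cyl y)"
      by (rule diff_below[symmetric])
  qed simp
  also have "\<dots> = measure (hit x) (cyl x) - f * measure (hit ?b) (cyl x)"
    unfolding hit_cyl_children[of _ x] by (simp add: sum_subtractf sum_distrib_left)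
  finally have "C' * \<nu> x = 1 - f" using diff_x by simp
  then have C': "C' = C x" using \<nu>_pos[of x] by (simp add: C_def f_def field_simps)
  have C\<nu>: "C x * \<nu> x = 1 - f" using \<nu>_pos[of x] by (simp add: C_def f_def)
  have "measure (hit x) (cyl y) - f * measure (hit ?b) (cyl y) = C x * measure (hit rt) (cyl x \<inter> cyl y)"
  proof -
    consider "y = rt" | "y = x" | "y \<in> ?T" "y \<noteq> x" | "y \<noteq> rt" "y \<notin> ?T" "y \<in> anc par rt x"
      | "y \<noteq> rt" "y \<notin> ?T" "y \<notin> anc par rt x" by blast
    then show ?thesis
    proof cases
      case 1
      then show ?thesis using hit.prob_space[of x] hit.prob_space[of ?b] C\<nu> cyl_subset_ends[of x]
        by (simp add: Int_absorb2)
    next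
      case 2 then show ?thesis using diff_x C\<nu> by simp
    next
      case 3
      then have "cyl x \<inter> cyl y = cyl y" using cyl_mono[of x y] by (auto simp: in_subtree_iff)
      then show ?thesis using diff_below[OF 3] C' by simp
    next
      case 4
      have "cyl x \<inter> cyl y = cyl x" using cyl_mono[OF 4(3)] by auto
      moreover have "par y \<notin> ?T" using 4 by (auto simp: in_subtree_iff anc_step[of y])
      moreover have "x \<in> subtree y" using 4 by (simp add: in_subtree_iff)
      moreover have "?b \<in> subtree y" using 4 calculation xb[of y] by auto
      ultimately show ?thesis using diff[OF 4(1)] gh0 4(2) C\<nu> by simp
    next
      case 5
      have "cyl x \<inter> cyl y = {}" using 5 by (intro cyl_disjoint) (auto simp: in_subtree_iff)
      moreover have "par y \<notin> ?T" using 5 by (auto simp: in_subtree_iff anc_step[of y])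
      moreover have "x \<notin> subtree y" using 5 by (simp add: in_subtree_iff)
      moreover have "?b \<notin> subtree y" using calculation xb[of y] by auto
      ultimately show ?thesis using diff[OF 5(1)] gh0 5(2) by simp
    qed
  qed
  then show ?thesis by (simp add: f_def)
qed

lemma F_nonneg: "0 \<le> F x y"
  unfolding Fhit_def by (rule suminf_nonneg) (auto simp: fp_summable)

lemma C_nonneg: "x \<noteq> rt \<Longrightarrow> 0 \<le> C x"
  using F_lt1 \<nu>_pos[of x] by (simp add: C_def less_imp_le)

lemma hit_density_step:
  assumes x: "x \<noteq> rt" and k [measurable]: "k \<in> borel_measurable bd" and k0: "\<And>\<xi>. 0 \<le> k \<xi>"
    and hk: "hit (par x) = density (hit rt) (\<lambda>\<xi>. ennreal (k \<xi>))"
  shows "hit x = density (hit rt) (\<lambda>\<xi>. ennreal (F x (par x) * k \<xi> + C x * indicator (cyl x) \<xi>))"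
proof (rule measure_eqI_cyl)
  let ?f = "F x (par x)"
  show "emeasure (hit x) ends \<noteq> \<infinity>" by (simp add: hit.emeasure_eq_measure)
  have split1: "ennreal (?f * k \<xi> + C x) = ennreal ?f * ennreal (k \<xi>) + ennreal (C x)"
    "ennreal (?f * k \<xi>) = ennreal ?f * ennreal (k \<xi>)" for \<xi>
    by (simp_all add: ennreal_plus ennreal_mult F_nonneg C_nonneg[OF x] k0)
  fix y
  have "emeasure (density (hit rt) (\<lambda>\<xi>. ennreal (?f * k \<xi> + C x * indicator (cyl x) \<xi>))) (cyl y)
    = (\<integral>\<^sup>+\<xi>. ennreal ?f * (ennreal (k \<xi>) * indicator (cyl y) \<xi>)
        + ennreal (C x) * indicator (cyl x \<inter> cyl y) \<xi> \<partial>hit rt)"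
    by (subst emeasure_density)
       (auto intro!: nn_integral_cong simp: split1 indicator_def)
  also have "\<dots> = ennreal ?f * emeasure (density (hit rt) (\<lambda>\<xi>. ennreal (k \<xi>))) (cyl y)
        + ennreal (C x) * emeasure (hit rt) (cyl x \<inter> cyl y)"
    by (subst nn_integral_add)
       (auto simp: nn_integral_cmult emeasure_density nn_integral_cmult_indicator)
  also have "\<dots> = ennreal (?f * measure (hit (par x)) (cyl y) + C x * measure (hit rt) (cyl x \<inter> cyl y))"
    unfolding hk[symmetric] hit.emeasure_eq_measure
    by (simp add: F_nonneg C_nonneg[OF x] ennreal_mult[symmetric] flip: ennreal_plus)
  also have "\<dots> = emeasure (hit x) (cyl y)"
    unfolding hit.emeasure_eq_measure hit_cyl_relation[OF x] ..
  finally show "emeasure (hit x) (cyl y) = emeasure (density (hit rt) (\<lambda>\<xi>. ennreal (?f * k \<xi> + C x * indicator (cyl x) \<xi>))) (cyl y)" ..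
qed simp_all

text \<open>Boundedness is the point: a function integrable for \<open>hit rt\<close> is then
  integrable for every \<open>hit x\<close>, so its Poisson transform is a genuine integral
  everywhere.\<close>

lemma hit_density:
  "\<exists>k\<in>borel_measurable bd. (\<exists>B. \<forall>\<xi>. 0 \<le> k \<xi> \<and> k \<xi> \<le> B) \<and> hit x = density (hit rt) (\<lambda>\<xi>. ennreal (k \<xi>))"
proof (induction x rule: tree_induct)
  case root
  show ?case
    by (rule bexI[of _ "\<lambda>_. 1"]) (auto simp: density_1)
next
  case (child x)
  then obtain k B where k [measurable]: "k \<in> borel_measurable bd" and B: "\<And>\<xi>. 0 \<le> k \<xi> \<and> k \<xi> \<le> B"
    and hk: "hit (par x) = density (hit rt) (\<lambda>\<xi>. ennreal (k \<xi>))" by blast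
  let ?k = "\<lambda>\<xi>. F x (par x) * k \<xi> + C x * indicator (cyl x) \<xi>"
  have "?k \<in> borel_measurable bd" by measurable
  moreover have "0 \<le> ?k \<xi> \<and> ?k \<xi> \<le> F x (par x) * B + C x * 1" for \<xi>
    using B[of \<xi>] F_nonneg[of x "par x"] C_nonneg[OF child.hyps]
    by (intro conjI add_nonneg_nonneg add_mono mult_left_mono mult_nonneg_nonneg) (auto simp: indicator_def)
  ultimately show ?case
    using hit_density_step[OF child.hyps k _ hk] B by (intro bexI[of _ ?k]) blast+
qed

abbreviation "h u x \<equiv> poisson par rt p u x"

definition cint :: "((nat \<Rightarrow> 'a) \<Rightarrow> real) \<Rightarrow> 'a \<Rightarrow> real" where
  "cint u x = (\<integral>\<xi>. indicator (cyl x) \<xi> * u \<xi> \<partial>hit rt)"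

lemma poisson_rt: "h u rt = cint u rt"
  unfolding poisson_def cint_def by (rule Bochner_Integration.integral_cong) auto

lemma integrable_indicator_cyl [simp]:
  fixes u :: "_ \<Rightarrow> real"
  shows "integrable (hit rt) u \<Longrightarrow> integrable (hit rt) (\<lambda>\<xi>. indicator (cyl x) \<xi> * u \<xi>)"
  using integrable_mult_indicator[of "cyl x" "hit rt" u] by simp

lemma poisson_step:
  assumes x: "x \<noteq> rt" and u: "integrable (hit rt) u"
  shows "h u x = F x (par x) * h u (par x) + C x * cint u x"
proof -
  obtain k B where k [measurable]: "k \<in> borel_measurable bd" and B: "\<And>\<xi>. 0 \<le> k \<xi> \<and> k \<xi> \<le> B"
    and hk: "hit (par x) = density (hit rt) (\<lambda>\<xi>. ennreal (k \<xi>))" using hit_density[of "par x"] by blast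
  have u' [measurable]: "u \<in> borel_measurable bd" using u by (simp add: borel_measurable_integrable[of "hit rt"] cong: measurable_cong_sets)
  have ku: "integrable (hit rt) (\<lambda>\<xi>. k \<xi> * u \<xi>)"
  proof (rule Bochner_Integration.integrable_bound[OF integrable_mult_right[OF integrable_abs[OF u], of B]])
    have "\<bar>k \<xi>\<bar> \<le> \<bar>B\<bar>" for \<xi> using B[of \<xi>] by auto
    then show "AE \<xi> in hit rt. norm (k \<xi> * u \<xi>) \<le> norm (B * \<bar>u \<xi>\<bar>)"
      by (auto simp: abs_mult intro!: mult_right_mono)
  qed measurable
  have h: "h u (par x) = (\<integral>\<xi>. k \<xi> * u \<xi> \<partial>hit rt)"
    unfolding poisson_def hk using B by (subst integral_density) auto
  have nn: "0 \<le> F x (par x) * k \<xi> + C x * indicator (cyl x) \<xi>" for \<xi>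
    using B[of \<xi>] F_nonneg[of x "par x"] C_nonneg[OF x]
    by (intro add_nonneg_nonneg mult_nonneg_nonneg) auto
  have "hit x = density (hit rt) (\<lambda>\<xi>. ennreal (F x (par x) * k \<xi> + C x * indicator (cyl x) \<xi>))"
    by (rule hit_density_step[OF x k _ hk]) (use B in auto)
  then have "h u x = (\<integral>\<xi>. (F x (par x) * k \<xi> + C x * indicator (cyl x) \<xi>) * u \<xi> \<partial>hit rt)"
    unfolding poisson_def using nn by (simp only:) (subst integral_density; auto)
  also have "\<dots> = (\<integral>\<xi>. F x (par x) * (k \<xi> * u \<xi>) + C x * (indicator (cyl x) \<xi> * u \<xi>) \<partial>hit rt)"
    by (intro Bochner_Integration.integral_cong) (auto simp: algebra_simps)
  also have "\<dots> = F x (par x) * h u (par x) + C x * cint u x"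
    unfolding h cint_def using ku u by (subst Bochner_Integration.integral_add) auto
  finally show ?thesis .
qed

end

section \<open>Tree energy and finite levels\<close>

lemma (in branching_tree) sum_level_par:
  fixes f :: "'v \<Rightarrow> 'v \<Rightarrow> 'b::comm_monoid_add"
  shows "(\<Sum>y\<in>level (Suc n). f y (par y)) = (\<Sum>x\<in>level n. \<Sum>y\<in>chl x. f y x)"
  unfolding sum_level_Suc by (intro sum.cong refl) (simp add: par_children)

lemma (in branching_tree) level_Suc_ne_rt: "y \<in> level (Suc n) \<Longrightarrow> y \<noteq> rt"
  by (auto simp: level_def)

locale vanishing_green_walk = descending_green_walk +
  assumes G_vanish: "\<forall>\<epsilon>>0. \<exists>S. finite S \<and> (\<forall>x. x \<notin> S \<longrightarrow> Green par rt p x rt < \<epsilon>)"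
begin

lemma g_vanish_depth: "0 < \<epsilon> \<Longrightarrow> \<exists>N. \<forall>x. N \<le> depth x \<longrightarrow> g x < \<epsilon>"
proof -
  assume "0 < \<epsilon>"
  then obtain S where S: "finite S" "\<And>x. x \<notin> S \<Longrightarrow> g x < \<epsilon>" using G_vanish by blast
  have "x \<notin> S" if "Suc (Max (depth ` S)) \<le> depth x" for x
    using S(1) that Max_ge[of "depth ` S" "depth x"] by (metis finite_imageI imageI not_less_eq_eq)
  then show ?thesis using S(2) by blast
qed

text \<open>Along a ray, while \<open>t\<close> runs from \<open>1 / g (par x)\<close> to
  \<open>1 / g x\<close>, the ball of radius \<open>1 / t\<close> is \<open>cyl x\<close>; hence
  this is the share of \<open>x\<close> in the integral defining \<open>J\<close>. The root carries
  the constant term \<open>1 / g rt\<close>.\<close>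

definition c :: "'a \<Rightarrow> real" where
  "c x = (if x = rt then 1 / g rt else (1 / g x - 1 / g (par x)) / \<nu> x)"

lemma c_nonneg: "0 \<le> c x"
proof (cases "x = rt")
  case False
  have "1 / g (par x) \<le> 1 / g x"
    using g_decreasing[OF False] g_pos[of x] by (intro divide_left_mono) auto
  then show ?thesis using False \<nu>_pos[of x] by (simp add: c_def)
qed (simp add: c_def)

lemma c_mult_\<nu>: "x \<noteq> rt \<Longrightarrow> c x * \<nu> x = 1 / g x - 1 / g (par x)"
  using \<nu>_pos[of x] by (simp add: c_def)

text \<open>No edge enters the root, and the value 0 there makes conservation of the flow hold at
  the root as well.\<close>

definition \<theta> :: "((nat \<Rightarrow> 'a) \<Rightarrow> real) \<Rightarrow> 'a \<Rightarrow> real" where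
  "\<theta> u x = (if x = rt then 0 else (h u x - h u (par x)) * a x)"

definition S :: "((nat \<Rightarrow> 'a) \<Rightarrow> real) \<Rightarrow> nat \<Rightarrow> real" where
  "S u n = (\<Sum>k<n. \<Sum>x\<in>level (Suc k). (h u x - h u (par x))\<^sup>2 * a x)"

definition B :: "((nat \<Rightarrow> 'a) \<Rightarrow> real) \<Rightarrow> nat \<Rightarrow> real" where
  "B u n = (\<Sum>x\<in>level n. g x * (\<theta> u x)\<^sup>2 / \<nu> x)"

lemma \<nu>_children: "(\<Sum>y\<in>chl x. \<nu> y) = \<nu> x"
  by (rule hit_cyl_children[symmetric])

text \<open>Since \<open>c x * \<nu> x\<close> is an increment of \<open>1 / g\<close> and
  additivity of \<open>K\<close> regroups children under their parent, consecutive levels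
  telescope.\<close>

lemma sum_c_additive:
  assumes K: "\<And>x. depth x < n \<Longrightarrow> K x = (\<Sum>y\<in>chl x. K y)"
  shows "(\<Sum>k\<le>n. \<Sum>x\<in>level k. c x * (\<nu> x * K x)) = (\<Sum>x\<in>level n. K x / g x)"
  using K
proof (induction n)
  case 0 then show ?case by (simp add: c_def)
next
  case (Suc n)
  have "(\<Sum>y\<in>level (Suc n). c y * (\<nu> y * K y)) = (\<Sum>y\<in>level (Suc n). K y / g y - K y / g (par y))"
  proof (intro sum.cong refl)
    fix y assume "y \<in> level (Suc n)"
    then show "c y * (\<nu> y * K y) = K y / g y - K y / g (par y)"
      using c_mult_\<nu>[OF level_Suc_ne_rt, of y n] by (simp add: mult.assoc[symmetric] left_diff_distrib)
  qed
  also have "\<dots> = (\<Sum>y\<in>level (Suc n). K y / g y) - (\<Sum>x\<in>level n. (\<Sum>y\<in>chl x. K y) / g x)"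
    unfolding sum_subtractf sum_level_par[of "\<lambda>y x. K y / g x"] by (simp add: sum_divide_distrib)
  also have "(\<Sum>x\<in>level n. (\<Sum>y\<in>chl x. K y) / g x) = (\<Sum>x\<in>level n. K x / g x)"
    using Suc.prems by (intro sum.cong) (auto simp: level_def)
  finally show ?case using Suc by simp
qed

context
  fixes u :: "(nat \<Rightarrow> 'a) \<Rightarrow> real"
  assumes u: "integrable (hit rt) u"
begin

lemma cint_children: "(\<Sum>y\<in>chl x. cint u y) = cint u x"
proof -
  have pt: "indicator (cyl x) \<xi> * u \<xi> = (\<Sum>y\<in>chl x. indicator (cyl y) \<xi> * u \<xi>)" for \<xi>
  proof -
    have "indicator (cyl x) \<xi> = (\<Sum>y\<in>chl x. indicator (cyl y) \<xi> :: real)"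
      by (subst cyl_children, subst indicator_UN_disjoint)
         (auto simp: cyl_children_disjoint)
    then show ?thesis by (simp add: sum_distrib_right)
  qed
  show ?thesis
    unfolding cint_def pt[abs_def] using u by (subst Bochner_Integration.integral_sum) auto
qed

text \<open>The parent-side twin of \<open>\<theta>_self\<close>. It is \<open>poisson_step\<close>
  rewritten with \<open>F x (par x) = g x / g (par x)\<close> and the definition of
  \<open>C\<close>.\<close>

lemma \<theta>_par: "x \<noteq> rt \<Longrightarrow> g (par x) * \<theta> u x = cint u x - \<nu> x * h u (par x)"
proof -
  assume x: "x \<noteq> rt"
  define f g' where "f = F x (par x)" and "g' = g (par x)"
  have f: "f < 1" using F_lt1 x by (simp add: f_def)
  have \<nu>: "\<nu> x = a x * g' * (1 - f)"
    using \<nu>_eq[OF x] g_step[OF x] by (simp add: f_def g'_def algebra_simps)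
  have pos: "0 < a x" "0 < g'" using a_pos[OF x] g_pos by (auto simp: g'_def)
  have "g' * ((f * h u (par x) + (1 - f) / (a x * g' * (1 - f)) * cint u x - h u (par x)) * a x)
     = cint u x - a x * g' * (1 - f) * h u (par x)"
    using pos f by (simp add: field_simps)
  then show ?thesis
    using x by (simp add: \<theta>_def poisson_step[OF x u] C_def \<nu> f_def[symmetric] g'_def[symmetric])
qed

lemma \<theta>_self: "g x * \<theta> u x = cint u x - \<nu> x * h u x"
proof (cases "x = rt")
  case True then show ?thesis by (simp add: \<theta>_def poisson_rt)
next
  case False
  have "(g (par x) - g x) * \<theta> u x = \<nu> x * (h u x - h u (par x))"
    using False by (simp add: \<theta>_def \<nu>_eq[OF False])
  then show ?thesis using \<theta>_par[OF False] by (simp add: algebra_simps)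
qed

text \<open>In \<open>\<theta>_par\<close> all children of \<open>x\<close> share the factor
  \<open>g x\<close> and the value \<open>h u x\<close>, so conservation of the flow, that is
  harmonicity of \<open>h u\<close>, follows from additivity of \<open>cint u\<close> and
  \<open>\<nu>\<close>.\<close>

lemma \<theta>_children: "(\<Sum>y\<in>chl x. \<theta> u y) = \<theta> u x"
proof -
  have "g x * (\<Sum>y\<in>chl x. \<theta> u y) = (\<Sum>y\<in>chl x. cint u y - \<nu> y * h u x)"
    unfolding sum_distrib_left
  proof (intro sum.cong refl)
    fix y assume "y \<in> chl x"
    then show "g x * \<theta> u y = cint u y - \<nu> y * h u x"
      using \<theta>_par[of y] by (auto simp: children_iff)
  qed
  also have "\<dots> = g x * \<theta> u x"
    unfolding sum_subtractf cint_children sum_distrib_right[symmetric] \<nu>_children \<theta>_self ..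
  finally show ?thesis using g_pos[of x] by simp
qed

lemma S_Suc: "S u (Suc n) = S u n + (\<Sum>y\<in>level (Suc n). \<theta> u y * (h u y - h u (par y)))"
proof -
  have "(\<Sum>x\<in>level (Suc n). (h u x - h u (par x))\<^sup>2 * a x) = (\<Sum>y\<in>level (Suc n). \<theta> u y * (h u y - h u (par y)))"
    using level_Suc_ne_rt by (intro sum.cong refl) (simp add: \<theta>_def power2_eq_square)
  then show ?thesis by (simp add: S_def)
qed

text \<open>Discrete Green formula: conservation cancels all inner levels, leaving only the boundary
  term on level \<open>n\<close>.\<close>

lemma S_eq: "S u n = (\<Sum>x\<in>level n. \<theta> u x * h u x)"
proof (induction n)
  case 0 then show ?case by (simp add: S_def \<theta>_def)
next
  case (Suc n)
  have "(\<Sum>y\<in>level (Suc n). \<theta> u y * h u (par y)) = (\<Sum>x\<in>level n. \<theta> u x * h u x)"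
    unfolding sum_level_par[of "\<lambda>y x. \<theta> u y * h u x"] by (simp flip: sum_distrib_right add: \<theta>_children)
  then show ?case using Suc by (simp add: S_Suc right_diff_distrib sum_subtractf)
qed

text \<open>Subtracted from \<open>sum_c_additive\<close>, this gives the variance-type sums that
  make up the jump energy.\<close>

lemma sum_c_cint:
  "(\<Sum>k\<le>n. \<Sum>x\<in>level k. c x * (cint u x)\<^sup>2) = (\<Sum>x\<in>level n. \<nu> x * (h u x)\<^sup>2 / g x) + S u n"
proof (induction n)
  case 0 then show ?case by (simp add: c_def S_def poisson_rt)
next
  case (Suc n)
  have pt: "c y * (cint u y)\<^sup>2 = \<nu> y * (h u y)\<^sup>2 / g y - \<nu> y * (h u (par y))\<^sup>2 / g (par y)
      + \<theta> u y * (h u y - h u (par y))" if "y \<in> level (Suc n)" for y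
  proof -
    have y: "y \<noteq> rt" using that level_Suc_ne_rt by auto
    define n0 t g0 g1 h0 h1 where "n0 = \<nu> y" "t = \<theta> u y" "g0 = g (par y)" "g1 = g y" "h0 = h u (par y)" "h1 = h u y"
    note d = this
    \<comment> \<open>The same integral is written with the values at \<open>y\<close> and with
      those at the parent. Each form is squared over its own \<open>g\<close>, so that the first
      terms telescope between levels.\<close>
    have I1: "cint u y = n0 * h1 + g1 * t" and I0: "cint u y = n0 * h0 + g0 * t"
      using \<theta>_self[of y] \<theta>_par[OF y] by (simp_all add: d)
    have nz: "n0 > 0" "g0 > 0" "g1 > 0" using \<nu>_pos[of y] g_pos by (auto simp: d)
    have e: "(g0 - g1) * t = n0 * (h1 - h0)" using I0 I1 by (simp add: algebra_simps)
    have "(1 / g1 - 1 / g0) / n0 * (cint u y)\<^sup>2 = (cint u y)\<^sup>2 / (n0 * g1) - (cint u y)\<^sup>2 / (n0 * g0)"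
      using nz by (simp add: field_simps)
    also have "\<dots> = (n0 * h1 + g1 * t)\<^sup>2 / (n0 * g1) - (n0 * h0 + g0 * t)\<^sup>2 / (n0 * g0)"
      using I0 I1 by simp
    also have "(n0 * h1 + g1 * t)\<^sup>2 / (n0 * g1) = n0 * h1\<^sup>2 / g1 + 2 * h1 * t + g1 * t * t / n0"
      using nz by (simp add: field_simps power2_eq_square)
    also have "(n0 * h0 + g0 * t)\<^sup>2 / (n0 * g0) = n0 * h0\<^sup>2 / g0 + 2 * h0 * t + g0 * t * t / n0"
      using nz by (simp add: field_simps power2_eq_square)
    \<comment> \<open>Equating the two forms gives \<open>e\<close>, the statement that
      \<open>t\<close> is the flow of the gradient of \<open>h\<close>; it turns the difference of
      the quadratic terms into the energy of the edge.\<close>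
    also have "g1 * t * t / n0 = g0 * t * t / n0 - (h1 - h0) * t"
    proof -
      have "(g0 - g1) * t * t / n0 = (h1 - h0) * t" unfolding e using nz by simp
      then show ?thesis by (simp add: algebra_simps diff_divide_distrib)
    qed
    finally show ?thesis using y by (simp add: c_def d[symmetric] algebra_simps)
  qed
  have "(\<Sum>y\<in>level (Suc n). \<nu> y * (h u (par y))\<^sup>2 / g (par y)) = (\<Sum>x\<in>level n. \<nu> x * (h u x)\<^sup>2 / g x)"
    unfolding sum_level_par[of "\<lambda>y x. \<nu> y * (h u x)\<^sup>2 / g x"]
    by (simp flip: sum_distrib_right sum_divide_distrib add: \<nu>_children)
  moreover have "(\<Sum>y\<in>level (Suc n). c y * (cint u y)\<^sup>2) =
    (\<Sum>y\<in>level (Suc n). \<nu> y * (h u y)\<^sup>2 / g y) - (\<Sum>y\<in>level (Suc n). \<nu> y * (h u (par y))\<^sup>2 / g (par y))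
      + (\<Sum>y\<in>level (Suc n). \<theta> u y * (h u y - h u (par y)))"
    by (simp add: pt sum.distrib sum_subtractf)
  ultimately show ?case using Suc by (simp add: S_Suc)
qed

text \<open>Finite-level form of the identity: the jump energy of the conditional expectation of \<open>u\<close>
  on level \<open>n\<close> exceeds the tree energy up to level \<open>n\<close> by \<open>B u n\<close>.\<close>

lemma level_energy:
  assumes K: "\<And>x. depth x < n \<Longrightarrow> K x = (\<Sum>y\<in>chl x. K y)"
    and Kn: "\<And>x. depth x = n \<Longrightarrow> K x = (cint u x)\<^sup>2 / \<nu> x"
  shows "(\<Sum>k\<le>n. \<Sum>x\<in>level k. c x * (\<nu> x * K x - (cint u x)\<^sup>2)) = S u n + B u n"
proof -
  have "(\<Sum>k\<le>n. \<Sum>x\<in>level k. c x * (\<nu> x * K x - (cint u x)\<^sup>2))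
    = (\<Sum>x\<in>level n. K x / g x) - (\<Sum>x\<in>level n. \<nu> x * (h u x)\<^sup>2 / g x) - S u n"
    using sum_c_additive[of n K, OF K] sum_c_cint[of n]
    by (simp add: right_diff_distrib sum_subtractf)
  also have "(\<Sum>x\<in>level n. K x / g x) = (\<Sum>x\<in>level n. \<nu> x * (h u x)\<^sup>2 / g x) + 2 * S u n + B u n"
    unfolding S_eq B_def sum_distrib_left sum.distrib[symmetric]
  proof (intro sum.cong refl)
    fix x assume "x \<in> level n"
    then have K: "K x = (cint u x)\<^sup>2 / \<nu> x" using Kn by (simp add: level_def)
    have I: "cint u x = \<nu> x * h u x + g x * \<theta> u x" using \<theta>_self[of x] by simp
    show "K x / g x = \<nu> x * (h u x)\<^sup>2 / g x + 2 * (\<theta> u x * h u x) + g x * (\<theta> u x)\<^sup>2 / \<nu> x"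
      unfolding K I using \<nu>_pos[of x] g_pos[of x] by (simp add: field_simps power2_eq_square)
  qed
  finally show ?thesis by simp
qed

lemma B_nonneg: "0 \<le> B u n"
  unfolding B_def using \<nu>_pos g_pos by (intro sum_nonneg) (simp add: less_imp_le)

text \<open>Among all flows below level \<open>n\<close> with prescribed inflow, the one proportional to \<open>\<nu>\<close>
  has least energy, namely \<open>B u n\<close>. Truncating \<open>g\<close> at height \<open>\<epsilon>\<close> makes the test function in
  the summation by parts vanish on deep levels.\<close>

lemma B_le_tail:
  assumes bound: "\<And>N. S u N \<le> E"
  shows "B u n \<le> E - S u n"
proof -
  \<comment> \<open>Below level \<open>n\<close> the comparison flow is \<open>\<kappa>\<close>
    times \<open>\<nu>\<close>; \<open>\<kappa>\<close> is constant on each subtree and chosen so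
    that the inflow at level \<open>n\<close> is \<open>\<theta> u\<close>.\<close>
  define \<kappa> where "\<kappa> z = \<theta> u (anc_at n z) / \<nu> (anc_at n z)" for z
  define M where "M = (\<Sum>x\<in>level n. (\<theta> u x)\<^sup>2 / \<nu> x)"
  \<comment> \<open>\<open>D N\<close> is the energy of the comparison flow below level
    \<open>N\<close>: on an edge it is \<open>\<kappa>\<^sup>2 * \<nu> * (g (par w) - g w)\<close>,
    because \<open>\<nu>\<close> is the conductance times the drop of \<open>g\<close>, and these
    terms telescope.\<close>
  define D where "D N = (\<Sum>z\<in>level N. (\<kappa> z)\<^sup>2 * \<nu> z * g z)" for N
  have M: "0 \<le> M" unfolding M_def using \<nu>_pos by (intro sum_nonneg) (simp add: less_imp_le)
  have \<kappa>n: "\<kappa> z = \<theta> u z / \<nu> z" if "z \<in> level n" for z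
    using that anc_at_self[of z] by (simp add: \<kappa>_def level_def)
  have \<kappa>_par: "\<kappa> w = \<kappa> (par w)" if "w \<in> level (Suc N)" "n \<le> N" for w N
    using that anc_at_par[of n w] by (simp add: \<kappa>_def level_def)
  have Dn: "D n = B u n" unfolding D_def B_def
  proof (intro sum.cong refl)
    fix z assume "z \<in> level n"
    then show "(\<kappa> z)\<^sup>2 * \<nu> z * g z = g z * (\<theta> u z)\<^sup>2 / \<nu> z"
      using \<nu>_pos[of z] by (simp add: \<kappa>n power2_eq_square field_simps)
  qed
  have D0: "0 \<le> D N" for N unfolding D_def using \<nu>_pos g_pos by (intro sum_nonneg) (simp add: less_imp_le)
  have main: "B u n - \<epsilon> * M \<le> (E - S u n) / 2 + B u n / 2" if \<epsilon>: "0 < \<epsilon>" for \<epsilon>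
  proof -
    define q where "q z = max 0 (g z - \<epsilon>)" for z
    define A where "A N = (\<Sum>z\<in>level N. \<theta> u z * \<kappa> z * q z)" for N
    have stp: "A N - A (Suc N) \<le> (S u (Suc N) - S u N) / 2 + (D N - D (Suc N)) / 2" if N: "n \<le> N" for N
    proof -
      have "A N = (\<Sum>w\<in>level (Suc N). \<theta> u w * \<kappa> (par w) * q (par w))"
        unfolding A_def sum_level_par[of "\<lambda>w z. \<theta> u w * \<kappa> z * q z"]
        by (simp flip: sum_distrib_right add: \<theta>_children)
      then have 1: "A N - A (Suc N) = (\<Sum>w\<in>level (Suc N). \<theta> u w * \<kappa> w * (q (par w) - q w))"
        unfolding A_def by (simp add: sum_subtractf right_diff_distrib \<kappa>_par[OF _ N])
      have "D N = (\<Sum>w\<in>level (Suc N). (\<kappa> (par w))\<^sup>2 * \<nu> w * g (par w))"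
        unfolding D_def sum_level_par[of "\<lambda>w z. (\<kappa> z)\<^sup>2 * \<nu> w * g z"]
        by (simp flip: sum_distrib_right sum_distrib_left add: \<nu>_children)
      then have 2: "D N - D (Suc N) = (\<Sum>w\<in>level (Suc N). (\<kappa> w)\<^sup>2 * \<nu> w * (g (par w) - g w))"
        unfolding D_def by (simp add: sum_subtractf right_diff_distrib \<kappa>_par[OF _ N])
      have "A N - A (Suc N) \<le> (\<Sum>w\<in>level (Suc N). \<theta> u w * (h u w - h u (par w)) / 2
          + (\<kappa> w)\<^sup>2 * \<nu> w * (g (par w) - g w) / 2)"
        unfolding 1
      proof (rule sum_mono)
        fix w assume "w \<in> level (Suc N)"
        then have w: "w \<noteq> rt" using level_Suc_ne_rt by auto
        define \<delta> d where "\<delta> = h u w - h u (par w)" and "d = g (par w) - g w"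
        define dq where "dq = q (par w) - q w"
        have a: "0 < a w" by (rule a_pos[OF w])
        have "\<bar>dq\<bar> \<le> d" using g_decreasing[OF w] by (auto simp: dq_def d_def q_def)
        then have "dq\<^sup>2 \<le> d\<^sup>2" by (rule abs_le_square_iff[THEN iffD1, OF order_trans]) simp
        then have "(\<kappa> w)\<^sup>2 * (a w * dq\<^sup>2) \<le> (\<kappa> w)\<^sup>2 * (a w * d\<^sup>2)" using a by (intro mult_left_mono) auto
        \<comment> \<open>Young's inequality. With \<open>\<theta> = \<delta> a\<close> and
          \<open>\<nu> = a d\<close>, the two squares are the edge energies of \<open>h\<close> and
          of the comparison flow; the halves later let \<open>B u n / 2\<close> be absorbed on the
          left.\<close>
        moreover have "0 \<le> a w * (\<delta> - \<kappa> w * dq)\<^sup>2" using a by simp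
        ultimately have "2 * (\<delta> * a w * \<kappa> w * dq) \<le> \<delta> * a w * \<delta> + (\<kappa> w)\<^sup>2 * (a w * d) * d"
          by (simp add: power2_eq_square algebra_simps)
        then show "\<theta> u w * \<kappa> w * (q (par w) - q w) \<le> \<theta> u w * (h u w - h u (par w)) / 2
            + (\<kappa> w)\<^sup>2 * \<nu> w * (g (par w) - g w) / 2"
          using w by (simp add: \<theta>_def \<nu>_eq[OF w] \<delta>_def[symmetric] d_def[symmetric] dq_def[symmetric])
      qed
      also have "\<dots> = (S u (Suc N) - S u N) / 2 + (D N - D (Suc N)) / 2"
        unfolding 2 S_Suc by (simp add: sum.distrib sum_divide_distrib)
      finally show ?thesis .
    qed
    have tele: "A n - A N \<le> (S u N - S u n) / 2 + (D n - D N) / 2" if "n \<le> N" for N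
      using that
    proof (induction N rule: dec_induct)
      case (step N)
      then show ?case using stp[of N] by (simp add: field_simps)
    qed simp
    obtain N0 where N0: "\<And>x. N0 \<le> depth x \<Longrightarrow> g x < \<epsilon>" using g_vanish_depth[OF \<epsilon>] by blast
    define N where "N = max n N0"
    have "q z = 0" if "z \<in> level N" for z using N0[of z] that by (simp add: q_def N_def level_def)
    then have "A N = 0" unfolding A_def by simp
    then have "A n \<le> (E - S u n) / 2 + B u n / 2"
      using tele[of N] bound[of N] D0[of N] Dn by (simp add: N_def field_simps)
    moreover have "B u n - \<epsilon> * M \<le> A n"
      unfolding B_def M_def A_def sum_distrib_left sum_subtractf[symmetric]
    proof (rule sum_mono)
      fix z assume z: "z \<in> level n"
      have "g z - \<epsilon> \<le> q z" by (simp add: q_def)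
      then have "(\<theta> u z)\<^sup>2 / \<nu> z * (g z - \<epsilon>) \<le> (\<theta> u z)\<^sup>2 / \<nu> z * q z"
        using \<nu>_pos[of z] by (intro mult_left_mono) auto
      then show "g z * (\<theta> u z)\<^sup>2 / \<nu> z - \<epsilon> * ((\<theta> u z)\<^sup>2 / \<nu> z) \<le> \<theta> u z * \<kappa> z * q z"
        by (simp add: \<kappa>n[OF z] power2_eq_square right_diff_distrib diff_divide_distrib mult_ac)
    qed
    ultimately show ?thesis by linarith
  qed
  have "B u n \<le> (E - S u n) / 2 + B u n / 2"
  proof (rule field_le_epsilon)
    fix e :: real assume e: "0 < e"
    have "e / (M + 1) * M \<le> e" using M e by (simp add: field_simps)
    moreover have "0 < e / (M + 1)" using M e by simp
    ultimately show "B u n \<le> (E - S u n) / 2 + B u n / 2 + e"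
      using main[of "e / (M + 1)"] by linarith
  qed
  then show ?thesis by (simp add: field_simps)
qed

end

end

section \<open>The jump kernel\<close>

context branching_tree
begin

lemma ray_agree_iff:
  assumes "\<xi> \<in> ends" "\<eta> \<in> ends"
  shows "\<xi> k = \<eta> k \<longleftrightarrow> (\<forall>i\<le>k. \<xi> i = \<eta> i)"
proof (induction k)
  case 0 then show ?case by simp
next
  case (Suc k)
  have "\<xi> k = \<eta> k" if "\<xi> (Suc k) = \<eta> (Suc k)"
    using that ray_par[OF assms(1), of k] ray_par[OF assms(2), of k] by simp
  then show ?case using Suc by (auto simp: le_Suc_eq)
qed

text \<open>Distinct rays agree exactly up to some level, so the \<open>GREATEST\<close> in
  \<open>meet\<close> ranges over a nonempty bounded set. The second conclusion lets agreement be
  tested at one level.\<close>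

lemma meet_ray:
  assumes "\<xi> \<in> ends" "\<eta> \<in> ends" "\<xi> \<noteq> \<eta>"
  obtains N where "meet \<xi> \<eta> = \<xi> N" "\<And>k. \<xi> k = \<eta> k \<longleftrightarrow> k \<le> N"
proof -
  note agree = ray_agree_iff[OF assms(1,2)]
  obtain b where b: "\<xi> b \<noteq> \<eta> b" using assms(3) by blast
  let ?P = "\<lambda>k. \<forall>i\<le>k. \<xi> i = \<eta> i"
  define N where "N = (GREATEST k. ?P k)"
  have bd: "k \<le> b" if "?P k" for k
    using that b by (meson nle_le)
  have P0: "?P 0" using assms by simp
  have PN: "?P N" unfolding N_def by (rule GreatestI_nat[of ?P, OF P0 bd])
  have "\<xi> k = \<eta> k \<longleftrightarrow> k \<le> N" for k
  proof
    assume "\<xi> k = \<eta> k"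
    then have "?P k" by (rule agree[THEN iffD1])
    then show "k \<le> N" unfolding N_def by (rule Greatest_le_nat) (rule bd)
  next
    assume "k \<le> N"
    then show "\<xi> k = \<eta> k" using PN by blast
  qed
  moreover have "meet \<xi> \<eta> = \<xi> N" unfolding meet_def N_def ..
  ultimately show ?thesis using that by blast
qed

text \<open>A geodesic ray may start anywhere and first climb towards the root. It can climb only
  finitely often, and after one downward step the absence of backtracking forbids turning up
  again.\<close>

lemma geodesic_ray_depth:
  assumes "geodesic_ray par rt \<xi>"
  shows "\<exists>k. \<forall>n. depth (\<xi> (k + n)) = depth (\<xi> k) + n"
proof -
  have adj: "adj par rt (\<xi> n) (\<xi> (Suc n))" and nb: "\<xi> (Suc (Suc n)) \<noteq> \<xi> n" for n
    using assms by (auto simp: geodesic_ray_def)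
  let ?D = "\<lambda>n. \<xi> (Suc n) \<noteq> rt \<and> \<xi> n = par (\<xi> (Suc n))"
  have persist: "?D (Suc n)" if "?D n" for n
    using adj[of "Suc n"] nb[of n] that by (auto simp: adj_def)
  have up: "\<xi> n \<noteq> rt \<and> \<xi> (Suc n) = par (\<xi> n)" if "\<not> ?D n" for n
    using adj[of n] that by (auto simp: adj_def)
  have "\<exists>k. ?D k"
  proof (rule ccontr)
    assume "\<nexists>k. ?D k"
    then have *: "\<xi> n \<noteq> rt \<and> \<xi> (Suc n) = par (\<xi> n)" for n using up by blast
    have "depth (\<xi> n) + n = depth (\<xi> 0)" for n
    proof (induction n)
      case (Suc n)
      then show ?case using *[of n] depth_par[of "\<xi> n"] by simp
    qed simp
    from this[of "Suc (depth (\<xi> 0))"] show False by simp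
  qed
  then obtain k where k: "?D k" by blast
  have D: "?D (k + n)" for n
    by (induction n) (use k persist in auto)
  have "depth (\<xi> (k + n)) = depth (\<xi> k) + n" for n
  proof (induction n)
    case (Suc n)
    then show ?case using D[of n] depth_par[of "\<xi> (Suc (k + n))"] by simp
  qed simp
  then show ?thesis by blast
qed

end

context vanishing_green_walk
begin

lemma ultrametric_g: "ultrametric_element par rt g"
  unfolding ultrametric_element_def
proof (intro conjI allI impI)
  fix \<xi> assume "geodesic_ray par rt \<xi>"
  then obtain k where k: "\<And>n. depth (\<xi> (k + n)) = depth (\<xi> k) + n"
    using geodesic_ray_depth by blast
  show "(\<lambda>n. g (\<xi> n)) \<longlonglongrightarrow> 0"
  proof (rule LIMSEQ_I)
    fix \<epsilon> :: real assume "0 < \<epsilon>"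
    then obtain N where N: "\<And>x. N \<le> depth x \<Longrightarrow> g x < \<epsilon>" using g_vanish_depth by blast
    have "norm (g (\<xi> n) - 0) < \<epsilon>" if "k + N \<le> n" for n
      using that k[of "n - k"] N[of "\<xi> n"] by simp
    then show "\<exists>n0. \<forall>n\<ge>n0. norm (g (\<xi> n) - 0) < \<epsilon>" by blast
  qed
qed (auto simp: g_pos g_decreasing)

abbreviation "J \<equiv> jump_kernel par rt g (hit rt)"

lemma g_ray_antimono:
  assumes \<xi>: "\<xi> \<in> ends"
  shows "g (\<xi> i) \<le> g (\<xi> j) \<longleftrightarrow> j \<le> i"
proof -
  have "strict_mono (\<lambda>n. - g (\<xi> n))"
    unfolding strict_mono_Suc_iff
    using g_decreasing[OF ray_ne_rt[OF \<xi>]] ray_par[OF \<xi>] by simp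
  from strict_mono_less_eq[OF this, of j i] show ?thesis by simp
qed

text \<open>Ends that leave the ray at \<open>\<xi> k\<close> are at distance
  \<open>g (\<xi> k)\<close>, which exceeds \<open>r\<close>; the ball therefore consists of the
  ends that still agree at \<open>Suc k\<close>.\<close>

lemma uball_eq_cyl:
  assumes \<xi>: "\<xi> \<in> ends" and r: "g (\<xi> (Suc k)) \<le> r" "r < g (\<xi> k)"
  shows "uball par rt g \<xi> r = cyl (\<xi> (Suc k))"
proof -
  have "\<eta> = \<xi> \<or> g (meet \<xi> \<eta>) \<le> r \<longleftrightarrow> \<eta> (Suc k) = \<xi> (Suc k)" if \<eta>: "\<eta> \<in> ends" for \<eta>
  proof (cases "\<eta> = \<xi>")
    case False
    obtain N where N: "meet \<xi> \<eta> = \<xi> N" "\<And>i. \<xi> i = \<eta> i \<longleftrightarrow> i \<le> N"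
      using meet_ray[OF \<xi> \<eta>] False by metis
    have "g (\<xi> N) \<le> r \<longleftrightarrow> Suc k \<le> N"
      using r g_ray_antimono[OF \<xi>, of N "Suc k"] g_ray_antimono[OF \<xi>, of k N] by linarith
    then show ?thesis using N False by metis
  qed simp
  then show ?thesis
    by (intro set_eqI) (simp add: uball_def in_cyl_iff ray_depth[OF \<xi>] cong: conj_cong)
qed

lemma jump_kernel_eq:
  assumes \<xi>: "\<xi> \<in> ends" and \<eta>: "\<eta> \<in> ends" "\<xi> \<noteq> \<eta>" and N: "meet \<xi> \<eta> = \<xi> N"
  shows "J \<xi> \<eta> = (\<Sum>k\<le>N. c (\<xi> k))"
proof -
  let ?f = "\<lambda>t. 1 / measure (hit rt) (uball par rt g \<xi> (1 / t))"
  have "(?f has_integral (\<Sum>k\<le>M. c (\<xi> k)) - 1 / g rt) {1 / g rt .. 1 / g (\<xi> M)}" for M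
  proof (induction M)
    case 0 then show ?case using \<xi> by (simp add: c_def has_integral_refl)
  next
    case (Suc M)
    let ?a = "1 / g (\<xi> M)" and ?b = "1 / g (\<xi> (Suc M))"
    have le: "?a \<le> ?b"
      using g_ray_antimono[OF \<xi>, of "Suc M" M] g_pos by (intro divide_left_mono) auto
    have le0: "1 / g rt \<le> ?a"
      using g_ray_antimono[OF \<xi>, of M 0] g_pos \<xi> by (intro divide_left_mono) auto
    have "(?f has_integral (?b - ?a) *\<^sub>R (1 / \<nu> (\<xi> (Suc M)))) (cbox ?a ?b)"
    \<comment> \<open>At the left endpoint the radius equals \<open>g (\<xi> M)\<close> and the
      closed ball is larger, so the integrand is constant only in the interior; endpoints do not
      affect the integral.\<close>
    proof (rule has_integral_spike_interior)
      show "((\<lambda>t. 1 / \<nu> (\<xi> (Suc M))) has_integral (?b - ?a) *\<^sub>R (1 / \<nu> (\<xi> (Suc M)))) (cbox ?a ?b)"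
        using has_integral_const_real[of "1 / \<nu> (\<xi> (Suc M))" ?a ?b] le by simp
      fix t assume t: "t \<in> box ?a ?b"
      then have t': "?a < t" "t < ?b" by auto
      have pos: "0 < g (\<xi> M)" "0 < g (\<xi> (Suc M))" by (rule g_pos)+
      have "0 < t" using t'(1) pos(1) by (meson less_trans zero_less_divide_1_iff)
      then have "g (\<xi> (Suc M)) \<le> 1 / t" "1 / t < g (\<xi> M)"
        using t' pos by (auto simp: field_simps)
      then show "?f t = 1 / \<nu> (\<xi> (Suc M))" by (simp add: uball_eq_cyl[OF \<xi>])
    qed
    then have "(?f has_integral (?b - ?a) * (1 / \<nu> (\<xi> (Suc M)))) {?a..?b}" by simp
    from has_integral_combine[OF le0 le Suc this] show ?case
      using ray_ne_rt[OF \<xi>, of M] ray_par[OF \<xi>, of M] by (simp add: c_def algebra_simps diff_divide_distrib)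
  qed
  from integral_unique[OF this[of N]] show ?thesis
    using \<eta>(2) by (simp add: jump_kernel_def N)
qed

text \<open>Values in \<open>ennreal\<close> allow sum and integral to be exchanged before
  integrability is known. On the diagonal \<open>J\<close> is 0 by convention while the sum of the
  weights is positive, which is why \<open>d\<close> must vanish there.\<close>

lemma ennreal_jump_sum:
  assumes \<xi>: "\<xi> \<in> ends" and \<eta>: "\<eta> \<in> ends" and d: "\<xi> = \<eta> \<Longrightarrow> d = 0" "0 \<le> d"
  shows "ennreal (d * J \<xi> \<eta>)
    = (\<Sum>n. \<Sum>x\<in>level n. ennreal (c x) * (indicator (cyl x) \<xi> * (indicator (cyl x) \<eta> * ennreal d)))"
proof (cases "\<xi> = \<eta>")
  case False
  obtain N where N: "meet \<xi> \<eta> = \<xi> N" "\<And>k. \<xi> k = \<eta> k \<longleftrightarrow> k \<le> N"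
    using meet_ray[OF \<xi> \<eta> False] by metis
  have lev: "(\<Sum>x\<in>level n. ennreal (c x) * (indicator (cyl x) \<xi> * (indicator (cyl x) \<eta> * ennreal d)))
     = (if n \<le> N then ennreal (c (\<xi> n) * d) else 0)" for n
  proof -
    have "(\<Sum>x\<in>level n. ennreal (c x) * (indicator (cyl x) \<xi> * (indicator (cyl x) \<eta> * ennreal d)))
      = (\<Sum>x\<in>level n. if x = \<xi> n then (if \<xi> n = \<eta> n then ennreal (c (\<xi> n) * d) else 0) else 0)"
      using \<xi> \<eta> by (intro sum.cong refl) (auto simp: in_cyl_iff level_def indicator_def ennreal_mult c_nonneg d)
    also have "\<dots> = (if \<xi> n = \<eta> n then ennreal (c (\<xi> n) * d) else 0)"
      by (subst sum.delta[OF finite_level]) (auto simp: level_def ray_depth[OF \<xi>])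
    finally show ?thesis using N(2) by simp
  qed
  have "(\<Sum>n. if n \<le> N then ennreal (c (\<xi> n) * d) else 0) = (\<Sum>n\<le>N. ennreal (c (\<xi> n) * d))"
    by (subst suminf_finite[of "{..N}"]) auto
  also have "\<dots> = ennreal (d * J \<xi> \<eta>)"
    using d c_nonneg by (simp add: jump_kernel_eq[OF \<xi> \<eta> False N(1)] sum_distrib_left mult.commute)
  finally show ?thesis by (simp add: lev)
qed (use d in simp)

lemma J_nonneg:
  assumes e: "\<xi> \<in> ends" "\<eta> \<in> ends"
  shows "0 \<le> J \<xi> \<eta>"
proof (cases "\<xi> = \<eta>")
  case False
  obtain N where "meet \<xi> \<eta> = \<xi> N" using meet_ray[OF e False] by metis
  then show ?thesis using jump_kernel_eq[OF e False] c_nonneg by (simp add: sum_nonneg)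
qed (simp add: jump_kernel_def)

text \<open>The kernel is given by a \<open>GREATEST\<close> and an integral; measurability is read
  off from the series over cylinders.\<close>

lemma jump_integrand_measurable:
  assumes [measurable]: "u \<in> borel_measurable bd"
  shows "(\<lambda>z. (u (fst z) - u (snd z))\<^sup>2 * J (fst z) (snd z)) \<in> borel_measurable (bd \<Otimes>\<^sub>M bd)"
proof -
  have "(\<lambda>z. enn2real (\<Sum>n. \<Sum>x\<in>level n. ennreal (c x) * (indicator (cyl x) (fst z) * (indicator (cyl x) (snd z)
      * ennreal ((u (fst z) - u (snd z))\<^sup>2))))) \<in> borel_measurable (bd \<Otimes>\<^sub>M bd)"
    by measurable
  also have "?this \<longleftrightarrow> ?thesis"
  proof (rule measurable_cong)
    fix z assume "z \<in> space (bd \<Otimes>\<^sub>M bd)"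
    then have z: "fst z \<in> ends" "snd z \<in> ends" by (auto simp: space_pair_measure)
    show "enn2real (\<Sum>n. \<Sum>x\<in>level n. ennreal (c x) * (indicator (cyl x) (fst z) * (indicator (cyl x) (snd z)
      * ennreal ((u (fst z) - u (snd z))\<^sup>2)))) = (u (fst z) - u (snd z))\<^sup>2 * J (fst z) (snd z)"
      by (subst ennreal_jump_sum[OF z, symmetric]) (auto simp: J_nonneg[OF z])
  qed
  finally show ?thesis .
qed

sublocale pair: pair_prob_space "hit rt" "hit rt"
  by unfold_locales

lemma sets_pair_hit [measurable_cong]: "sets (hit rt \<Otimes>\<^sub>M hit rt) = sets (bd \<Otimes>\<^sub>M bd)"
  by (rule sets_pair_measure_cong) simp_all

lemma integrable_hit_measurable: "integrable (hit rt) (u :: _ \<Rightarrow> real) \<Longrightarrow> u \<in> borel_measurable bd"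
  using borel_measurable_integrable[of "hit rt" u] by (simp cong: measurable_cong_sets)

text \<open>For fixed \<open>\<xi>\<close> the inner integral is a quadratic polynomial in
  \<open>t = u \<xi>\<close>; integrating it once more gives twice the unnormalized variance on the
  cylinder.\<close>

lemma cylinder_variance:
  fixes u :: "_ \<Rightarrow> real"
  assumes u: "integrable (hit rt) u" and u2: "integrable (hit rt) (\<lambda>\<xi>. (u \<xi>)\<^sup>2)"
  shows "(\<integral>\<^sup>+\<xi>. \<integral>\<^sup>+\<eta>. indicator (cyl x) \<xi> * (indicator (cyl x) \<eta> * ennreal ((u \<xi> - u \<eta>)\<^sup>2)) \<partial>hit rt \<partial>hit rt)
    = ennreal (2 * (\<nu> x * cint (\<lambda>\<xi>. (u \<xi>)\<^sup>2) x - (cint u x)\<^sup>2))"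
proof -
  note [measurable] = integrable_hit_measurable[OF u]
  let ?i = "\<lambda>\<xi>. indicator (cyl x) \<xi> :: real"
  define K where "K = cint (\<lambda>\<xi>. (u \<xi>)\<^sup>2) x"
  define I where "I = cint u x"
  have i1: "integrable (hit rt) (\<lambda>\<xi>. ?i \<xi> * u \<xi>)" "integrable (hit rt) (\<lambda>\<xi>. ?i \<xi> * (u \<xi>)\<^sup>2)"
    "integrable (hit rt) ?i"
    using u u2 by (auto simp: less_top[symmetric] intro!: integrable_real_indicator)
  have inner: "(\<integral>\<^sup>+\<eta>. indicator (cyl x) \<eta> * ennreal ((t - u \<eta>)\<^sup>2) \<partial>hit rt) = ennreal (\<nu> x * t\<^sup>2 - 2 * t * I + K)"
    and inner0: "0 \<le> \<nu> x * t\<^sup>2 - 2 * t * I + K" for t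
  proof -
    have eq: "?i \<eta> * (t - u \<eta>)\<^sup>2 = t\<^sup>2 * ?i \<eta> - 2 * t * (?i \<eta> * u \<eta>) + ?i \<eta> * (u \<eta>)\<^sup>2" for \<eta>
      by (simp add: power2_eq_square algebra_simps)
    have int: "integrable (hit rt) (\<lambda>\<eta>. ?i \<eta> * (t - u \<eta>)\<^sup>2)"
      unfolding eq using i1 by auto
    have val: "(\<integral>\<eta>. ?i \<eta> * (t - u \<eta>)\<^sup>2 \<partial>hit rt) = \<nu> x * t\<^sup>2 - 2 * t * I + K"
      unfolding eq using i1 by (simp add: I_def K_def cint_def Int_absorb2[OF cyl_subset_ends])
    have "(\<integral>\<^sup>+\<eta>. indicator (cyl x) \<eta> * ennreal ((t - u \<eta>)\<^sup>2) \<partial>hit rt) = (\<integral>\<^sup>+\<eta>. ennreal (?i \<eta> * (t - u \<eta>)\<^sup>2) \<partial>hit rt)"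
      by (intro nn_integral_cong) (auto simp: indicator_def)
    also have "\<dots> = ennreal (\<nu> x * t\<^sup>2 - 2 * t * I + K)"
      using int by (subst nn_integral_eq_integral) (auto simp: val)
    finally show "(\<integral>\<^sup>+\<eta>. indicator (cyl x) \<eta> * ennreal ((t - u \<eta>)\<^sup>2) \<partial>hit rt) = ennreal (\<nu> x * t\<^sup>2 - 2 * t * I + K)" .
    show "0 \<le> \<nu> x * t\<^sup>2 - 2 * t * I + K"
      unfolding val[symmetric] by (intro integral_nonneg_AE) auto
  qed
  have eq: "?i \<xi> * (\<nu> x * (u \<xi>)\<^sup>2 - 2 * u \<xi> * I + K) = \<nu> x * (?i \<xi> * (u \<xi>)\<^sup>2) - (2 * I) * (?i \<xi> * u \<xi>) + K * ?i \<xi>" for \<xi>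
    by (simp add: algebra_simps)
  have int: "integrable (hit rt) (\<lambda>\<xi>. ?i \<xi> * (\<nu> x * (u \<xi>)\<^sup>2 - 2 * u \<xi> * I + K))"
    unfolding eq using i1 by auto
  have val: "(\<integral>\<xi>. ?i \<xi> * (\<nu> x * (u \<xi>)\<^sup>2 - 2 * u \<xi> * I + K) \<partial>hit rt) = 2 * (\<nu> x * K - I\<^sup>2)"
    unfolding eq using i1 by (simp add: I_def K_def cint_def power2_eq_square Int_absorb2[OF cyl_subset_ends])
  have "(\<integral>\<^sup>+\<xi>. \<integral>\<^sup>+\<eta>. indicator (cyl x) \<xi> * (indicator (cyl x) \<eta> * ennreal ((u \<xi> - u \<eta>)\<^sup>2)) \<partial>hit rt \<partial>hit rt)
    = (\<integral>\<^sup>+\<xi>. ennreal (?i \<xi> * (\<nu> x * (u \<xi>)\<^sup>2 - 2 * u \<xi> * I + K)) \<partial>hit rt)"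
  proof (intro nn_integral_cong)
    fix \<xi>
    show "(\<integral>\<^sup>+\<eta>. indicator (cyl x) \<xi> * (indicator (cyl x) \<eta> * ennreal ((u \<xi> - u \<eta>)\<^sup>2)) \<partial>hit rt)
      = ennreal (?i \<xi> * (\<nu> x * (u \<xi>)\<^sup>2 - 2 * u \<xi> * I + K))"
      by (cases "\<xi> \<in> cyl x") (simp_all add: inner)
  qed
  also have "\<dots> = ennreal (2 * (\<nu> x * K - I\<^sup>2))"
    using int inner0 by (subst nn_integral_eq_integral) (auto simp: val)
  finally show ?thesis by (simp add: K_def I_def)
qed

lemma jump_energy:
  fixes u :: "_ \<Rightarrow> real"
  assumes u: "integrable (hit rt) u" and u2: "integrable (hit rt) (\<lambda>\<xi>. (u \<xi>)\<^sup>2)"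
  shows "(\<integral>\<^sup>+z. ennreal ((u (fst z) - u (snd z))\<^sup>2 * J (fst z) (snd z)) \<partial>(hit rt \<Otimes>\<^sub>M hit rt))
    = (\<Sum>n. \<Sum>x\<in>level n. ennreal (c x) * ennreal (2 * (\<nu> x * cint (\<lambda>\<xi>. (u \<xi>)\<^sup>2) x - (cint u x)\<^sup>2)))"
proof -
  note [measurable] = integrable_hit_measurable[OF u]
  let ?t = "\<lambda>x z. indicator (cyl x) (fst z) * (indicator (cyl x) (snd z) * ennreal ((u (fst z) - u (snd z))\<^sup>2))"
  have m [measurable]: "?t x \<in> borel_measurable (hit rt \<Otimes>\<^sub>M hit rt)" for x
    by measurable
  have val: "(\<integral>\<^sup>+z. ?t x z \<partial>(hit rt \<Otimes>\<^sub>M hit rt)) = ennreal (2 * (\<nu> x * cint (\<lambda>\<xi>. (u \<xi>)\<^sup>2) x - (cint u x)\<^sup>2))" for x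
    unfolding cylinder_variance[OF u u2, symmetric]
    by (subst hit.nn_integral_fst[symmetric, OF m]) simp
  have "(\<integral>\<^sup>+z. ennreal ((u (fst z) - u (snd z))\<^sup>2 * J (fst z) (snd z)) \<partial>(hit rt \<Otimes>\<^sub>M hit rt))
    = (\<integral>\<^sup>+z. (\<Sum>n. \<Sum>x\<in>level n. ennreal (c x) * ?t x z) \<partial>(hit rt \<Otimes>\<^sub>M hit rt))"
    by (intro nn_integral_cong ennreal_jump_sum) (auto simp: space_pair_measure)
  also have "\<dots> = (\<Sum>n. \<Sum>x\<in>level n. ennreal (c x) * (\<integral>\<^sup>+z. ?t x z \<partial>(hit rt \<Otimes>\<^sub>M hit rt)))"
    by (simp add: nn_integral_suminf nn_integral_sum nn_integral_cmult)
  finally show ?thesis by (simp only: val)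
qed

end

section \<open>Conditional expectations on levels\<close>

context vanishing_green_walk
begin

text \<open>Conditional expectation given the vertex at level \<open>n\<close>, written explicitly.
  It has finitely many values on the ends, so it is square integrable even when \<open>u\<close> is
  merely integrable.\<close>

definition cexp :: "nat \<Rightarrow> ((nat \<Rightarrow> 'a) \<Rightarrow> real) \<Rightarrow> (nat \<Rightarrow> 'a) \<Rightarrow> real" where
  "cexp n u \<xi> = cint u (\<xi> n) / \<nu> (\<xi> n)"

definition L1 :: "((nat \<Rightarrow> 'a) \<Rightarrow> real) \<Rightarrow> real" where
  "L1 u = (\<integral>\<xi>. \<bar>u \<xi>\<bar> \<partial>hit rt)"

lemma level_fun_eq:
  fixes f :: "'a \<Rightarrow> real"
  assumes "\<xi> \<in> ends"
  shows "f (\<xi> n) = (\<Sum>x\<in>level n. f x * indicator (cyl x) \<xi>)"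
proof -
  have "(\<Sum>x\<in>level n. f x * indicator (cyl x) \<xi>) = (\<Sum>x\<in>level n. if x = \<xi> n then f (\<xi> n) else 0)"
    using assms by (intro sum.cong refl) (auto simp: in_cyl_iff level_def indicator_def)
  also have "\<dots> = f (\<xi> n)"
    by (subst sum.delta[OF finite_level]) (auto simp: level_def ray_depth[OF assms])
  finally show ?thesis ..
qed

lemma integrable_cyl [simp]: "integrable (hit rt) (indicator (cyl x) :: _ \<Rightarrow> real)"
  by (auto simp: less_top[symmetric] intro!: integrable_real_indicator)

lemma integrable_level_fun: "integrable (hit rt) (\<lambda>\<xi>. (f :: 'a \<Rightarrow> real) (\<xi> n))"
proof -
  have "integrable (hit rt) (\<lambda>\<xi>. \<Sum>x\<in>level n. f x * indicator (cyl x) \<xi>)"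
    by (intro Bochner_Integration.integrable_sum integrable_mult_right integrable_cyl)
  also have "?this \<longleftrightarrow> ?thesis"
    by (intro Bochner_Integration.integrable_cong) (auto simp: level_fun_eq[of _ f])
  finally show ?thesis .
qed

lemma integral_level_fun: "(\<integral>\<xi>. (f :: 'a \<Rightarrow> real) (\<xi> n) \<partial>hit rt) = (\<Sum>x\<in>level n. f x * \<nu> x)"
proof -
  have "(\<integral>\<xi>. f (\<xi> n) \<partial>hit rt) = (\<integral>\<xi>. (\<Sum>x\<in>level n. f x * indicator (cyl x) \<xi>) \<partial>hit rt)"
    by (intro Bochner_Integration.integral_cong) (auto simp: level_fun_eq[of _ f])
  also have "\<dots> = (\<Sum>x\<in>level n. f x * \<nu> x)"
    by (subst Bochner_Integration.integral_sum) (auto simp: Int_absorb2[OF cyl_subset_ends])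
  finally show ?thesis .
qed

lemma cint_level_fun: 
  fixes f :: "'a \<Rightarrow> real"
  assumes "depth x = n" shows "cint (\<lambda>\<xi>. f (\<xi> n)) x = f x * \<nu> x"
proof -
  have "cint (\<lambda>\<xi>. f (\<xi> n)) x = (\<integral>\<xi>. f x * indicator (cyl x) \<xi> \<partial>hit rt)"
    unfolding cint_def using assms
    by (intro Bochner_Integration.integral_cong) (auto simp: indicator_def in_cyl_iff)
  then show ?thesis by (simp add: Int_absorb2[OF cyl_subset_ends])
qed

lemma integrable_cexp [simp]: "integrable (hit rt) (cexp n u)"
  unfolding cexp_def[abs_def] by (rule integrable_level_fun[of "\<lambda>x. cint u x / \<nu> x"])

lemma integrable_cexp_sq [simp]: "integrable (hit rt) (\<lambda>\<xi>. (cexp n u \<xi>)\<^sup>2)"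
  unfolding cexp_def by (rule integrable_level_fun[of "\<lambda>x. (cint u x / \<nu> x)\<^sup>2"])

lemma cint_sum_level:
  assumes "integrable (hit rt) u"
  shows "(\<Sum>x\<in>level n. cint u x) = (\<integral>\<xi>. u \<xi> \<partial>hit rt)"
proof (induction n)
  case 0
  show ?case by (auto simp: cint_def intro!: Bochner_Integration.integral_cong)
next
  case (Suc n)
  then show ?case by (simp add: sum_level_Suc cint_children[OF assms])
qed

lemma cint_abs: "integrable (hit rt) u \<Longrightarrow> \<bar>cint u x\<bar> \<le> cint (\<lambda>\<xi>. \<bar>u \<xi>\<bar>) x"
  unfolding cint_def
  by (rule order_trans[OF integral_abs_bound]) (simp add: abs_mult)

text \<open>Contractivity in \<open>n\<close> uniformly is what makes convergence of conditional
  expectations stable under limits of \<open>u\<close>.\<close>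

lemma L1_cexp_le: 
  assumes u: "integrable (hit rt) u"
  shows "L1 (cexp n u) \<le> L1 u"
proof -
  have "L1 (cexp n u) = (\<Sum>x\<in>level n. \<bar>cint u x / \<nu> x\<bar> * \<nu> x)"
    unfolding L1_def cexp_def by (rule integral_level_fun[of "\<lambda>x. \<bar>cint u x / \<nu> x\<bar>"])
  also have "\<dots> = (\<Sum>x\<in>level n. \<bar>cint u x\<bar>)"
    using \<nu>_pos by (intro sum.cong refl) (simp add: abs_div less_imp_neq[symmetric])
  also have "\<dots> \<le> (\<Sum>x\<in>level n. cint (\<lambda>\<xi>. \<bar>u \<xi>\<bar>) x)"
    by (intro sum_mono cint_abs u)
  also have "\<dots> = L1 u" unfolding L1_def using u by (intro cint_sum_level) simp
  finally show ?thesis .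
qed

lemma L1_triangle:
  assumes "integrable (hit rt) u" "integrable (hit rt) v"
  shows "L1 (\<lambda>\<xi>. u \<xi> + v \<xi>) \<le> L1 u + L1 v"
proof -
  have "L1 (\<lambda>\<xi>. u \<xi> + v \<xi>) \<le> (\<integral>\<xi>. \<bar>u \<xi>\<bar> + \<bar>v \<xi>\<bar> \<partial>hit rt)"
    unfolding L1_def using assms by (intro integral_mono) auto
  then show ?thesis using assms by (simp add: L1_def)
qed

lemma cint_add: "integrable (hit rt) u \<Longrightarrow> integrable (hit rt) v \<Longrightarrow> cint (\<lambda>\<xi>. u \<xi> + v \<xi>) x = cint u x + cint v x"
  unfolding cint_def by (subst Bochner_Integration.integral_add[symmetric]) (auto simp: distrib_left)

lemma cint_diff: "integrable (hit rt) u \<Longrightarrow> integrable (hit rt) v \<Longrightarrow> cint (\<lambda>\<xi>. u \<xi> - v \<xi>) x = cint u x - cint v x"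
  unfolding cint_def by (subst Bochner_Integration.integral_diff[symmetric]) (auto simp: right_diff_distrib)

lemma cint_cmult: "cint (\<lambda>\<xi>. u \<xi> * r) x = cint u x * r"
  unfolding cint_def by (simp add: mult.assoc[symmetric])

definition cexp_tends :: "((nat \<Rightarrow> 'a) \<Rightarrow> real) \<Rightarrow> bool" where
  "cexp_tends u \<longleftrightarrow> (\<lambda>n. L1 (\<lambda>\<xi>. cexp n u \<xi> - u \<xi>)) \<longlonglongrightarrow> 0"

lemma L1_nonneg: "0 \<le> L1 u"
  unfolding L1_def by (rule integral_nonneg_AE) auto

lemma cexp_tends_add:
  assumes "integrable (hit rt) u" "integrable (hit rt) v" "cexp_tends u" "cexp_tends v"
  shows "cexp_tends (\<lambda>\<xi>. u \<xi> + v \<xi>)"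
  unfolding cexp_tends_def
proof (rule tendsto_sandwich[OF _ _ tendsto_const])
  show "(\<lambda>n. L1 (\<lambda>\<xi>. cexp n u \<xi> - u \<xi>) + L1 (\<lambda>\<xi>. cexp n v \<xi> - v \<xi>)) \<longlonglongrightarrow> 0"
    using tendsto_add[OF assms(3,4)[unfolded cexp_tends_def]] by simp
  have "L1 (\<lambda>\<xi>. cexp n (\<lambda>\<xi>. u \<xi> + v \<xi>) \<xi> - (u \<xi> + v \<xi>)) \<le> L1 (\<lambda>\<xi>. cexp n u \<xi> - u \<xi>) + L1 (\<lambda>\<xi>. cexp n v \<xi> - v \<xi>)" for n
  proof -
    have "cexp n (\<lambda>\<xi>. u \<xi> + v \<xi>) \<xi> - (u \<xi> + v \<xi>) = (cexp n u \<xi> - u \<xi>) + (cexp n v \<xi> - v \<xi>)" for \<xi>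
      by (simp add: cexp_def cint_add assms add_divide_distrib)
    then show ?thesis using assms by (simp only:) (intro L1_triangle; simp)
  qed
  then show "\<forall>\<^sub>F n in sequentially. L1 (\<lambda>\<xi>. cexp n (\<lambda>\<xi>. u \<xi> + v \<xi>) \<xi> - (u \<xi> + v \<xi>)) \<le> L1 (\<lambda>\<xi>. cexp n u \<xi> - u \<xi>) + L1 (\<lambda>\<xi>. cexp n v \<xi> - v \<xi>)"
    by simp
qed (simp add: L1_nonneg)

lemma cexp_tends_cmult:
  assumes "cexp_tends u"
  shows "cexp_tends (\<lambda>\<xi>. u \<xi> * r)"
proof -
  have "L1 (\<lambda>\<xi>. cexp n (\<lambda>\<xi>. u \<xi> * r) \<xi> - u \<xi> * r) = L1 (\<lambda>\<xi>. cexp n u \<xi> - u \<xi>) * \<bar>r\<bar>" for n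
  proof -
    have "cexp n (\<lambda>\<xi>. u \<xi> * r) \<xi> - u \<xi> * r = (cexp n u \<xi> - u \<xi>) * r" for \<xi>
      by (simp add: cexp_def cint_cmult left_diff_distrib)
    then show ?thesis by (simp add: L1_def abs_mult)
  qed
  then show ?thesis
    using tendsto_mult_right[OF assms[unfolded cexp_tends_def], of "\<bar>r\<bar>"] unfolding cexp_tends_def by simp
qed

text \<open>The usual three-part estimate: contraction controls the conditional expectation of
  \<open>u - v i\<close> for every \<open>n\<close> at once.\<close>

lemma cexp_tends_limit:
  assumes u: "integrable (hit rt) u" and v: "\<And>i. integrable (hit rt) (v i)" "\<And>i. cexp_tends (v i)"
    and lim: "(\<lambda>i. L1 (\<lambda>\<xi>. v i \<xi> - u \<xi>)) \<longlonglongrightarrow> 0"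
  shows "cexp_tends u"
  unfolding cexp_tends_def
proof (rule LIMSEQ_I)
  fix e :: real assume e: "0 < e"
  then obtain i where i: "L1 (\<lambda>\<xi>. v i \<xi> - u \<xi>) < e / 3"
    using LIMSEQ_D[OF lim, of "e / 3"] L1_nonneg by fastforce
  obtain N where N: "\<And>n. N \<le> n \<Longrightarrow> L1 (\<lambda>\<xi>. cexp n (v i) \<xi> - v i \<xi>) < e / 3"
    using LIMSEQ_D[OF v(2)[of i, unfolded cexp_tends_def], of "e / 3"] e L1_nonneg by fastforce
  have "L1 (\<lambda>\<xi>. cexp n u \<xi> - u \<xi>) < e" if n: "N \<le> n" for n
  proof -
    let ?w = "\<lambda>\<xi>. u \<xi> - v i \<xi>"
    have "cexp n u \<xi> - u \<xi> = cexp n ?w \<xi> + ((cexp n (v i) \<xi> - v i \<xi>) + (v i \<xi> - u \<xi>))" for \<xi>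
      by (simp add: cexp_def cint_diff u v diff_divide_distrib)
    then have "L1 (\<lambda>\<xi>. cexp n u \<xi> - u \<xi>) \<le> L1 (cexp n ?w) + L1 (\<lambda>\<xi>. (cexp n (v i) \<xi> - v i \<xi>) + (v i \<xi> - u \<xi>))"
      using u v by (simp only:) (intro L1_triangle; simp)
    also have "\<dots> \<le> L1 (cexp n ?w) + (L1 (\<lambda>\<xi>. cexp n (v i) \<xi> - v i \<xi>) + L1 (\<lambda>\<xi>. v i \<xi> - u \<xi>))"
      using u v by (intro add_left_mono L1_triangle) auto
    also have "L1 (cexp n ?w) \<le> L1 ?w" using u v by (intro L1_cexp_le) auto
    also have "L1 ?w = L1 (\<lambda>\<xi>. v i \<xi> - u \<xi>)" by (simp add: L1_def abs_minus_commute)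
    finally show ?thesis using i N[OF n] by linarith
  qed
  then show "\<exists>N. \<forall>n\<ge>N. norm (L1 (\<lambda>\<xi>. cexp n u \<xi> - u \<xi>) - 0) < e"
    using L1_nonneg by (metis abs_of_nonneg diff_zero real_norm_def)
qed

lemma cexp_tends_dominated:
  assumes u: "integrable (hit rt) u" and v: "\<And>i. integrable (hit rt) (v i)" "\<And>i. cexp_tends (v i)"
    and lim: "\<And>\<xi>. \<xi> \<in> ends \<Longrightarrow> (\<lambda>i. v i \<xi>) \<longlonglongrightarrow> u \<xi>"
    and w: "integrable (hit rt) w" and dom: "\<And>i \<xi>. \<xi> \<in> ends \<Longrightarrow> \<bar>v i \<xi>\<bar> \<le> w \<xi>"
  shows "cexp_tends u"
proof (rule cexp_tends_limit[OF u v])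
  have "(\<lambda>i. L1 (\<lambda>\<xi>. v i \<xi> - u \<xi>)) \<longlonglongrightarrow> (\<integral>\<xi>. 0 \<partial>hit rt)"
    unfolding L1_def
  proof (rule integral_dominated_convergence[where w="\<lambda>\<xi>. w \<xi> + \<bar>u \<xi>\<bar>"])
    show "integrable (hit rt) (\<lambda>\<xi>. w \<xi> + \<bar>u \<xi>\<bar>)" using u w by simp
    show "AE \<xi> in hit rt. (\<lambda>i. \<bar>v i \<xi> - u \<xi>\<bar>) \<longlonglongrightarrow> 0"
      using lim by (intro AE_I2 tendsto_rabs_zero) (simp add: LIM_zero)
    show "AE \<xi> in hit rt. norm \<bar>v i \<xi> - u \<xi>\<bar> \<le> w \<xi> + \<bar>u \<xi>\<bar>" for i
      using dom[of _ i] by (intro AE_I2) force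
    show "(\<lambda>\<xi>. \<bar>v i \<xi> - u \<xi>\<bar>) \<in> borel_measurable (hit rt)" for i
      using u v(1)[of i] by (intro borel_measurable_integrable) simp
  qed simp
  then show "(\<lambda>i. L1 (\<lambda>\<xi>. v i \<xi> - u \<xi>)) \<longlonglongrightarrow> 0" by simp
qed

text \<open>From level \<open>depth x\<close> on, \<open>cyl x\<close> is determined by the vertex
  of the ray at that level, so conditioning reproduces the indicator exactly.\<close>

lemma cexp_tends_cyl: "cexp_tends (indicator (cyl x))"
proof -
  have "L1 (\<lambda>\<xi>. cexp n (indicator (cyl x)) \<xi> - indicator (cyl x) \<xi>) = 0" if n: "depth x \<le> n" for n
  proof -
    have "cexp n (indicator (cyl x)) \<xi> = indicator (cyl x) \<xi>" if \<xi>: "\<xi> \<in> ends" for \<xi>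
    proof -
      have \<xi>n: "\<xi> \<in> cyl (\<xi> n)" using \<xi> ray_depth[OF \<xi>] by (simp add: in_cyl_iff)
      have dn: "depth (\<xi> n) = n" by (rule ray_depth[OF \<xi>])
      have "cint (indicator (cyl x)) (\<xi> n) = indicator (cyl x) \<xi> * \<nu> (\<xi> n)"
      proof (cases "\<xi> \<in> cyl x")
        case True
        then have "cyl (\<xi> n) \<subseteq> cyl x" using cyl_anc[OF True \<xi>n] n dn by (intro cyl_mono) simp
        then have "cint (indicator (cyl x)) (\<xi> n) = (\<integral>\<eta>. indicator (cyl (\<xi> n)) \<eta> \<partial>hit rt)"
          unfolding cint_def by (intro Bochner_Integration.integral_cong) (auto simp: indicator_def)
        then show ?thesis using True by (simp add: Int_absorb2[OF cyl_subset_ends])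
      next
        case False
        have "x \<notin> anc par rt (\<xi> n)" using False \<xi>n cyl_mono by blast
        then have "cyl x \<inter> cyl (\<xi> n) = {}" using cyl_anc n dn by fastforce
        then have "cint (indicator (cyl x)) (\<xi> n) = (\<integral>\<eta>. 0 \<partial>hit rt)"
          unfolding cint_def by (intro Bochner_Integration.integral_cong) (auto simp: indicator_def)
        then show ?thesis using False by simp
      qed
      then show ?thesis using \<nu>_pos[of "\<xi> n"] by (simp add: cexp_def)
    qed
    then have "L1 (\<lambda>\<xi>. cexp n (indicator (cyl x)) \<xi> - indicator (cyl x) \<xi>) = (\<integral>\<xi>. 0 \<partial>hit rt)"
      unfolding L1_def by (intro Bochner_Integration.integral_cong) auto
    then show ?thesis by simp
  qed
  then show ?thesis
    unfolding cexp_tends_def by (intro tendsto_eventually) (auto simp: eventually_sequentially)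
qed

text \<open>Dynkin's argument: cylinders form an intersection-stable generator, and complements and
  disjoint unions preserve convergence by linearity and domination.\<close>

lemma cexp_tends_indicator:
  assumes "A \<in> sets bd"
  shows "cexp_tends (indicator A)"
proof -
  have int: "integrable (hit rt) (indicator A :: _ \<Rightarrow> real)" if "A \<in> sets bd" for A
    using that by (auto simp: less_top[symmetric] intro!: integrable_real_indicator)
  have ends: "cexp_tends (indicator ends)" using cexp_tends_cyl[of rt] by simp
  have cong: "cexp_tends v" if "cexp_tends u" "\<And>\<xi>. \<xi> \<in> ends \<Longrightarrow> u \<xi> = v \<xi>" for u v
  proof -
    have "cint u x = cint v x" for x
      unfolding cint_def by (intro Bochner_Integration.integral_cong) (use that(2) in auto)
    then have "L1 (\<lambda>\<xi>. cexp n u \<xi> - u \<xi>) = L1 (\<lambda>\<xi>. cexp n v \<xi> - v \<xi>)" for n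
      unfolding L1_def cexp_def by (intro Bochner_Integration.integral_cong) (use that(2) in auto)
    then show ?thesis using that(1) by (simp add: cexp_tends_def)
  qed
  have pow: "insert {} (range cyl) \<subseteq> Pow ends" using cyl_subset_ends by auto
  from Int_stable_cyl pow assms[unfolded sets_bdry'] show ?thesis
  proof (induction rule: sigma_sets_induct_disjoint)
    case (basic A)
    then consider "A = {}" | x where "A = cyl x" by blast
    then show ?case
    proof cases
      case 1 then show ?thesis using cexp_tends_cmult[OF ends, of 0] by (simp add: indicator_def[abs_def])
    qed (simp add: cexp_tends_cyl)
  next
    case empty
    show ?case using cexp_tends_cmult[OF ends, of 0] by (simp add: indicator_def[abs_def])
  next
    case (compl A)
    then have A: "A \<in> sets bd" by (simp add: sets_bdry')
    have "cexp_tends (\<lambda>\<xi>. indicator ends \<xi> + indicator A \<xi> * (- 1))"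
      by (intro cexp_tends_add cexp_tends_cmult ends compl) (use int[OF A] int[of ends] sets.top[of bd] in auto)
    then show ?case by (rule cong) (auto simp: indicator_def)
  next
    case (union A)
    have A: "A i \<in> sets bd" for i using union by (auto simp: sets_bdry')
    have "cexp_tends (\<lambda>\<xi>. \<Sum>i<k. indicator (A i) \<xi>)" for k
    proof (induction k)
      case 0 show ?case using cexp_tends_cmult[OF ends, of 0] by simp
    next
      case (Suc k)
      then show ?case
        using cexp_tends_add[OF _ int[OF A] Suc union.IH, of k] int[OF A] by simp
    qed
    moreover have sum: "(\<Sum>i<k. indicator (A i) \<xi>) = (indicator (\<Union>i<k. A i) \<xi> :: real)" for k \<xi>
      using union(1) by (subst indicator_UN_disjoint) (auto simp: disjoint_family_on_def)
    ultimately have fin: "cexp_tends (indicator (\<Union>i<k. A i))" for k by simp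
    show ?case
    proof (rule cexp_tends_dominated[OF int _ fin, where w="\<lambda>_. 1"])
      show "(\<Union>i. A i) \<in> sets bd" using A by auto
      show "integrable (hit rt) (indicator (\<Union>i<k. A i) :: _ \<Rightarrow> real)" for k using A by (intro int) auto
      show "(\<lambda>k. indicator (\<Union>i<k. A i) \<xi> :: real) \<longlonglongrightarrow> indicator (\<Union>i. A i) \<xi>" for \<xi>
        by (rule LIMSEQ_indicator_UN)
    qed (auto simp: indicator_def)
  qed
qed

text \<open>The closed case of martingale convergence in mean, extended from indicators through
  simple functions.\<close>

lemma cexp_L1_convergence: "integrable (hit rt) u \<Longrightarrow> cexp_tends u"
proof (induction u rule: integrable_induct)
  case (base A r)
  then show ?case using cexp_tends_cmult[OF cexp_tends_indicator[of A], of r] by simp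
next
  case (add f h)
  then show ?case by (intro cexp_tends_add)
next
  case (lim f s)
  then show ?case
    by (intro cexp_tends_dominated[of f s "\<lambda>\<xi>. 2 * \<bar>f \<xi>\<bar>"]) auto
qed

lemma cexp_AE_subseq:
  assumes u: "integrable (hit rt) u"
  obtains r where "strict_mono (r :: nat \<Rightarrow> nat)" "AE \<xi> in hit rt. (\<lambda>k. cexp (r k) u \<xi>) \<longlonglongrightarrow> u \<xi>"
proof -
  have "(\<lambda>n. \<integral>\<xi>. norm (cexp n u \<xi> - u \<xi>) \<partial>hit rt) \<longlonglongrightarrow> 0"
    using cexp_L1_convergence[OF u] by (simp add: cexp_tends_def L1_def)
  from tendsto_L1_AE_subseq[OF _ this] obtain r 
    where r: "strict_mono r" "AE \<xi> in hit rt. (\<lambda>k. cexp (r k) u \<xi> - u \<xi>) \<longlonglongrightarrow> 0"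
    using u by auto
  show ?thesis
    by (rule that[OF r(1)]) (use r(2) in \<open>auto elim!: eventually_mono intro: LIM_zero_cancel\<close>)
qed

text \<open>Convergence in mean gives almost sure convergence along a subsequence, and Fatou
  transfers the bound to \<open>u\<close>. Integrability of the square is not assumed but is what
  this is meant to produce.\<close>

lemma cexp_fatou:
  assumes u: "integrable (hit rt) u" and b: "\<And>x. 0 \<le> b x"
    and X: "\<And>n. l \<le> n \<Longrightarrow> (\<Sum>x\<in>level l. b x * cint (\<lambda>\<xi>. (cexp n u \<xi>)\<^sup>2) x) \<le> X"
  shows "(\<integral>\<^sup>+\<xi>. ennreal ((\<Sum>x\<in>level l. b x * indicator (cyl x) \<xi>) * (u \<xi>)\<^sup>2) \<partial>hit rt) \<le> ennreal X"
proof -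
  note [measurable] = integrable_hit_measurable[OF u]
  obtain r where r: "strict_mono (r :: nat \<Rightarrow> nat)" "AE \<xi> in hit rt. (\<lambda>k. cexp (r k) u \<xi>) \<longlonglongrightarrow> u \<xi>"
    by (rule cexp_AE_subseq[OF u])
  let ?w = "\<lambda>\<xi>. \<Sum>x\<in>level l. b x * indicator (cyl x) \<xi>"
  have w0: "0 \<le> ?w \<xi>" for \<xi> using b by (intro sum_nonneg) auto
  have meas [measurable]: "cexp n u \<in> borel_measurable bd" for n
    by (rule integrable_hit_measurable) simp
  have exp: "?w \<xi> * t = (\<Sum>x\<in>level l. b x * (indicator (cyl x) \<xi> * t))" for \<xi> t
    unfolding sum_distrib_right by (intro sum.cong refl mult.assoc)
  have int: "integrable (hit rt) (\<lambda>\<xi>. ?w \<xi> * (cexp n u \<xi>)\<^sup>2)" for n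
    unfolding exp
    by (intro Bochner_Integration.integrable_sum integrable_mult_right integrable_indicator_cyl integrable_cexp_sq)
  have val: "(\<integral>\<xi>. ?w \<xi> * (cexp n u \<xi>)\<^sup>2 \<partial>hit rt) = (\<Sum>x\<in>level l. b x * cint (\<lambda>\<xi>. (cexp n u \<xi>)\<^sup>2) x)" for n
    unfolding exp cint_def
    by (subst Bochner_Integration.integral_sum)
       (intro integrable_mult_right integrable_indicator_cyl integrable_cexp_sq, simp)
  have "(\<integral>\<^sup>+\<xi>. ennreal (?w \<xi> * (u \<xi>)\<^sup>2) \<partial>hit rt)
      = (\<integral>\<^sup>+\<xi>. liminf (\<lambda>k. ennreal (?w \<xi> * (cexp (r k) u \<xi>)\<^sup>2)) \<partial>hit rt)"
  proof (rule nn_integral_cong_AE, use r(2) in eventually_elim)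
    case (elim \<xi>)
    then have "(\<lambda>k. ennreal (?w \<xi> * (cexp (r k) u \<xi>)\<^sup>2)) \<longlonglongrightarrow> ennreal (?w \<xi> * (u \<xi>)\<^sup>2)"
      by (intro tendsto_ennrealI tendsto_mult_left tendsto_power)
    then show ?case by (intro lim_imp_Liminf[symmetric]) auto
  qed
  also have "\<dots> \<le> liminf (\<lambda>k. \<integral>\<^sup>+\<xi>. ennreal (?w \<xi> * (cexp (r k) u \<xi>)\<^sup>2) \<partial>hit rt)"
    by (rule nn_integral_liminf) measurable
  also have "\<dots> \<le> liminf (\<lambda>k. ennreal X)"
  proof (rule Liminf_mono)
    have "(\<integral>\<^sup>+\<xi>. ennreal (?w \<xi> * (cexp (r k) u \<xi>)\<^sup>2) \<partial>hit rt) \<le> ennreal X" if "l \<le> k" for k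
    proof -
      have "(\<integral>\<^sup>+\<xi>. ennreal (?w \<xi> * (cexp (r k) u \<xi>)\<^sup>2) \<partial>hit rt)
        = ennreal (\<Sum>x\<in>level l. b x * cint (\<lambda>\<xi>. (cexp (r k) u \<xi>)\<^sup>2) x)"
        by (subst nn_integral_eq_integral[OF int])
           (intro AE_I2 mult_nonneg_nonneg w0 zero_le_power2, simp only: val)
      \<comment> \<open>A strictly increasing sequence satisfies \<open>k \<le> r k\<close>, so the
        bound assumed from level \<open>l\<close> on applies along the subsequence.\<close>
      then show ?thesis
        using X[of "r k"] strict_mono_imp_increasing[OF r(1), of k] that by (simp add: ennreal_leI)
    qed
    then show "\<forall>\<^sub>F k in sequentially. (\<integral>\<^sup>+\<xi>. ennreal (?w \<xi> * (cexp (r k) u \<xi>)\<^sup>2) \<partial>hit rt) \<le> ennreal X"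
      by (auto simp: eventually_sequentially)
  qed
  also have "\<dots> = ennreal X" by (simp add: Liminf_const)
  finally show ?thesis .
qed

end

section \<open>The energy identity\<close>

context vanishing_green_walk
begin

text \<open>With \<open>t\<close> the mean of \<open>u\<close> on \<open>cyl x\<close>, the integral
  of \<open>(u - t)\<^sup>2\<close> over the cylinder is nonnegative.\<close>

lemma cint_sq_le:
  assumes u: "integrable (hit rt) u" and u2: "integrable (hit rt) (\<lambda>\<xi>. (u \<xi>)\<^sup>2)"
  shows "(cint u x)\<^sup>2 / \<nu> x \<le> cint (\<lambda>\<xi>. (u \<xi>)\<^sup>2) x"
proof -
  define t where "t = cint u x / \<nu> x"
  have eq: "indicator (cyl x) \<xi> * (u \<xi> - t)\<^sup>2 = indicator (cyl x) \<xi> * (u \<xi>)\<^sup>2 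
      - 2 * t * (indicator (cyl x) \<xi> * u \<xi>) + t\<^sup>2 * indicator (cyl x) \<xi>" for \<xi>
    by (simp add: power2_eq_square algebra_simps)
  have "0 \<le> (\<integral>\<xi>. indicator (cyl x) \<xi> * (u \<xi> - t)\<^sup>2 \<partial>hit rt)"
    by (intro integral_nonneg_AE) auto
  also have "\<dots> = cint (\<lambda>\<xi>. (u \<xi>)\<^sup>2) x - 2 * t * cint u x + t\<^sup>2 * \<nu> x"
    unfolding eq using u u2 by (simp add: cint_def Int_absorb2[OF cyl_subset_ends])
  also have "\<dots> = cint (\<lambda>\<xi>. (u \<xi>)\<^sup>2) x - (cint u x)\<^sup>2 / \<nu> x"
    using \<nu>_pos[of x] by (simp add: t_def power2_eq_square field_simps)
  finally show ?thesis by simp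
qed

lemma upward_induct [consumes 1, case_names leaf inner]:
  assumes "depth x \<le> n"
    and "\<And>x. depth x = n \<Longrightarrow> P x"
    and "\<And>x. depth x < n \<Longrightarrow> (\<And>y. y \<in> chl x \<Longrightarrow> P y) \<Longrightarrow> P x"
  shows "P x"
  using assms(1)
proof (induction "n - depth x" arbitrary: x)
  case 0 then show ?case using assms(2) by simp
next
  case (Suc k)
  show ?case
  proof (rule assms(3))
    fix y assume "y \<in> chl x"
    then show "P y" using Suc by (intro Suc.hyps(1)) (auto simp: depth_children)
  qed (use Suc in simp)
qed

context
  fixes u :: "(nat \<Rightarrow> 'a) \<Rightarrow> real"
  assumes u: "integrable (hit rt) u"
begin

text \<open>The tower property: immediate on level \<open>n\<close>, then carried towards the root
  because both sides are additive over children.\<close>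

lemma cint_cexp: "depth x \<le> n \<Longrightarrow> cint (cexp n u) x = cint u x"
proof (induction x rule: upward_induct)
  case (leaf x)
  then show ?case
    using cint_level_fun[of x n "\<lambda>x. cint u x / \<nu> x"] \<nu>_pos[of x] by (simp add: cexp_def[abs_def])
next
  case (inner x)
  then show ?case
    unfolding cint_children[OF integrable_cexp, of n u x, symmetric] cint_children[OF u, of x, symmetric] by simp
qed

lemma cint_cexp_sq_leaf: "depth x = n \<Longrightarrow> cint (\<lambda>\<xi>. (cexp n u \<xi>)\<^sup>2) x = (cint u x)\<^sup>2 / \<nu> x"
  using cint_level_fun[of x n "\<lambda>x. (cint u x / \<nu> x)\<^sup>2"] \<nu>_pos[of x]
  by (simp add: cexp_def power2_eq_square)

text \<open>Jensen's inequality on level \<open>n\<close> by \<open>cint_sq_le\<close>, propagated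
  towards the root by additivity.\<close>

lemma cint_cexp_sq_le:
  assumes u2: "integrable (hit rt) (\<lambda>\<xi>. (u \<xi>)\<^sup>2)"
  shows "depth x \<le> n \<Longrightarrow> cint (\<lambda>\<xi>. (cexp n u \<xi>)\<^sup>2) x \<le> cint (\<lambda>\<xi>. (u \<xi>)\<^sup>2) x"
proof (induction x rule: upward_induct)
  case (leaf x)
  then show ?case using cint_sq_le[OF u u2] by (simp add: cint_cexp_sq_leaf)
next
  case (inner x)
  then show ?case
    unfolding cint_children[OF integrable_cexp_sq, of n u x, symmetric] cint_children[OF u2, of x, symmetric]
    by (intro sum_mono)
qed

lemma cexp_energy:
  "(\<Sum>k\<le>n. \<Sum>x\<in>level k. c x * (\<nu> x * cint (\<lambda>\<xi>. (cexp n u \<xi>)\<^sup>2) x - (cint u x)\<^sup>2)) = S u n + B u n"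
  by (rule level_energy[OF u]) (simp_all add: cint_children[OF integrable_cexp_sq] cint_cexp_sq_leaf)

lemma cexp_energy_term_nonneg:
  assumes "depth x \<le> n"
  shows "0 \<le> c x * (\<nu> x * cint (\<lambda>\<xi>. (cexp n u \<xi>)\<^sup>2) x - (cint u x)\<^sup>2)"
  using cint_sq_le[OF integrable_cexp integrable_cexp_sq, of n u x] \<nu>_pos[of x] c_nonneg[of x]
  by (intro mult_nonneg_nonneg) (simp_all add: cint_cexp[OF assms] field_simps)

context
  fixes E :: real
  assumes bound: "\<And>N. S u N \<le> E"
begin

text \<open>The level-\<open>l\<close> part of the jump energy of \<open>cexp n u\<close> is below
  the full energy \<open>S u n + B u n\<close>, hence below \<open>E\<close>. Adding back the
  squared means leaves a nonnegative integral, the form needed for Fatou, with a bound free of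
  \<open>n\<close>.\<close>

lemma cexp_level_bound:
  assumes "l \<le> n"
  shows "(\<Sum>x\<in>level l. 1 / g x * cint (\<lambda>\<xi>. (cexp n u \<xi>)\<^sup>2) x) \<le> E + (\<Sum>k\<le>l. \<Sum>x\<in>level k. c x * (cint u x)\<^sup>2)"
proof -
  let ?K = "cint (\<lambda>\<xi>. (cexp n u \<xi>)\<^sup>2)"
  have 1: "(\<Sum>x\<in>level l. ?K x / g x) = (\<Sum>k\<le>l. \<Sum>x\<in>level k. c x * (\<nu> x * ?K x))"
    by (rule sum_c_additive[symmetric]) (simp add: cint_children[OF integrable_cexp_sq])
  have 2: "(\<Sum>k\<le>l. \<Sum>x\<in>level k. c x * (\<nu> x * ?K x)) = (\<Sum>k\<le>l. \<Sum>x\<in>level k. c x * (\<nu> x * ?K x - (cint u x)\<^sup>2)) + (\<Sum>k\<le>l. \<Sum>x\<in>level k. c x * (cint u x)\<^sup>2)"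
    by (simp add: right_diff_distrib sum_subtractf)
  have "(\<Sum>k\<le>l. \<Sum>x\<in>level k. c x * (\<nu> x * ?K x - (cint u x)\<^sup>2))
     \<le> (\<Sum>k\<le>n. \<Sum>x\<in>level k. c x * (\<nu> x * ?K x - (cint u x)\<^sup>2))"
    using assms by (intro sum_mono2 sum_nonneg cexp_energy_term_nonneg) (auto simp: level_def)
  also have "\<dots> = S u n + B u n" by (rule cexp_energy)
  also have "\<dots> \<le> E" using B_le_tail[OF u bound, of n] by simp
  finally show ?thesis using 1 2 by simp
qed

lemma weighted_square_bound:
  "(\<integral>\<^sup>+\<xi>. ennreal ((\<Sum>x\<in>level l. 1 / g x * indicator (cyl x) \<xi>) * (u \<xi>)\<^sup>2) \<partial>hit rt)
     \<le> ennreal (E + (\<Sum>k\<le>l. \<Sum>x\<in>level k. c x * (cint u x)\<^sup>2))"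
  by (rule cexp_fatou[OF u]) (simp_all only: cexp_level_bound, simp)

text \<open>The case \<open>l = 0\<close> of the weighted bound, where the weight is the constant
  \<open>1 / g rt\<close>.\<close>

lemma square_integrable: "integrable (hit rt) (\<lambda>\<xi>. (u \<xi>)\<^sup>2)"
proof -
  note [measurable] = integrable_hit_measurable[OF u]
  have "integrable (hit rt) (\<lambda>\<xi>. 1 / g rt * (u \<xi>)\<^sup>2)"
  proof (rule integrableI_bounded)
    have "(\<integral>\<^sup>+\<xi>. ennreal (norm (1 / g rt * (u \<xi>)\<^sup>2)) \<partial>hit rt)
      = (\<integral>\<^sup>+\<xi>. ennreal ((\<Sum>x\<in>level 0. 1 / g x * indicator (cyl x) \<xi>) * (u \<xi>)\<^sup>2) \<partial>hit rt)"
      by (intro nn_integral_cong) simp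
    also have "\<dots> \<le> ennreal (E + (\<Sum>k\<le>0. \<Sum>x\<in>level k. c x * (cint u x)\<^sup>2))"
      by (rule weighted_square_bound)
    also have "\<dots> < \<infinity>" by simp
    finally show "(\<integral>\<^sup>+\<xi>. ennreal (norm (1 / g rt * (u \<xi>)\<^sup>2)) \<partial>hit rt) < \<infinity>" .
  qed measurable
  then have "integrable (hit rt) (\<lambda>\<xi>. g rt * (1 / g rt * (u \<xi>)\<^sup>2))" by (rule integrable_mult_right)
  then show ?thesis using g_pos[of rt] by simp
qed

lemma energy_nonneg: "0 \<le> E"
  using bound[of 0] by (simp add: S_def)

text \<open>Now that \<open>u\<^sup>2\<close> is integrable, the squared means added for Fatou's
  lemma can be subtracted again.\<close>

lemma partial_jump_energy_le: "(\<Sum>k\<le>l. \<Sum>x\<in>level k. c x * (\<nu> x * cint (\<lambda>\<xi>. (u \<xi>)\<^sup>2) x - (cint u x)\<^sup>2)) \<le> E"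
proof -
  note u2 = square_integrable
  let ?K = "cint (\<lambda>\<xi>. (u \<xi>)\<^sup>2)"
  let ?w = "\<lambda>\<xi>. \<Sum>x\<in>level l. 1 / g x * indicator (cyl x) \<xi>"
  have exp: "?w \<xi> * t = (\<Sum>x\<in>level l. 1 / g x * (indicator (cyl x) \<xi> * t))" for \<xi> t
    unfolding sum_distrib_right by (intro sum.cong refl mult.assoc)
  have w0: "0 \<le> ?w \<xi>" for \<xi> by (intro sum_nonneg) auto
  have int: "integrable (hit rt) (\<lambda>\<xi>. ?w \<xi> * (u \<xi>)\<^sup>2)"
    unfolding exp by (intro Bochner_Integration.integrable_sum integrable_mult_right integrable_indicator_cyl u2)
  have val: "(\<integral>\<xi>. ?w \<xi> * (u \<xi>)\<^sup>2 \<partial>hit rt) = (\<Sum>x\<in>level l. 1 / g x * ?K x)"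
    unfolding exp cint_def
    by (subst Bochner_Integration.integral_sum)
       (intro integrable_mult_right integrable_indicator_cyl u2, simp)
  have eq: "(\<integral>\<^sup>+\<xi>. ennreal (?w \<xi> * (u \<xi>)\<^sup>2) \<partial>hit rt) = ennreal (\<Sum>x\<in>level l. 1 / g x * ?K x)"
    by (subst nn_integral_eq_integral[OF int])
       (intro AE_I2 mult_nonneg_nonneg w0 zero_le_power2, simp only: val)
  have "0 \<le> E + (\<Sum>k\<le>l. \<Sum>x\<in>level k. c x * (cint u x)\<^sup>2)"
    using energy_nonneg by (intro add_nonneg_nonneg sum_nonneg) (auto simp: c_nonneg)
  then have "(\<Sum>x\<in>level l. 1 / g x * ?K x) \<le> E + (\<Sum>k\<le>l. \<Sum>x\<in>level k. c x * (cint u x)\<^sup>2)"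
    using weighted_square_bound[of l] unfolding eq by (subst (asm) ennreal_le_iff)
  moreover have "(\<Sum>k\<le>l. \<Sum>x\<in>level k. c x * (\<nu> x * ?K x)) = (\<Sum>x\<in>level l. ?K x / g x)"
    by (rule sum_c_additive) (simp add: cint_children[OF u2])
  ultimately show ?thesis by (simp add: right_diff_distrib sum_subtractf)
qed

text \<open>Conditioning leaves each \<open>cint u x\<close> up to level \<open>n\<close> unchanged
  and can only lower the integrals of the square; the finite-level energy already dominates
  \<open>S u n\<close>.\<close>

lemma S_le_partial_jump_energy:
  "S u n \<le> (\<Sum>k\<le>n. \<Sum>x\<in>level k. c x * (\<nu> x * cint (\<lambda>\<xi>. (u \<xi>)\<^sup>2) x - (cint u x)\<^sup>2))"
proof -
  have "S u n \<le> (\<Sum>k\<le>n. \<Sum>x\<in>level k. c x * (\<nu> x * cint (\<lambda>\<xi>. (cexp n u \<xi>)\<^sup>2) x - (cint u x)\<^sup>2))"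
    unfolding cexp_energy using B_nonneg[OF u] by simp
  also have "\<dots> \<le> (\<Sum>k\<le>n. \<Sum>x\<in>level k. c x * (\<nu> x * cint (\<lambda>\<xi>. (u \<xi>)\<^sup>2) x - (cint u x)\<^sup>2))"
    using c_nonneg \<nu>_pos
    by (intro sum_mono mult_left_mono diff_right_mono cint_cexp_sq_le[OF square_integrable])
       (auto simp: level_def less_imp_le)
  finally show ?thesis .
qed

lemma jump_energy_term_nonneg: "0 \<le> c x * (\<nu> x * cint (\<lambda>\<xi>. (u \<xi>)\<^sup>2) x - (cint u x)\<^sup>2)"
  using cint_sq_le[OF u square_integrable, of x] \<nu>_pos[of x] c_nonneg[of x]
  by (intro mult_nonneg_nonneg) (simp_all add: field_simps)

text \<open>So far \<open>E\<close> was any upper bound of the tree energies; \<open>least\<close>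
  makes it their supremum, so the upper and lower estimates meet.\<close>

lemma jump_energy_sums:
  assumes least: "\<And>X. (\<And>N. S u N \<le> X) \<Longrightarrow> E \<le> X"
  shows "(\<lambda>n. \<Sum>x\<in>level n. c x * (\<nu> x * cint (\<lambda>\<xi>. (u \<xi>)\<^sup>2) x - (cint u x)\<^sup>2)) sums E"
proof -
  let ?t = "\<lambda>n. \<Sum>x\<in>level n. c x * (\<nu> x * cint (\<lambda>\<xi>. (u \<xi>)\<^sup>2) x - (cint u x)\<^sup>2)"
  have t0: "0 \<le> ?t n" for n by (intro sum_nonneg jump_energy_term_nonneg)
  have bd: "(\<Sum>k<n. ?t k) \<le> E" for n
    using partial_jump_energy_le[of "n - 1"] energy_nonneg by (cases n) (auto simp: lessThan_Suc_atMost)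
  have summ: "summable ?t" by (rule summableI_nonneg_bounded[OF t0 bd])
  have "suminf ?t \<le> E" by (rule suminf_le_const[OF summ bd])
  moreover have "E \<le> suminf ?t"
  proof (rule least)
    fix N
    have "S u N \<le> (\<Sum>k<Suc N. ?t k)"
      using S_le_partial_jump_energy[of N] by (simp only: lessThan_Suc_atMost)
    also have "\<dots> \<le> suminf ?t" by (rule sum_le_suminf[OF summ]) (use t0 in auto)
    finally show "S u N \<le> suminf ?t" .
  qed
  ultimately show ?thesis using summ by (simp add: sums_iff)
qed

lemma jump_energy_eq:
  assumes least: "\<And>X. (\<And>N. S u N \<le> X) \<Longrightarrow> E \<le> X"
  shows "has_bochner_integral (hit rt \<Otimes>\<^sub>M hit rt) (\<lambda>z. (u (fst z) - u (snd z))\<^sup>2 * J (fst z) (snd z)) (2 * E)"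
proof (rule has_bochner_integral_nn_integral)
  note [measurable] = integrable_hit_measurable[OF u]
  let ?f = "\<lambda>z. (u (fst z) - u (snd z))\<^sup>2 * J (fst z) (snd z)"
  let ?t = "\<lambda>x. c x * (\<nu> x * cint (\<lambda>\<xi>. (u \<xi>)\<^sup>2) x - (cint u x)\<^sup>2)"
  show "?f \<in> borel_measurable (hit rt \<Otimes>\<^sub>M hit rt)"
    using jump_integrand_measurable[of u] by (simp cong: measurable_cong_sets sets_pair_hit)
  show "AE z in hit rt \<Otimes>\<^sub>M hit rt. 0 \<le> ?f z"
    by (intro AE_I2 mult_nonneg_nonneg J_nonneg) (auto simp: space_pair_measure)
  show "0 \<le> 2 * E" using energy_nonneg by simp
  have "(\<integral>\<^sup>+z. ennreal (?f z) \<partial>(hit rt \<Otimes>\<^sub>M hit rt))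
    = (\<Sum>n. \<Sum>x\<in>level n. ennreal (c x) * ennreal (2 * (\<nu> x * cint (\<lambda>\<xi>. (u \<xi>)\<^sup>2) x - (cint u x)\<^sup>2)))"
    by (rule jump_energy[OF u square_integrable])
  also have "\<dots> = (\<Sum>n. ennreal (2 * (\<Sum>x\<in>level n. ?t x)))"
  proof (intro suminf_cong)
    fix n
    have "ennreal (c x) * ennreal (2 * (\<nu> x * cint (\<lambda>\<xi>. (u \<xi>)\<^sup>2) x - (cint u x)\<^sup>2)) = ennreal (2 * ?t x)" for x
      unfolding ennreal_mult'[OF c_nonneg, symmetric] by (rule arg_cong[where f=ennreal], rule mult.left_commute)
    then show "(\<Sum>x\<in>level n. ennreal (c x) * ennreal (2 * (\<nu> x * cint (\<lambda>\<xi>. (u \<xi>)\<^sup>2) x - (cint u x)\<^sup>2)))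
        = ennreal (2 * (\<Sum>x\<in>level n. ?t x))"
      using jump_energy_term_nonneg by (simp only: sum_distrib_left) (subst sum_ennreal; simp)
  qed
  also have "\<dots> = ennreal (2 * E)"
    using sums_mult[OF jump_energy_sums[OF least], of 2] 
    by (intro suminf_ennreal_eq) (simp_all add: sum_nonneg jump_energy_term_nonneg)
  finally show "(\<integral>\<^sup>+z. ennreal (?f z) \<partial>(hit rt \<Otimes>\<^sub>M hit rt)) = ennreal (2 * E)" .
qed

end

end

abbreviation "HD \<equiv> HD_domain par rt p"
abbreviation "en u x \<equiv> (h u x - h u (par x))\<^sup>2 * a x"

lemma quadratic_identity:
  assumes "u \<in> HD"
  shows "has_bochner_integral (hit rt \<Otimes>\<^sub>M hit rt) (\<lambda>z. (u (fst z) - u (snd z))\<^sup>2 * J (fst z) (snd z))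
    (2 * (\<Sum>\<^sub>\<infinity>x\<in>UNIV - {rt}. en u x))"
proof (rule jump_energy_eq)
  show u: "integrable (hit rt) u" using assms by (simp add: HD_domain_def)
  have s: "en u summable_on (UNIV - {rt})" using assms by (simp add: HD_domain_def)
  have en0: "0 \<le> en u x" if "x \<in> UNIV - {rt}" for x
    using that a_pos[of x] by simp
  have S: "S u N = sum (en u) (\<Union>k<N. level (Suc k))" for N
    unfolding S_def by (rule sum.UNION_disjoint[symmetric]) (simp_all, auto simp: level_def)
  have sub: "(\<Union>k<N. level (Suc k)) \<subseteq> UNIV - {rt}" for N by (auto simp: level_def)
  show "S u N \<le> (\<Sum>\<^sub>\<infinity>x\<in>UNIV - {rt}. en u x)" for N
    unfolding S by (rule finite_sum_le_infsum[OF s _ sub]) (use en0 in auto)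
  fix X assume X: "\<And>N. S u N \<le> X"
  show "(\<Sum>\<^sub>\<infinity>x\<in>UNIV - {rt}. en u x) \<le> X"
  proof (rule infsum_le_finite_sums[OF s])
    fix A assume A: "finite A" "A \<subseteq> UNIV - {rt}"
    \<comment> \<open>A finite set of vertices other than the root lies within finitely many
      positive levels; inserting 0 keeps \<open>Max\<close> defined for empty
      \<open>A\<close>.\<close>
    have "x \<in> (\<Union>k<Max (insert 0 (depth ` A)). level (Suc k))" if "x \<in> A" for x
    proof -
      have "depth x \<noteq> 0" using that A by auto
      then obtain k where k: "depth x = Suc k" by (cases "depth x") auto
      have "depth x \<le> Max (insert 0 (depth ` A))" using that A by (intro Max_ge) auto
      then show ?thesis using k by (auto simp: level_def)
    qed
    then have A': "A \<subseteq> (\<Union>k<Max (insert 0 (depth ` A)). level (Suc k))" by blast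
    have "sum (en u) A \<le> sum (en u) (\<Union>k<Max (insert 0 (depth ` A)). level (Suc k))"
      by (rule sum_mono2[OF _ A'], simp, rule en0) (use sub in blast)
    then show "sum (en u) A \<le> X" using X[of "Max (insert 0 (depth ` A))"] unfolding S by linarith
  qed
qed

text \<open>Linearity is carried down the tree by \<open>poisson_step\<close>, so integrability is
  required only with respect to \<open>hit rt\<close>.\<close>

lemma poisson_lin:
  assumes "integrable (hit rt) u" "integrable (hit rt) v"
  shows "h (\<lambda>\<xi>. u \<xi> + v \<xi> * r) x = h u x + h v x * r"
proof -
  have ci: "cint (\<lambda>\<xi>. u \<xi> + v \<xi> * r) y = cint u y + cint v y * r" for y
    using assms cint_add[of u "\<lambda>\<xi>. v \<xi> * r" y] by (simp add: cint_cmult)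
  show ?thesis
  proof (induction x rule: tree_induct)
    case root then show ?case by (simp add: poisson_rt ci)
  next
    case (child x)
    have int: "integrable (hit rt) (\<lambda>\<xi>. u \<xi> + v \<xi> * r)" using assms by simp
    show ?case
      unfolding poisson_step[OF child.hyps int] poisson_step[OF child.hyps assms(1)]
        poisson_step[OF child.hyps assms(2)] ci child.IH
      by (simp add: algebra_simps)
  qed
qed

lemma HD_lin:
  assumes "u \<in> HD" "v \<in> HD"
  shows "(\<lambda>\<xi>. u \<xi> + v \<xi> * r) \<in> HD"
proof -
  have i: "integrable (hit rt) u" "integrable (hit rt) v" using assms by (auto simp: HD_domain_def)
  have s: "(\<lambda>x. 2 * en u x + (2 * r\<^sup>2) * en v x) summable_on (UNIV - {rt})"
    using assms by (intro summable_on_add summable_on_cmult_right) (auto simp: HD_domain_def)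
  have "en (\<lambda>\<xi>. u \<xi> + v \<xi> * r) summable_on (UNIV - {rt})"
  proof (rule summable_on_comparison_test[OF s])
    fix x assume "x \<in> UNIV - {rt}"
    then have a: "0 < a x" using a_pos by simp
    define d d' where "d = h u x - h u (par x)" and "d' = h v x - h v (par x)"
    have "h (\<lambda>\<xi>. u \<xi> + v \<xi> * r) x - h (\<lambda>\<xi>. u \<xi> + v \<xi> * r) (par x) = d + d' * r"
      unfolding poisson_lin[OF i] d_def d'_def by (simp add: algebra_simps)
    moreover have "(d + d' * r)\<^sup>2 * a x \<le> (2 * d\<^sup>2 + 2 * r\<^sup>2 * d'\<^sup>2) * a x"
    proof (rule mult_right_mono)
      have "0 \<le> (d - d' * r)\<^sup>2" by simp
      then show "(d + d' * r)\<^sup>2 \<le> 2 * d\<^sup>2 + 2 * r\<^sup>2 * d'\<^sup>2"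
        by (simp add: power2_eq_square algebra_simps)
    qed (use a in simp)
    ultimately show "en (\<lambda>\<xi>. u \<xi> + v \<xi> * r) x \<le> 2 * en u x + 2 * r\<^sup>2 * en v x"
      by (simp add: d_def[symmetric] d'_def[symmetric] algebra_simps)
    show "0 \<le> en (\<lambda>\<xi>. u \<xi> + v \<xi> * r) x" using a by simp
  qed
  then show ?thesis using i by (simp add: HD_domain_def)
qed

lemma polarized_identity:
  assumes u: "u \<in> HD" and v: "v \<in> HD"
  shows "energy_HD par rt p u v = standard_form par rt g (hit rt) u v"
proof -
  have i: "integrable (hit rt) u" "integrable (hit rt) v" using assms by (auto simp: HD_domain_def)
  define w where "w r \<xi> = u \<xi> + v \<xi> * r" for r \<xi>
  have w: "w r \<in> HD" for r unfolding w_def[abs_def] by (rule HD_lin[OF u v])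
  define E where "E r = (\<Sum>\<^sub>\<infinity>x\<in>UNIV - {rt}. en (w r) x)" for r
  have s: "(en (w r) has_sum E r) (UNIV - {rt})" for r
    using w[of r] unfolding E_def by (intro has_sum_infsum) (simp add: HD_domain_def)
  have pt: "1/4 * en (w 1) x + (-1/4) * en (w (-1)) x = (h u x - h u (par x)) * (h v x - h v (par x)) * a x" for x
    unfolding w_def[abs_def] poisson_lin[OF i] by (simp add: power2_eq_square algebra_simps)
  have "((\<lambda>x. 1/4 * en (w 1) x + (-1/4) * en (w (-1)) x) has_sum (1/4 * E 1 + (-1/4) * E (-1))) (UNIV - {rt})"
    by (intro has_sum_add has_sum_cmult_right s)
  then have lhs: "energy_HD par rt p u v = 1/4 * E 1 + (-1/4) * E (-1)"
    unfolding pt energy_HD_def energy_T_def by (rule infsumI)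
  let ?f = "\<lambda>r z. (w r (fst z) - w r (snd z))\<^sup>2 * J (fst z) (snd z)"
  have q: "has_bochner_integral (hit rt \<Otimes>\<^sub>M hit rt) (?f r) (2 * E r)" for r
    unfolding E_def by (rule quadratic_identity[OF w])
  have fe: "1/4 * ?f 1 z + (-1/4) * ?f (-1) z = (\<lambda>(\<xi>, \<eta>). (u \<xi> - u \<eta>) * (v \<xi> - v \<eta>) * J \<xi> \<eta>) z" for z
    by (simp add: w_def split_beta power2_eq_square algebra_simps)
  have "has_bochner_integral (hit rt \<Otimes>\<^sub>M hit rt) (\<lambda>z. 1/4 * ?f 1 z + (-1/4) * ?f (-1) z) (1/4 * (2 * E 1) + (-1/4) * (2 * E (-1)))"
    by (intro has_bochner_integral_add has_bochner_integral_mult_right q)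
  then have "has_bochner_integral (hit rt \<Otimes>\<^sub>M hit rt) (\<lambda>(\<xi>, \<eta>). (u \<xi> - u \<eta>) * (v \<xi> - v \<eta>) * J \<xi> \<eta>) (1/4 * (2 * E 1) + (-1/4) * (2 * E (-1)))"
    unfolding fe by (simp add: eta_contract_eq)
  \<comment> \<open>The polarized integrand is integrable on the product space as a combination of
    two integrable ones, so Fubini yields the iterated integral in
    \<open>standard_form\<close>.\<close>
  then have "(\<integral>\<xi>. (\<integral>\<eta>. (u \<xi> - u \<eta>) * (v \<xi> - v \<eta>) * J \<xi> \<eta> \<partial>hit rt) \<partial>hit rt) = 1/4 * (2 * E 1) + (-1/4) * (2 * E (-1))"
    by (subst pair.integral_fst) (auto simp: has_bochner_integral_iff)
  then show ?thesis
    unfolding lhs standard_form_def by simp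
qed

end

theorem theorem4p1:
  fixes par :: "'v \<Rightarrow> 'v" and rt :: 'v and p :: "'v \<Rightarrow> 'v \<Rightarrow> real"
  assumes tree: "rooted_tree par rt"
    and infinite_tree: "infinite (UNIV :: 'v set)"
    and locally_finite: "\<forall>x. finite (nbrs par rt x)"
    and fdeg: "\<forall>x. card (children par rt x) \<ge> 2"
    and walk: "nn_random_walk par rt p"
    and trans: "transient par rt p"
    and F_lt1: "\<forall>x. x \<noteq> rt \<longrightarrow> Fhit par rt p x (par x) < 1"
    and G_vanish: "\<forall>\<epsilon>>0. \<exists>S. finite S \<and> (\<forall>x. x \<notin> S \<longrightarrow> Green par rt p x rt < \<epsilon>)"
  shows "ultrametric_element par rt (\<lambda>x. Green par rt p x rt) \<and>
         (\<forall>\<phi>\<in>HD_domain par rt p. \<forall>\<psi>\<in>HD_domain par rt p.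
            energy_HD par rt p \<phi> \<psi> =
            standard_form par rt (\<lambda>x. Green par rt p x rt) (hit_distr par rt p rt) \<phi> \<psi>)"
proof -
  interpret vanishing_green_walk par rt p
    by unfold_locales (fact tree locally_finite fdeg walk trans F_lt1 G_vanish)+
  show ?thesis using ultrametric_g polarized_identity by blast
qed

end
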